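(* Let $b\ge1$ be an integer. For every $c>0$ there exists a real number $g(c)$ such that $\lim_{n\to\infty}\mathcal M_w(n,c,b)/n=g(c)$ with high probability, i.e. for every $\epsilon>0$ $$\mathbb P\Big\{\Big|\frac{\mathcal M_w(n,c,b)}{n}-g(c)\Big|>\epsilon\Big\}\to0\qquad\text{as }n\to\infty,$$ where the probability is with respect to both the random graph and the random weights.
   Context: $G(n,cn)$ denotes the simple undirected random graph on nodes $\{1,\dots,n\}$ with $cn$ edges (with the convention $\lfloor cn\rfloor$) selected uniformly at random from all $n(n-1)/2$ possible edges. Its edges carry random nonnegative weights $W_{i,j}$, drawn independently (of each other and of the graph) from a common fixed probability distribution supported in a bounded interval $[0,B_w]$, $B_w<\infty$. A $b$-matching is a set of edges such that every node is incident to at most $b$ of them; its weight is the sum of the weights of its edges. $\mathcal M_w(n,c,b)$ is the maximum weight of a $b$-matching in $G(n,cn)$. *)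

theory Defs
  imports "HOL-Probability.Probability"
begin

definition all_edges :: "nat \<Rightarrow> nat set set" where
  "all_edges n = {e. e \<subseteq> {1..n} \<and> card e = 2}"

definition graphs_with_edges :: "nat \<Rightarrow> nat \<Rightarrow> nat set set set" where
  "graphs_with_edges n m = {E. E \<subseteq> all_edges n \<and> card E = m}"

(* A graph is identified with its edge set.  If n is so small that there is no graph with
   \<lfloor>c * n\<rfloor> edges, this is the zero measure on the empty space; see prob_space_weighted_graph. *)
definition random_graph :: "nat \<Rightarrow> real \<Rightarrow> nat set set measure" where
  "random_graph n c = uniform_count_measure (graphs_with_edges n (nat \<lfloor>c * real n\<rfloor>))"

(* i.i.d. weights are attached to all potential edges, independently of the graph;
   only the weights of edges present in the graph are ever used. *)
definition weighted_graph :: "real measure \<Rightarrow> nat \<Rightarrow> real \<Rightarrow> (nat set set \<times> (nat set \<Rightarrow> real)) measure" where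
  "weighted_graph D n c = random_graph n c \<Otimes>\<^sub>M (\<Pi>\<^sub>M e\<in>all_edges n. D)"

(* Meant for finite E only: card is 0 on infinite sets. *)
definition b_matching :: "nat \<Rightarrow> 'a set set \<Rightarrow> 'a set set \<Rightarrow> bool" where
  "b_matching b E F \<longleftrightarrow> F \<subseteq> E \<and> (\<forall>v. card {e \<in> F. v \<in> e} \<le> b)"

definition max_weight_b_matching :: "nat \<Rightarrow> 'a set set \<Rightarrow> ('a set \<Rightarrow> real) \<Rightarrow> real" where
  "max_weight_b_matching b E w = Max ((\<lambda>F. \<Sum>e\<in>F. w e) ` {F. b_matching b E F})"

lemma finite_all_edges [simp]: "finite (all_edges n)"
  unfolding all_edges_def by (rule finite_subset[of _ "Pow {1..n}"]) auto

lemma card_all_edges: "card (all_edges n) = n choose 2"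
  unfolding all_edges_def using n_subsets[of "{1..n}" 2] by simp

lemma finite_graphs_with_edges [simp]: "finite (graphs_with_edges n m)"
  unfolding graphs_with_edges_def by (rule finite_subset[of _ "Pow (all_edges n)"]) auto

lemma graphs_with_edges_nonempty:
  assumes "m \<le> n choose 2"
  shows "graphs_with_edges n m \<noteq> {}"
  using obtain_subset_with_card_n[of m "all_edges n"] assms
  unfolding graphs_with_edges_def card_all_edges by blast

lemma finite_b_matchings:
  assumes "finite E"
  shows "finite {F. b_matching b E F}"
  by (rule finite_subset[of _ "Pow E"]) (use assms in \<open>auto simp: b_matching_def\<close>)

lemma b_matching_empty: "b_matching b E {}"
  by (simp add: b_matching_def)

lemma prob_space_weighted_graph:
  assumes "prob_space D"
  shows "\<forall>\<^sub>F n in sequentially. prob_space (weighted_graph D n c)"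
proof -
  have "eventually (\<lambda>n. n \<ge> nat \<lceil>2 * \<bar>c\<bar>\<rceil> + 1) sequentially"
    by (rule eventually_ge_at_top)
  then show ?thesis
  proof eventually_elim
    case (elim n)
    then have n: "2 * \<bar>c\<bar> \<le> real n - 1" by linarith
    have "c * real n \<le> \<bar>c\<bar> * real n" by (simp add: mult_right_mono)
    also have "\<dots> \<le> (real n - 1) / 2 * real n"
      using n by (intro mult_right_mono) auto
    also have "\<dots> = real (n choose 2)"
      using elim by (simp add: choose_two real_of_nat_div of_nat_diff mult.commute)
    finally have "nat \<lfloor>c * real n\<rfloor> \<le> n choose 2" by linarith
    then interpret G: prob_space "random_graph n c"
      unfolding random_graph_def
      by (intro prob_space_uniform_count_measure graphs_with_edges_nonempty) auto
    interpret W: prob_space "\<Pi>\<^sub>M e\<in>all_edges n. D"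
      by (intro prob_space_PiM assms)
    interpret pair_prob_space "random_graph n c" "\<Pi>\<^sub>M e\<in>all_edges n. D" ..
    show ?case unfolding weighted_graph_def by (rule prob_space_axioms)
  qed
qed

lemma borel_measurable_max_weight_b_matching:
  assumes D: "sets D = sets borel"
  shows "(\<lambda>(E, w). max_weight_b_matching b E w) \<in> borel_measurable (weighted_graph D n c)"
proof -
  let ?A = "graphs_with_edges n (nat \<lfloor>c * real n\<rfloor>)"
  have 1: "(\<lambda>w. max_weight_b_matching b E w) \<in> borel_measurable (\<Pi>\<^sub>M e\<in>all_edges n. D)"
    if E: "E \<in> ?A" for E
  proof -
    have EA: "E \<subseteq> all_edges n" using E by (auto simp: graphs_with_edges_def)
    then have fin: "finite E" by (rule finite_subset) simp
    have comp: "(\<lambda>w. w e) \<in> borel_measurable (\<Pi>\<^sub>M e\<in>all_edges n. D)" if "e \<in> E" for e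
      using measurable_component_singleton[of e "all_edges n" "\<lambda>_. D"] that EA
      by (auto cong: measurable_cong_sets simp: D)
    show ?thesis
      unfolding max_weight_b_matching_def
      by (intro borel_measurable_Max finite_b_matchings fin borel_measurable_sum comp)
         (auto simp: b_matching_def)
  qed
  have sets_A: "sets (random_graph n c) = sets (count_space ?A)"
    by (simp add: random_graph_def sets_uniform_count_measure)
  have "(\<lambda>(E, w). max_weight_b_matching b E w)
      \<in> borel_measurable (count_space ?A \<Otimes>\<^sub>M (\<Pi>\<^sub>M e\<in>all_edges n. D))"
    by (rule measurable_pair_measure_countable1) (auto simp: 1 countable_finite)
  then show ?thesis
    unfolding weighted_graph_def
    using measurable_cong_sets[OF sets_pair_measure_cong[OF sets_A refl] refl] by blast
qed

end

theory Submission
  imports Defs "HOL-Real_Asymp.Real_Asymp"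
begin

text \<open>
  The proof combines three facts: the normalised mean converges, the variance of the optimum is O(n), and
  Chebyshev's inequality turns both into convergence in probability.

  The mean.  The maximum weight of a b-matching is a global quantity, but it can be read off locally up
  to an error that is small compared with n.  Relax the problem to edge variables in [0, 1].  The dual
  problem asks for vertex prices, and projected subgradient descent solves it with an accuracy per vertex
  that depends on the step size, the number T of steps and the mean squared degree, but not on n.  The edges demanded along the way,
  averaged over time, form a nearly feasible and nearly optimal primal solution, and the values around a vertex depend only
  on the ball of radius T around it.  Together with weak duality this replaces strong
  duality.  Passing back to integral solutions costs at most the bound on the weights per cycle of a family of
  disjoint cycles, since a solution that admits no further rounding without loss is fractional exactly on
  such a family.  Long disjoint cycles are few because they use up vertices, and short cycles are rare in a
  sparse random graph.  The result is \<open>max_weight_b_matching_local_approximation\<close>.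

  Averages of a local functional over the vertices converge in mean (\<open>local_average_convergent\<close>).
  The probability that the ball around a vertex is a given labelled graph is a quotient of binomial
  coefficients; multiplied by the number of possible labellings and divided by n it converges, because a
  connected graph on k vertices has at least k - 1 edges.  Large balls can be neglected since the mean
  size of a ball is bounded.  Hence the mean of the optimum per vertex is arbitrarily close to convergent
  sequences and so converges itself (\<open>mean_max_convergent\<close>).

  The fluctuations.  Changing one weight, or replacing one edge, changes the optimum by at most the bound B
  on the weights.  Arguments of Efron--Stein type for independent weights and for uniformly random
  edge sets bound the variance by 2 m B squared, where m is the number of edges
  (\<open>clipped_max_concentration\<close>).
\<close>

section \<open>Rounding fractional b-matchings\<close>

text \<open>
  More unknowns than equations leave a nonzero solution: Gaussian elimination, one equation at a time.
\<close>

lemma kernel_vector: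
  fixes a :: "'i \<Rightarrow> 'j \<Rightarrow> real"
  assumes "finite I" "finite J" "card I < card J"
  shows "\<exists>z. (\<exists>j\<in>J. z j \<noteq> 0) \<and> (\<forall>i\<in>I. (\<Sum>j\<in>J. a i j * z j) = 0)"
  using assms
proof (induction I arbitrary: J a rule: finite_induct)
  case empty
  then obtain j where "j \<in> J" by fastforce
  then show ?case by (intro exI[of _ "\<lambda>_. 1"]) auto
next
  case (insert i I)
  show ?case
  proof (cases "\<forall>j\<in>J. a i j = 0")
    case True
    with insert.IH[of J a] insert.prems insert.hyps show ?thesis by auto
  next
    case False
    then obtain k where k: "k \<in> J" "a i k \<noteq> 0" by auto
    \<comment> \<open>Eliminate the unknown k by means of equation i.\<close>
    define a' where "a' = (\<lambda>l j. a l j - a l k * a i j / a i k)"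
    have "card I < card (J - {k})" using insert.prems insert.hyps k by simp
    then obtain z where z: "\<exists>j\<in>J - {k}. z j \<noteq> 0" "\<forall>l\<in>I. (\<Sum>j\<in>J - {k}. a' l j * z j) = 0"
      using insert.IH[of "J - {k}" a'] insert.prems by blast
    define s where "s = (\<Sum>j\<in>J - {k}. a i j * z j)"
    define z' where "z' = z(k := - s / a i k)"
    have split: "(\<Sum>j\<in>J. a l j * z' j) = (\<Sum>j\<in>J - {k}. a l j * z j) - a l k * s / a i k" for l
    proof -
      have "(\<Sum>j\<in>J. a l j * z' j) = a l k * z' k + (\<Sum>j\<in>J - {k}. a l j * z' j)"
        using k insert.prems by (simp add: sum.remove)
      also have "(\<Sum>j\<in>J - {k}. a l j * z' j) = (\<Sum>j\<in>J - {k}. a l j * z j)"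
        by (intro sum.cong) (auto simp: z'_def)
      finally show ?thesis by (simp add: z'_def)
    qed
    have "(\<Sum>j\<in>J. a l j * z' j) = 0" if "l \<in> insert i I" for l
    proof (cases "l = i")
      case True
      then show ?thesis using k by (simp add: split s_def)
    next
      case False
      then have "(\<Sum>j\<in>J - {k}. a' l j * z j) = 0" using that z by auto
      moreover have "(\<Sum>j\<in>J - {k}. a' l j * z j) = (\<Sum>j\<in>J - {k}. a l j * z j) - a l k * s / a i k"
        by (simp add: a'_def s_def algebra_simps sum_subtractf sum_distrib_left sum_divide_distrib)
      ultimately show ?thesis by (simp add: split)
    qed
    moreover have "\<exists>j\<in>J. z' j \<noteq> 0" using z(1) by (auto simp: z'_def)
    ultimately show ?thesis by blast
  qed
qed

text \<open>
  The slacks of finitely many linear constraints, currently positive numbers p, change at rates q along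
  a line.  If some slack decreases, then there is a first time at which one of them vanishes.
\<close>

lemma step_to_boundary:
  fixes P :: "(real \<times> real) set"
  assumes "finite P" "\<And>p q. (p, q) \<in> P \<Longrightarrow> p > 0" "\<exists>(p, q)\<in>P. q < 0"
  shows "\<exists>s>0. (\<forall>(p, q)\<in>P. p + s * q \<ge> 0) \<and> (\<exists>(p, q)\<in>P. p + s * q = 0)"
proof -
  define N where "N = {(p, q) \<in> P. q < 0}"
  define s where "s = Min ((\<lambda>(p, q). p / - q) ` N)"
  have N: "finite N" "N \<noteq> {}" using assms unfolding N_def by (auto intro: finite_subset)
  have "s \<in> (\<lambda>(p, q). p / - q) ` N" unfolding s_def using N by (intro Min_in) auto
  then obtain p q where pq: "(p, q) \<in> P" "q < 0" "s = p / - q" by (auto simp: N_def)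
  have s0: "s > 0" using assms(2)[OF pq(1)] pq by (simp add: divide_pos_neg)
  have "p' + s * q' \<ge> 0" if "(p', q') \<in> P" for p' q'
  proof (cases "q' < 0")
    case True
    then have "s \<le> p' / - q'" unfolding s_def using N that by (intro Min_le) (auto simp: N_def image_iff)
    then have "s * - q' \<le> p'" using True by (subst (asm) pos_le_divide_eq) auto
    then show ?thesis by simp
  next
    case False
    then show ?thesis using s0 assms(2)[OF that] by (simp add: add_nonneg_nonneg order.strict_implies_order)
  qed
  moreover have "p + s * q = 0" using pq by (simp add: field_simps)
  ultimately show ?thesis using s0 pq(1) by (intro exI[of _ s]) auto
qed

definition fractional_b_matching :: "nat \<Rightarrow> 'a set set \<Rightarrow> ('a set \<Rightarrow> real) \<Rightarrow> bool" where
  "fractional_b_matching b E x \<longleftrightarrow>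
     (\<forall>e\<in>E. 0 \<le> x e \<and> x e \<le> 1) \<and> (\<forall>v. (\<Sum>e\<in>{e\<in>E. v \<in> e}. x e) \<le> real b)"

definition fractional_edges :: "'a set set \<Rightarrow> ('a set \<Rightarrow> real) \<Rightarrow> 'a set set" where
  "fractional_edges E x = {e\<in>E. 0 < x e \<and> x e < 1}"

text \<open>
  Only endpoints of fractional edges count.  A rounding step decreases the number of fractional edges
  plus the number of these vertices.
\<close>

definition slack_vertices :: "nat \<Rightarrow> 'a set set \<Rightarrow> ('a set \<Rightarrow> real) \<Rightarrow> 'a set" where
  "slack_vertices b E x = {v \<in> \<Union>(fractional_edges E x). (\<Sum>e\<in>{e\<in>E. v \<in> e}. x e) < real b}"

text \<open>
  In a finite graph, a two-regular edge set is a vertex-disjoint union of cycles.  This degree condition is all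
  that the argument knows about cycles; no paths occur in it.
\<close>

definition two_regular :: "'a set set \<Rightarrow> bool" where
  "two_regular H \<longleftrightarrow> (\<forall>v\<in>\<Union>H. card {e\<in>H. v \<in> e} = 2)"

lemma sum_incidence:
  fixes g :: "'a \<Rightarrow> 'a set \<Rightarrow> 'b :: comm_monoid_add"
  assumes "finite V" "finite E" "\<And>e. e \<in> E \<Longrightarrow> e \<subseteq> V"
  shows "(\<Sum>v\<in>V. \<Sum>e\<in>{e\<in>E. v \<in> e}. g v e) = (\<Sum>e\<in>E. \<Sum>v\<in>e. g v e)"
proof -
  have "(\<Sum>v\<in>V. \<Sum>e\<in>{e\<in>E. v \<in> e}. g v e) = (\<Sum>e\<in>E. \<Sum>v\<in>{v\<in>V. v \<in> e}. g v e)"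
    using sum.swap_restrict[OF assms(1,2), of g "\<lambda>v e. v \<in> e"] .
  also have "\<dots> = (\<Sum>e\<in>E. \<Sum>v\<in>e. g v e)"
    using assms(3) by (intro sum.cong refl) auto
  finally show ?thesis .
qed

lemma handshake:
  assumes "finite E" "\<And>e. e \<in> E \<Longrightarrow> card e = 2" "finite V" "\<And>e. e \<in> E \<Longrightarrow> e \<subseteq> V"
  shows "(\<Sum>v\<in>V. card {e\<in>E. v \<in> e}) = 2 * card E"
proof -
  have "(\<Sum>v\<in>V. \<Sum>e\<in>{e\<in>E. v \<in> e}. 1::nat) = (\<Sum>e\<in>E. \<Sum>v\<in>e. 1)"
    by (rule sum_incidence) (use assms in auto)
  also have "\<dots> = (\<Sum>e\<in>E. 2)" by (intro sum.cong) (use assms in auto)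
  finally show ?thesis by simp
qed

lemma card_two_regular:
  assumes "finite H" "\<And>e. e \<in> H \<Longrightarrow> card e = 2" "two_regular H"
  shows "card (\<Union>H) = card H"
proof -
  have fin: "finite (\<Union>H)" using assms by (intro finite_Union) (simp_all add: card_ge_0_finite)
  have "2 * card H = (\<Sum>v\<in>\<Union>H. card {e\<in>H. v \<in> e})"
    by (rule handshake[symmetric]) (use assms fin in auto)
  also have "\<dots> = (\<Sum>v\<in>\<Union>H. 2)" using assms by (intro sum.cong) (auto simp: two_regular_def)
  finally show ?thesis by simp
qed

text \<open>
  The edge set H of fractional edges has at most as many edges as saturated vertices unless some nonzero
  vector on H leaves the load of every saturated vertex unchanged.  Moving along that vector, in the
  direction that does not lose weight, makes an edge integral or saturates a further vertex.  If there
  is no such vector, count degrees in H: since b is an integer, a saturated vertex meets at least two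
  fractional edges, and every other endpoint meets at least one; as there are no more edges than
  saturated vertices, the handshake identity forces all degrees to be exactly two.
\<close>

lemma fractional_reduction_step:
  fixes w :: "'a set \<Rightarrow> real"
  assumes E: "finite E" "\<And>e. e \<in> E \<Longrightarrow> card e = 2"
    and x: "fractional_b_matching b E x"
    and not_reg: "\<not> two_regular (fractional_edges E x)"
  shows "\<exists>x'. fractional_b_matching b E x' \<and> (\<Sum>e\<in>E. w e * x' e) \<ge> (\<Sum>e\<in>E. w e * x e) \<and>
           fractional_edges E x' \<subseteq> fractional_edges E x \<and>
           card (fractional_edges E x') + card (slack_vertices b E x') <
           card (fractional_edges E x) + card (slack_vertices b E x)"
proof -
  define H where "H = fractional_edges E x"
  define W where "W = \<Union>H"
  define load where "load = (\<lambda>x v. \<Sum>e\<in>{e\<in>E. v \<in> e}. x e :: real)"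
  define S where "S = slack_vertices b E x"
  define T where "T = W - S"
  have finH: "finite H" using E unfolding H_def fractional_edges_def by auto
  have HE: "H \<subseteq> E" unfolding H_def fractional_edges_def by auto
  have Hx: "0 < x e" "x e < 1" if "e \<in> H" for e using that unfolding H_def fractional_edges_def by auto
  have H2: "card e = 2" if "e \<in> H" for e using that HE E by auto
  have finW: "finite W" unfolding W_def using H2 finH by (intro finite_Union) (simp_all add: card_ge_0_finite)
  have SW: "S \<subseteq> W" by (auto simp: S_def W_def H_def slack_vertices_def)
  have S_less: "load x v < b" if "v \<in> S" for v using that by (auto simp: S_def slack_vertices_def load_def)
  have le_b: "load x v \<le> b" for v using x by (auto simp: fractional_b_matching_def load_def)
  have T_eq: "load x v = b" if "v \<in> T" for v
    using that le_b[of v] unfolding T_def S_def slack_vertices_def W_def H_def load_def by auto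
  have deg1: "card {e\<in>H. v \<in> e} \<ge> 1" if "v \<in> W" for v
  proof -
    have "{e\<in>H. v \<in> e} \<noteq> {}" using that unfolding W_def by auto
    then show ?thesis using finH by (simp add: Suc_le_eq card_gt_0_iff)
  qed
  have deg2: "card {e\<in>H. v \<in> e} \<ge> 2" if "v \<in> T" for v
  proof (rule ccontr)
    assume "\<not> ?thesis"
    moreover have "v \<in> W" using that by (simp add: T_def)
    ultimately have "card {e\<in>H. v \<in> e} = 1" using deg1[of v] by linarith
    then obtain f where f: "{e\<in>H. v \<in> e} = {f}" by (auto simp: card_1_singleton_iff)
    then have fE: "f \<in> {e\<in>E. v \<in> e}" and fH: "f \<in> H" using HE by auto
    have 01: "x e \<in> \<int>" if "e \<in> {e\<in>E. v \<in> e} - {f}" for e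
    proof -
      have "e \<in> E" "e \<notin> H" using that f by auto
      then have "x e = 0 \<or> x e = 1"
        using x unfolding H_def fractional_edges_def fractional_b_matching_def by force
      then show ?thesis by auto
    qed
    have "load x v = x f + (\<Sum>e\<in>{e\<in>E. v \<in> e} - {f}. x e)"
      unfolding load_def using E by (intro sum.remove[OF _ fE]) auto
    moreover have "(\<Sum>e\<in>{e\<in>E. v \<in> e} - {f}. x e) \<in> \<int>" using 01 by (rule Ints_sum)
    ultimately have "x f \<in> \<int>" using T_eq[OF that] by (metis Ints_diff Ints_of_nat add_diff_cancel_right')
    then show False using Hx[OF fH] by (auto elim!: Ints_cases)
  qed
  \<comment> \<open>Otherwise the degree count would make H two-regular.\<close>
  have "card T < card H"
  proof (rule ccontr)
    assume ge: "\<not> card T < card H"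
    have fT: "finite T" unfolding T_def using finW by auto
    have "2 * card H = (\<Sum>v\<in>W. card {e\<in>H. v \<in> e})"
      by (rule handshake[symmetric]) (use finH H2 finW in \<open>auto simp: W_def\<close>)
    also have "\<dots> = (\<Sum>v\<in>T. card {e\<in>H. v \<in> e}) + (\<Sum>v\<in>S. card {e\<in>H. v \<in> e})"
      using SW finW sum.subset_diff[of S W "\<lambda>v. card {e\<in>H. v \<in> e}"] by (simp add: T_def)
    finally have eq: "2 * card H = \<dots>" .
    have S1: "(\<Sum>v\<in>S. card {e\<in>H. v \<in> e}) \<ge> card S"
      using sum_mono[of S "\<lambda>_. 1" "\<lambda>v. card {e\<in>H. v \<in> e}"] deg1 SW by auto
    have T2: "(\<Sum>v\<in>T. card {e\<in>H. v \<in> e}) \<ge> 2 * card T"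
      using sum_mono[of T "\<lambda>_. 2" "\<lambda>v. card {e\<in>H. v \<in> e}"] deg2 by auto
    have "card S = 0" using eq S1 T2 ge by linarith
    then have "S = {}" using SW finW finite_subset by fastforce
    then have WT: "W = T" by (auto simp: T_def)
    have sumeq: "(\<Sum>v\<in>T. card {e\<in>H. v \<in> e}) = (\<Sum>v\<in>T. 2)"
      using eq S1 T2 ge \<open>S = {}\<close> by simp
    have "card {e\<in>H. v \<in> e} = 2" if "v \<in> T" for v
    proof (rule ccontr)
      assume "card {e\<in>H. v \<in> e} \<noteq> 2"
      then have "card {e\<in>H. v \<in> e} > 2" using deg2[OF that] by linarith
      then have "(\<Sum>v\<in>T. 2) < (\<Sum>v\<in>T. card {e\<in>H. v \<in> e})"
        using fT that deg2 by (intro sum_strict_mono_ex1) auto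
      with sumeq show False by simp
    qed
    then have "two_regular H" by (auto simp: two_regular_def WT[symmetric] W_def)
    with not_reg show False by (simp add: H_def)
  qed
  then obtain z0 :: "'a set \<Rightarrow> real" where z0: "\<exists>e\<in>H. z0 e \<noteq> 0" "\<forall>v\<in>T. (\<Sum>e\<in>H. (if v \<in> e then 1 else 0) * z0 e) = 0"
    using kernel_vector[of T H "\<lambda>v e. if v \<in> e then 1 else 0"] finH finW T_def by blast
  \<comment> \<open>Choose the sign that does not decrease the weight.\<close>
  define z where "z = (\<lambda>e. if e \<in> H then (if (\<Sum>e\<in>H. w e * z0 e) \<ge> 0 then z0 e else - z0 e) else 0)"
  have z_out: "z e = 0" if "e \<notin> H" for e using that by (simp add: z_def)
  have z_ex: "\<exists>e\<in>H. z e \<noteq> 0" using z0(1) by (auto simp: z_def)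
  have wz: "(\<Sum>e\<in>E. w e * z e) \<ge> 0"
  proof -
    have "(\<Sum>e\<in>E. w e * z e) = (\<Sum>e\<in>H. w e * z e)"
      using E HE by (intro sum.mono_neutral_right) (auto simp: z_out)
    also have "\<dots> = \<bar>\<Sum>e\<in>H. w e * z0 e\<bar>"
      by (cases "(\<Sum>e\<in>H. w e * z0 e) \<ge> 0") (simp_all add: z_def sum_negf)
    finally show ?thesis by simp
  qed
  have load_z: "load z v = (\<Sum>e\<in>H. (if v \<in> e then 1 else 0) * z e)" for v
  proof -
    have "(\<Sum>e\<in>H. (if v \<in> e then 1 else 0) * z e) = (\<Sum>e\<in>E. (if v \<in> e then 1 else 0) * z e)"
      using E HE by (intro sum.mono_neutral_left) (auto simp: z_out)
    also have "\<dots> = (\<Sum>e\<in>E. if v \<in> e then z e else 0)" by (intro sum.cong) auto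
    also have "\<dots> = load z v" unfolding load_def using E by (simp add: sum.inter_filter)
    finally show ?thesis by simp
  qed
  have zT: "load z v = 0" if "v \<in> T" for v
  proof -
    have "load z v = (\<Sum>e\<in>H. (if v \<in> e then 1 else 0) * z0 e) *
                      (if (\<Sum>e\<in>H. w e * z0 e) \<ge> 0 then 1 else - 1)"
      unfolding load_z sum_distrib_right by (intro sum.cong) (auto simp: z_def)
    then show ?thesis using z0(2) that by simp
  qed
  \<comment> \<open>Slacks and their rates: lower and upper bounds of fractional edges, capacities of unsaturated vertices.\<close>
  define P where "P = (\<lambda>e. (x e, z e)) ` H \<union> (\<lambda>e. (1 - x e, - z e)) ` H \<union> (\<lambda>v. (b - load x v, - load z v)) ` S"
  have finS: "finite S" using SW finW finite_subset by auto
  have Pneg: "\<exists>(p, q)\<in>P. q < 0"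
  proof -
    obtain e where e: "e \<in> H" "z e \<noteq> 0" using z_ex by auto
    show ?thesis
    proof (cases "z e < 0")
      case True
      then show ?thesis using e unfolding P_def by (intro bexI[of _ "(x e, z e)"]) auto
    next
      case False
      then show ?thesis using e unfolding P_def by (intro bexI[of _ "(1 - x e, - z e)"]) auto
    qed
  qed
  have "\<exists>s>0. (\<forall>(p, q)\<in>P. p + s * q \<ge> 0) \<and> (\<exists>(p, q)\<in>P. p + s * q = 0)"
    by (rule step_to_boundary) (use finS finH Hx S_less Pneg in \<open>auto simp: P_def\<close>)
  then obtain s where s: "s > 0" "\<And>p q. (p, q) \<in> P \<Longrightarrow> p + s * q \<ge> 0" "\<exists>(p, q)\<in>P. p + s * q = 0"
    by auto
  define x' where "x' = (\<lambda>e. x e + s * z e)"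
  have load': "load x' v = load x v + s * load z v" for v
    unfolding load_def x'_def by (simp add: sum.distrib sum_distrib_left)
  have out': "x' e = x e" if "e \<notin> H" for e using that by (simp add: x'_def z_out)
  have in': "0 \<le> x' e" "x' e \<le> 1" if "e \<in> H" for e
    using that s(2)[of "x e" "z e"] s(2)[of "1 - x e" "- z e"] by (auto simp: P_def x'_def)
  have loadW: "load x' v \<le> b" if "v \<in> W" for v
  proof (cases "v \<in> S")
    case True
    then show ?thesis using s(2)[of "b - load x v" "- load z v"] by (auto simp: P_def load')
  next
    case False
    then show ?thesis using that zT[of v] le_b[of v] by (auto simp: T_def load')
  qed
  have feas: "fractional_b_matching b E x'"
    unfolding fractional_b_matching_def
  proof (intro conjI ballI allI)
    fix e assume "e \<in> E"
    then show "0 \<le> x' e" "x' e \<le> 1"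
      using x in'[of e] out'[of e] by (cases "e \<in> H"; auto simp: fractional_b_matching_def)+
  next
    fix v
    show "(\<Sum>e\<in>{e\<in>E. v \<in> e}. x' e) \<le> b"
    proof (cases "v \<in> W")
      case True then show ?thesis using loadW unfolding load_def by simp
    next
      case False
      then have "(\<Sum>e\<in>{e\<in>E. v \<in> e}. x' e) = (\<Sum>e\<in>{e\<in>E. v \<in> e}. x e)"
        by (intro sum.cong refl out') (auto simp: W_def)
      then show ?thesis using le_b[of v] by (simp add: load_def)
    qed
  qed
  define H' where "H' = fractional_edges E x'"
  define S' where "S' = slack_vertices b E x'"
  have H'H: "H' \<subseteq> H"
  proof
    fix e assume "e \<in> H'"
    then have "e \<in> E" "0 < x' e" "x' e < 1" by (auto simp: H'_def fractional_edges_def)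
    then show "e \<in> H" using out'[of e] by (cases "e \<in> H") (auto simp: H_def fractional_edges_def)
  qed
  have S'S: "S' \<subseteq> S"
  proof
    fix v assume "v \<in> S'"
    then have v: "v \<in> \<Union>H'" "load x' v < b" by (auto simp: S'_def slack_vertices_def H'_def load_def)
    then have "v \<in> W" using H'H by (auto simp: W_def)
    moreover have "v \<notin> T"
    proof
      assume "v \<in> T"
      then show False using v(2) T_eq zT by (simp add: load')
    qed
    ultimately show "v \<in> S" by (auto simp: T_def)
  qed
  have strict: "H' \<subset> H \<or> S' \<subset> S"
  proof -
    obtain p q where pq: "(p, q) \<in> P" "p + s * q = 0" using s(3) by auto
    from pq(1) consider e where "e \<in> H" "p = x e" "q = z e" | e where "e \<in> H" "p = 1 - x e" "q = - z e"
      | v where "v \<in> S" "p = b - load x v" "q = - load z v" by (auto simp: P_def)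
    then show ?thesis
    proof cases
      case 1
      then have "e \<notin> H'" using pq by (simp add: H'_def fractional_edges_def x'_def)
      then show ?thesis using 1 H'H by auto
    next
      case 2
      then have "e \<notin> H'" using pq by (simp add: H'_def fractional_edges_def x'_def)
      then show ?thesis using 2 H'H by auto
    next
      case 3
      then have "load x' v = b" using pq by (simp add: load')
      then have "v \<notin> S'" by (simp add: S'_def slack_vertices_def load_def)
      then show ?thesis using 3 S'S by auto
    qed
  qed
  have "card H' + card S' < card H + card S"
    using strict
  proof
    assume "H' \<subset> H"
    then have "card H' < card H" using finH by (intro psubset_card_mono)
    moreover have "card S' \<le> card S" using finS S'S by (intro card_mono)
    ultimately show ?thesis by simp
  next
    assume "S' \<subset> S"
    then have "card S' < card S" using finS by (intro psubset_card_mono)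
    moreover have "card H' \<le> card H" using finH H'H by (intro card_mono)
    ultimately show ?thesis by simp
  qed
  moreover have "(\<Sum>e\<in>E. w e * x' e) \<ge> (\<Sum>e\<in>E. w e * x e)"
  proof -
    have "(\<Sum>e\<in>E. w e * x' e) = (\<Sum>e\<in>E. w e * x e) + s * (\<Sum>e\<in>E. w e * z e)"
      by (simp add: x'_def algebra_simps sum.distrib sum_distrib_left)
    then show ?thesis using wz s(1) by simp
  qed
  ultimately show ?thesis using feas H'H unfolding H'_def H_def S'_def S_def by blast
qed

lemma fractional_reduction:
  fixes w :: "'a set \<Rightarrow> real"
  assumes E: "finite E" "\<And>e. e \<in> E \<Longrightarrow> card e = 2"
    and x: "fractional_b_matching b E x"
  shows "\<exists>x'. fractional_b_matching b E x' \<and> (\<Sum>e\<in>E. w e * x' e) \<ge> (\<Sum>e\<in>E. w e * x e) \<and>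
           fractional_edges E x' \<subseteq> fractional_edges E x \<and> two_regular (fractional_edges E x')"
  using x
proof (induction "card (fractional_edges E x) + card (slack_vertices b E x)" arbitrary: x rule: less_induct)
  case less
  show ?case
  proof (cases "two_regular (fractional_edges E x)")
    case True
    then show ?thesis using less.prems by blast
  next
    case False
    obtain x1 where x1: "fractional_b_matching b E x1" "(\<Sum>e\<in>E. w e * x1 e) \<ge> (\<Sum>e\<in>E. w e * x e)"
       "fractional_edges E x1 \<subseteq> fractional_edges E x"
       "card (fractional_edges E x1) + card (slack_vertices b E x1) <
           card (fractional_edges E x) + card (slack_vertices b E x)"
      using fractional_reduction_step[OF E less.prems False, of w] by blast
    obtain x2 where "fractional_b_matching b E x2" "(\<Sum>e\<in>E. w e * x2 e) \<ge> (\<Sum>e\<in>E. w e * x1 e)"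
       "fractional_edges E x2 \<subseteq> fractional_edges E x1" "two_regular (fractional_edges E x2)"
      using less.hyps[OF x1(4,1)] by blast
    then show ?thesis using x1 by (intro exI[of _ x2]) auto
  qed
qed

text \<open>
  Nonempty two-regular subgraphs: unions of vertex-disjoint cycles.  The minimal ones are the cycles.
\<close>

definition cycle_sets :: "'a set set \<Rightarrow> 'a set set set" where
  "cycle_sets E = {A. A \<subseteq> E \<and> A \<noteq> {} \<and> two_regular A}"

text \<open>
  A vertex of both parts has both of its H-edges in each of them.  Hence two distinct minimal two-regular
  subsets of H, that is, two cycles, are disjoint.
\<close>

lemma two_regular_Int:
  assumes H: "finite H" "two_regular H" and A: "A \<subseteq> H" "two_regular A" and A': "A' \<subseteq> H" "two_regular A'"
  shows "two_regular (A \<inter> A')"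
  unfolding two_regular_def
proof
  fix v assume v: "v \<in> \<Union>(A \<inter> A')"
  have *: "{e\<in>C. v \<in> e} = {e\<in>H. v \<in> e}" if "C \<subseteq> H" "two_regular C" "v \<in> \<Union>C" for C
  proof (rule card_subset_eq)
    have "v \<in> \<Union>H" using that by auto
    then have "card {e\<in>H. v \<in> e} = 2" using H(2) unfolding two_regular_def by blast
    moreover have "card {e\<in>C. v \<in> e} = 2" using that unfolding two_regular_def by blast
    ultimately show "card {e\<in>C. v \<in> e} = card {e\<in>H. v \<in> e}" by simp
  qed (use that H in auto)
  have "{e\<in>A \<inter> A'. v \<in> e} = {e\<in>A. v \<in> e} \<inter> {e\<in>A'. v \<in> e}" by auto
  also have "\<dots> = {e\<in>H. v \<in> e}" using *[OF A] *[OF A'] v by auto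
  finally have "{e\<in>A \<inter> A'. v \<in> e} = {e\<in>H. v \<in> e}" .
  moreover have "v \<in> \<Union>H" using v A(1) by auto
  ultimately show "card {e\<in>A \<inter> A'. v \<in> e} = 2" using H(2) unfolding two_regular_def by metis
qed

lemma finite_cycle_sets: "finite E \<Longrightarrow> finite (cycle_sets E)"
  by (rule finite_subset[of _ "Pow E"]) (auto simp: cycle_sets_def)

text \<open>
  Pick one edge from each minimal two-regular subset.  These subsets are disjoint, so at most
  card H / L of them have L or more edges, and the others are counted by the first term.
\<close>

lemma cycle_transversal:
  assumes H: "finite H" "two_regular H"
  shows "\<exists>S\<subseteq>H. (\<forall>A\<in>cycle_sets H. S \<inter> A \<noteq> {}) \<and>
           L * card S \<le> L * card {A\<in>cycle_sets H. card A < L} + card H"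
proof -
  define P where "P = {A\<in>cycle_sets H. \<forall>A'\<in>cycle_sets H. A' \<subseteq> A \<longrightarrow> A' = A}"
  have finP: "finite P" unfolding P_def using finite_cycle_sets[OF H(1)] by auto
  have ne: "A \<noteq> {}" "A \<subseteq> H" if "A \<in> P" for A using that by (auto simp: P_def cycle_sets_def)
  have disj: "A \<inter> A' = {}" if "A \<in> P" "A' \<in> P" "A \<noteq> A'" for A A'
  proof (rule ccontr)
    assume "A \<inter> A' \<noteq> {}"
    moreover have "two_regular (A \<inter> A')"
      by (rule two_regular_Int[OF H]) (use that in \<open>auto simp: P_def cycle_sets_def\<close>)
    ultimately have "A \<inter> A' \<in> cycle_sets H" using ne[OF that(1)] by (auto simp: cycle_sets_def)
    then have "A \<inter> A' = A" "A \<inter> A' = A'" using that by (auto simp: P_def)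
    with that show False by auto
  qed
  \<comment> \<open>One edge from each cycle.\<close>
  define pick where "pick = (\<lambda>A::'a set set. SOME e. e \<in> A)"
  have pick: "pick A \<in> A" if "A \<in> P" for A using ne(1)[OF that] by (auto simp: pick_def some_in_eq)
  have hit: "pick ` P \<inter> A \<noteq> {}" if A: "A \<in> cycle_sets H" for A
  proof -
    have "\<exists>A'\<in>{A'\<in>cycle_sets H. A' \<subseteq> A}. \<forall>C\<in>{A'\<in>cycle_sets H. A' \<subseteq> A}. C \<le> A' \<longrightarrow> A' = C"
      by (rule finite_has_minimal) (use A finite_cycle_sets[OF H(1)] in auto)
    then obtain A' where A': "A' \<in> cycle_sets H" "A' \<subseteq> A"
      "\<And>C. C \<in> cycle_sets H \<Longrightarrow> C \<subseteq> A \<Longrightarrow> C \<subseteq> A' \<Longrightarrow> A' = C" by auto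
    then have "A' \<in> P" unfolding P_def by (auto)
    then show ?thesis using pick A'(2) by blast
  qed
  have "L * card (pick ` P) \<le> L * card P" by (intro mult_le_mono2 card_image_le finP)
  also have "card P = card {A\<in>P. card A < L} + card {A\<in>P. \<not> card A < L}"
    using finP by (subst card_Un_disjoint[symmetric]) (auto intro!: arg_cong[of _ _ card])
  also have "L * \<dots> = L * card {A\<in>P. card A < L} + L * card {A\<in>P. \<not> card A < L}"
    by (simp add: algebra_simps)
  also have "card {A\<in>P. card A < L} \<le> card {A\<in>cycle_sets H. card A < L}"
    using finite_cycle_sets[OF H(1)] by (intro card_mono) (auto simp: P_def)
  also have "L * card {A\<in>P. \<not> card A < L} \<le> (\<Sum>A\<in>{A\<in>P. \<not> card A < L}. card A)"
    using sum_mono[of "{A\<in>P. \<not> card A < L}" "\<lambda>_. L" card] by (simp add: mult.commute)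
  also have "\<dots> = card (\<Union>{A\<in>P. \<not> card A < L})"
    by (rule card_Union_disjoint[symmetric])
       (use disj finite_subset[OF ne(2) H(1)] in \<open>auto simp: pairwise_def disjnt_def\<close>)
  also have "\<dots> \<le> card H" by (rule card_mono) (use H ne in auto)
  finally have "L * card (pick ` P) \<le> L * card {A\<in>cycle_sets H. card A < L} + card H" by simp
  moreover have "pick ` P \<subseteq> H" using pick ne by blast
  ultimately show ?thesis using hit by (intro exI[of _ "pick ` P"] conjI ballI) assumption+
qed

lemma max_weight_b_matching_ge:
  assumes "finite E" "b_matching b E F"
  shows "(\<Sum>e\<in>F. w e) \<le> max_weight_b_matching b E w"
  unfolding max_weight_b_matching_def
  by (intro Max_ge finite_imageI finite_b_matchings assms imageI) (use assms in auto)

lemma max_weight_b_matching_attained: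
  assumes "finite E"
  obtains F where "b_matching b E F" "max_weight_b_matching b E w = (\<Sum>e\<in>F. w e)"
proof -
  have "max_weight_b_matching b E w \<in> (\<lambda>F. \<Sum>e\<in>F. w e) ` {F. b_matching b E F}"
    unfolding max_weight_b_matching_def
    by (intro Max_in finite_imageI finite_b_matchings assms) (use b_matching_empty in auto)
  then show thesis using that by auto
qed

lemma integral_weight_le_max_weight_b_matching:
  assumes E: "finite E" and x: "fractional_b_matching b E x" and int: "fractional_edges E x = {}"
  shows "(\<Sum>e\<in>E. w e * x e) \<le> max_weight_b_matching b E w"
proof -
  define F where "F = {e\<in>E. x e = 1}"
  have x01: "x e = 1 \<or> x e = 0" if "e \<in> E" for e
    using x int that unfolding fractional_edges_def fractional_b_matching_def by force
  have "b_matching b E F" unfolding b_matching_def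
  proof (intro conjI allI)
    fix v
    have "real (card {e\<in>F. v \<in> e}) = (\<Sum>e\<in>{e\<in>F. v \<in> e}. 1)" by simp
    also have "\<dots> = (\<Sum>e\<in>{e\<in>E. v \<in> e}. x e)"
      by (rule sum.mono_neutral_cong_left) (use E in \<open>auto simp: F_def dest: x01\<close>)
    also have "\<dots> \<le> b" using x by (simp add: fractional_b_matching_def)
    finally show "card {e\<in>F. v \<in> e} \<le> b" by simp
  qed (auto simp: F_def)
  moreover have "(\<Sum>e\<in>F. w e) = (\<Sum>e\<in>E. w e * x e)"
    by (rule sum.mono_neutral_cong_left) (use E in \<open>auto simp: F_def dest: x01\<close>)
  ultimately show ?thesis using max_weight_b_matching_ge[OF E, of b F w] by simp
qed

text \<open>
  The gap between the linear relaxation and the combinatorial optimum comes from cycles only.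
  The remaining fractional edges are two-regular; setting one edge of each cycle to zero costs at most
  B per cycle, and reducing once more must end with an integral solution, because a two-regular set of
  fractional edges would avoid the transversal.  Cycles with at least L edges are disjoint, so there
  are at most card V / L of them; the short ones are rare in a sparse random graph.
\<close>

lemma b_matching_rounding:
  fixes w :: "'a set \<Rightarrow> real"
  assumes V: "finite V" and E: "\<And>e. e \<in> E \<Longrightarrow> e \<subseteq> V \<and> card e = 2"
    and w: "\<And>e. e \<in> E \<Longrightarrow> 0 \<le> w e \<and> w e \<le> B" and B: "B \<ge> 0"
    and x: "fractional_b_matching b E x" and L: "L > 0"
  shows "(\<Sum>e\<in>E. w e * x e) \<le>
           max_weight_b_matching b E w + B * (card {A\<in>cycle_sets E. card A < L} + card V / L)"
proof -
  have finE: "finite E" by (rule finite_subset[of _ "Pow V"]) (use V E in auto)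
  have E2: "\<And>e. e \<in> E \<Longrightarrow> card e = 2" using E by auto
  obtain x1 where x1: "fractional_b_matching b E x1" "(\<Sum>e\<in>E. w e * x1 e) \<ge> (\<Sum>e\<in>E. w e * x e)"
    "two_regular (fractional_edges E x1)"
    using fractional_reduction[OF finE E2 x, of w] by auto
  define H where "H = fractional_edges E x1"
  have HE: "H \<subseteq> E" by (auto simp: H_def fractional_edges_def)
  have finH: "finite H" using HE finE finite_subset by auto
  obtain S where S: "S \<subseteq> H" "\<And>A. A \<in> cycle_sets H \<Longrightarrow> S \<inter> A \<noteq> {}"
    "L * card S \<le> L * card {A\<in>cycle_sets H. card A < L} + card H"
    using cycle_transversal[OF finH, of L] x1(3) by (auto simp: H_def)
  \<comment> \<open>Cut every cycle of fractional edges.\<close>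
  define x2 where "x2 = (\<lambda>e. if e \<in> S then 0 else x1 e)"
  have x1_01: "0 \<le> x1 e" "x1 e \<le> 1" if "e \<in> E" for e
    using x1(1) that by (auto simp: fractional_b_matching_def)
  have x2: "fractional_b_matching b E x2"
    unfolding fractional_b_matching_def
  proof (intro conjI allI ballI)
    fix v
    have "(\<Sum>e\<in>{e\<in>E. v \<in> e}. x2 e) \<le> (\<Sum>e\<in>{e\<in>E. v \<in> e}. x1 e)"
      by (intro sum_mono) (auto simp: x2_def x1_01)
    also have "\<dots> \<le> b" using x1(1) by (simp add: fractional_b_matching_def)
    finally show "(\<Sum>e\<in>{e\<in>E. v \<in> e}. x2 e) \<le> b" .
  qed (auto simp: x2_def x1_01)
  obtain x3 where x3: "fractional_b_matching b E x3" "(\<Sum>e\<in>E. w e * x3 e) \<ge> (\<Sum>e\<in>E. w e * x2 e)"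
    "fractional_edges E x3 \<subseteq> fractional_edges E x2" "two_regular (fractional_edges E x3)"
    using fractional_reduction[OF finE E2 x2, of w] by auto
  have sub: "fractional_edges E x3 \<subseteq> H - S"
    using x3(3) by (auto simp: fractional_edges_def x2_def H_def split: if_splits)
  have "fractional_edges E x3 = {}"
  proof (rule ccontr)
    assume "fractional_edges E x3 \<noteq> {}"
    then have "fractional_edges E x3 \<in> cycle_sets H" using sub x3(4) by (auto simp: cycle_sets_def)
    then show False using S(2) sub by blast
  qed
  then have int: "(\<Sum>e\<in>E. w e * x3 e) \<le> max_weight_b_matching b E w"
    by (intro integral_weight_le_max_weight_b_matching finE x3)
  have "(\<Sum>e\<in>E. w e * x1 e) - (\<Sum>e\<in>E. w e * x2 e) = (\<Sum>e\<in>E. w e * (if e \<in> S then x1 e else 0))"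
    unfolding sum_subtractf[symmetric] by (intro sum.cong) (auto simp: x2_def)
  also have "\<dots> = (\<Sum>e\<in>S. w e * x1 e)"
    by (rule sum.mono_neutral_cong_right) (use finE S(1) HE in auto)
  also have "\<dots> \<le> (\<Sum>e\<in>S. B * 1)"
    using S(1) HE w x1_01 B by (intro sum_mono mult_mono) auto
  finally have loss: "(\<Sum>e\<in>E. w e * x1 e) - (\<Sum>e\<in>E. w e * x2 e) \<le> B * card S" by (simp add: mult.commute)
  have "card {A\<in>cycle_sets H. card A < L} \<le> card {A\<in>cycle_sets E. card A < L}"
    by (rule card_mono[OF finite_subset[OF _ finite_cycle_sets[OF finE]]]) (use HE in \<open>auto simp: cycle_sets_def\<close>)
  moreover have "card H \<le> card V"
  proof -
    have "card H = card (\<Union>H)"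
      by (rule card_two_regular[OF finH, symmetric]) (use x1(3) HE E2 in \<open>auto simp: H_def\<close>)
    also have "\<dots> \<le> card V" using HE E V by (intro card_mono) auto
    finally show ?thesis .
  qed
  ultimately have "L * card S \<le> L * card {A\<in>cycle_sets E. card A < L} + card V"
    using S(3) by (meson add_mono le_trans mult_le_mono2)
  then have "real L * card S \<le> L * card {A\<in>cycle_sets E. card A < L} + card V"
    by (metis of_nat_add of_nat_le_iff of_nat_mult)
  then have "card S \<le> card {A\<in>cycle_sets E. card A < L} + card V / L"
    using L by (simp add: field_simps)
  then have "B * card S \<le> B * (card {A\<in>cycle_sets E. card A < L} + card V / L)"
    using B by (intro mult_left_mono) auto
  then show ?thesis using loss int x3(2) x1(2) by (simp add: algebra_simps)
qed

section \<open>Subgradient descent on vertex prices\<close>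

text \<open>
  Projected subgradient descent with step size \<open>\<eta>\<close> for the dual of the relaxed
  problem, which is to minimise b times the sum of the prices y v plus, over all edges, the positive part
  of the weight minus the prices of the two endpoints.  An edge is demanded when its weight exceeds the
  prices of its endpoints; a vertex raises its price when its demand exceeds b.  One step only uses the
  prices of neighbours, so T steps only use the ball of radius T.
\<close>

fun price :: "nat \<Rightarrow> real \<Rightarrow> 'a set set \<Rightarrow> ('a set \<Rightarrow> real) \<Rightarrow> nat \<Rightarrow> 'a \<Rightarrow> real" where
  "price b \<eta> E w 0 v = 0"
| "price b \<eta> E w (Suc t) v =
     max 0 (price b \<eta> E w t v - \<eta> * (real b -
       (\<Sum>e\<in>{e\<in>E. v \<in> e}. of_bool (w e > (\<Sum>u\<in>e. price b \<eta> E w t u)))))"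

definition demand :: "nat \<Rightarrow> real \<Rightarrow> 'a set set \<Rightarrow> ('a set \<Rightarrow> real) \<Rightarrow> nat \<Rightarrow> 'a set \<Rightarrow> real" where
  "demand b \<eta> E w t e = of_bool (w e > (\<Sum>u\<in>e. price b \<eta> E w t u))"

definition mean_demand :: "nat \<Rightarrow> real \<Rightarrow> nat \<Rightarrow> 'a set set \<Rightarrow> ('a set \<Rightarrow> real) \<Rightarrow> 'a set \<Rightarrow> real" where
  "mean_demand b \<eta> T E w e = (\<Sum>t<T. demand b \<eta> E w t e) / T"

definition degree :: "'a set set \<Rightarrow> 'a \<Rightarrow> nat" where
  "degree E v = card {e\<in>E. v \<in> e}"

lemma price_Suc:
  "price b \<eta> E w (Suc t) v =
     max 0 (price b \<eta> E w t v - \<eta> * (real b - (\<Sum>e\<in>{e\<in>E. v \<in> e}. demand b \<eta> E w t e)))"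
  by (simp add: demand_def)

declare price.simps(2) [simp del]

lemma demand_01: "0 \<le> demand b \<eta> E w t e" "demand b \<eta> E w t e \<le> 1"
  by (auto simp: demand_def)

lemma mean_demand_01: "0 \<le> mean_demand b \<eta> T E w e" "mean_demand b \<eta> T E w e \<le> 1"
proof -
  have "(\<Sum>t<T. demand b \<eta> E w t e) \<le> (\<Sum>t<T. 1)" by (intro sum_mono demand_01)
  then show "mean_demand b \<eta> T E w e \<le> 1" by (cases "T = 0") (simp_all add: mean_demand_def divide_le_eq_1)
  show "0 \<le> mean_demand b \<eta> T E w e" unfolding mean_demand_def by (intro divide_nonneg_nonneg sum_nonneg demand_01) auto
qed

lemma price_nonneg: "price b \<eta> E w t v \<ge> 0"
  by (cases t) (auto simp: price.simps)

lemma demand_sum_bounds: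
  "0 \<le> (\<Sum>e\<in>{e\<in>E. v \<in> e}. demand b \<eta> E w t e)"
  "(\<Sum>e\<in>{e\<in>E. v \<in> e}. demand b \<eta> E w t e) \<le> degree E v"
proof -
  have "(\<Sum>e\<in>{e\<in>E. v \<in> e}. demand b \<eta> E w t e) \<le> (\<Sum>e\<in>{e\<in>E. v \<in> e}. 1)" by (intro sum_mono demand_01)
  then show "(\<Sum>e\<in>{e\<in>E. v \<in> e}. demand b \<eta> E w t e) \<le> degree E v" by (simp add: degree_def)
qed (intro sum_nonneg demand_01)

text \<open>
  A vertex whose price has reached B is no longer demanded, so its price falls; before that, one step
  adds at most \<open>\<eta>\<close> times the degree.
\<close>

lemma price_le:
  assumes "\<And>e. e \<in> E \<Longrightarrow> card e = 2" "\<And>e. e \<in> E \<Longrightarrow> w e \<le> B" "B \<ge> 0" "\<eta> \<ge> 0"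
  shows "price b \<eta> E w t v \<le> B + \<eta> * degree E v"
proof (induction t)
  case 0
  then show ?case using assms by simp
next
  case (Suc t)
  let ?d = "\<Sum>e\<in>{e\<in>E. v \<in> e}. demand b \<eta> E w t e"
  have B: "0 \<le> B + \<eta> * degree E v" using assms by simp
  show ?case
  proof (cases "price b \<eta> E w t v \<ge> B")
    case True
    have "demand b \<eta> E w t e = 0" if "e \<in> {e\<in>E. v \<in> e}" for e
    proof -
      have "finite e" using assms(1)[of e] that by (simp add: card_ge_0_finite)
      then have "price b \<eta> E w t v \<le> (\<Sum>u\<in>e. price b \<eta> E w t u)"
        using that by (intro member_le_sum price_nonneg) auto
      then show ?thesis using True assms(2)[of e] that by (auto simp: demand_def)
    qed
    then have "?d = 0" by simp
    then have "price b \<eta> E w (Suc t) v \<le> max 0 (price b \<eta> E w t v)"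
      unfolding price_Suc using assms(4) by (simp add: le_max_iff_disj price_nonneg)
    then show ?thesis using Suc.IH B by linarith
  next
    case False
    have "\<eta> * (?d - b) \<le> \<eta> * degree E v"
      using demand_sum_bounds(2)[where E=E and v=v and b=b and \<eta>=\<eta> and w=w and t=t] assms(4) by (intro mult_left_mono) auto
    then have "price b \<eta> E w t v - \<eta> * (b - ?d) \<le> B + \<eta> * degree E v"
      using False by (simp add: algebra_simps)
    then show ?thesis unfolding price_Suc using B by simp
  qed
qed

text \<open>
  A bound on the amount by which the averaged demand can exceed b: the largest possible price divided
  by the total step length.
\<close>

definition violation :: "real \<Rightarrow> real \<Rightarrow> nat \<Rightarrow> 'a set set \<Rightarrow> 'a \<Rightarrow> real" where
  "violation B \<eta> T E v = (B + \<eta> * degree E v) / (\<eta> * T)"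

text \<open>
  The price of a vertex is at least \<open>\<eta>\<close> times its accumulated excess demand, and prices are bounded.
\<close>

lemma mean_demand_nearly_feasible:
  assumes "\<And>e. e \<in> E \<Longrightarrow> card e = 2" "\<And>e. e \<in> E \<Longrightarrow> w e \<le> B" "B \<ge> 0" "\<eta> > 0" "T > 0"
  shows "(\<Sum>e\<in>{e\<in>E. v \<in> e}. mean_demand b \<eta> T E w e) \<le> b + violation B \<eta> T E v"
proof -
  let ?d = "\<lambda>t. \<Sum>e\<in>{e\<in>E. v \<in> e}. demand b \<eta> E w t e"
  have "\<eta> * (\<Sum>t<T'. ?d t - b) \<le> price b \<eta> E w T' v" for T'
  proof (induction T')
    case (Suc t)
    then show ?case unfolding price_Suc by (simp add: algebra_simps)
  qed simp
  also have "price b \<eta> E w T v \<le> B + \<eta> * degree E v" using assms by (intro price_le) auto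
  finally have "\<eta> * (\<Sum>t<T. ?d t - b) \<le> B + \<eta> * degree E v" .
  then have "(\<Sum>t<T. ?d t) / T \<le> b + violation B \<eta> T E v"
    using assms(4,5) by (simp add: violation_def sum_subtractf field_simps)
  also have "(\<Sum>t<T. ?d t) / T = (\<Sum>e\<in>{e\<in>E. v \<in> e}. mean_demand b \<eta> T E w e)"
    unfolding mean_demand_def sum_divide_distrib[symmetric] by (subst sum.swap) simp
  finally show ?thesis .
qed

text \<open>
  Write the weight of an edge of the matching as its surplus over the prices plus the prices; each price
  is paid at most b times.
\<close>

lemma b_matching_weak_duality:
  assumes V: "finite V" and E: "\<And>e. e \<in> E \<Longrightarrow> e \<subseteq> V"
    and y: "\<And>v. y v \<ge> 0"
  shows "max_weight_b_matching b E w \<le> b * (\<Sum>v\<in>V. y v) + (\<Sum>e\<in>E. max 0 (w e - (\<Sum>u\<in>e. y u)))"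
proof -
  have finE: "finite E" by (rule finite_subset[of _ "Pow V"]) (use V E in auto)
  obtain F where F: "b_matching b E F" "max_weight_b_matching b E w = (\<Sum>e\<in>F. w e)"
    by (rule max_weight_b_matching_attained[OF finE])
  have FE: "F \<subseteq> E" and finF: "finite F" using F(1) finE finite_subset by (auto simp: b_matching_def)
  have "(\<Sum>e\<in>F. w e) = (\<Sum>e\<in>F. w e - (\<Sum>u\<in>e. y u)) + (\<Sum>e\<in>F. \<Sum>u\<in>e. y u)"
    by (simp add: sum_subtractf)
  also have "(\<Sum>e\<in>F. w e - (\<Sum>u\<in>e. y u)) \<le> (\<Sum>e\<in>F. max 0 (w e - (\<Sum>u\<in>e. y u)))"
    by (intro sum_mono) auto
  also have "\<dots> \<le> (\<Sum>e\<in>E. max 0 (w e - (\<Sum>u\<in>e. y u)))"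
    by (intro sum_mono2 finE FE) auto
  also have "(\<Sum>e\<in>F. \<Sum>u\<in>e. y u) = (\<Sum>v\<in>V. \<Sum>e\<in>{e\<in>F. v \<in> e}. y v)"
    by (rule sum_incidence[symmetric]) (use V finF FE E in auto)
  also have "\<dots> = (\<Sum>v\<in>V. card {e\<in>F. v \<in> e} * y v)" by simp
  also have "\<dots> \<le> (\<Sum>v\<in>V. b * y v)"
    using F(1) y by (intro sum_mono mult_right_mono) (auto simp: b_matching_def)
  finally show ?thesis using F(2) by (simp add: sum_distrib_left)
qed

text \<open>
  At every step the dual value equals the weight of the demanded edges plus the sum of price times unused
  capacity.  The standard regret bound of subgradient descent controls the average of the latter:
  the squared price drops by at least \<open>2\<eta>\<close> times that product, up to the square of
  the step.  Together with near feasibility this yields approximate strong duality, with an explicit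
  near-optimal primal solution.
\<close>

lemma max_weight_b_matching_le_mean_demand:
  assumes V: "finite V" and E: "\<And>e. e \<in> E \<Longrightarrow> e \<subseteq> V" and \<eta>: "\<eta> > 0" and T: "T > 0"
  shows "max_weight_b_matching b E w \<le>
           (\<Sum>e\<in>E. w e * mean_demand b \<eta> T E w e) + \<eta> / 2 * (\<Sum>v\<in>V. (real b + degree E v)\<^sup>2)"
proof -
  let ?M = "max_weight_b_matching b E w"
  let ?d = "\<lambda>t v. \<Sum>e\<in>{e\<in>E. v \<in> e}. demand b \<eta> E w t e"
  let ?y = "\<lambda>t v. price b \<eta> E w t v"
  let ?G = "\<Sum>v\<in>V. (real b + degree E v)\<^sup>2"
  have finE: "finite E" by (rule finite_subset[of _ "Pow V"]) (use V E in auto)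
  have step: "?M \<le> (\<Sum>e\<in>E. w e * demand b \<eta> E w t e) + (\<Sum>v\<in>V. ?y t v * (b - ?d t v))" for t
  proof -
    have "?M \<le> b * (\<Sum>v\<in>V. ?y t v) + (\<Sum>e\<in>E. max 0 (w e - (\<Sum>u\<in>e. ?y t u)))"
      by (rule b_matching_weak_duality[OF V E price_nonneg])
    also have "(\<Sum>e\<in>E. max 0 (w e - (\<Sum>u\<in>e. ?y t u))) =
      (\<Sum>e\<in>E. w e * demand b \<eta> E w t e) - (\<Sum>e\<in>E. \<Sum>u\<in>e. ?y t u * demand b \<eta> E w t e)"
      unfolding sum_subtractf[symmetric]
      by (intro sum.cong refl) (auto simp: demand_def)
    also have "(\<Sum>e\<in>E. \<Sum>u\<in>e. ?y t u * demand b \<eta> E w t e) = (\<Sum>v\<in>V. ?y t v * ?d t v)"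
      unfolding sum_distrib_left by (rule sum_incidence[symmetric]) (use V finE E in auto)
    finally show ?thesis by (simp add: sum_distrib_left algebra_simps sum_subtractf)
  qed
  \<comment> \<open>The squared price at time T' is the potential; it starts at 0 and stays nonnegative.\<close>
  have regret: "2 * \<eta> * (\<Sum>t<T'. ?y t v * (b - ?d t v)) \<le>
      \<eta>\<^sup>2 * (T' * (real b + degree E v)\<^sup>2) - (?y T' v)\<^sup>2" for T' v
  proof (induction T')
    case (Suc t)
    let ?g = "b - ?d t v"
    have "\<bar>?g\<bar> \<le> real b + degree E v" using demand_sum_bounds[where E=E and v=v and b=b and \<eta>=\<eta> and w=w and t=t] by auto
    then have g: "?g\<^sup>2 \<le> (real b + degree E v)\<^sup>2" by (simp add: abs_le_square_iff[symmetric])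
    have "(?y (Suc t) v)\<^sup>2 \<le> (?y t v - \<eta> * ?g)\<^sup>2" unfolding price_Suc
      by (auto simp: max_def)
    also have "\<dots> = (?y t v)\<^sup>2 - 2 * \<eta> * (?y t v * ?g) + \<eta>\<^sup>2 * ?g\<^sup>2" by (simp add: power2_eq_square algebra_simps)
    also have "\<dots> \<le> (?y t v)\<^sup>2 - 2 * \<eta> * (?y t v * ?g) + \<eta>\<^sup>2 * (real b + degree E v)\<^sup>2"
      using g by (intro add_left_mono mult_left_mono) auto
    finally show ?case using Suc.IH by (simp add: algebra_simps)
  qed simp
  have "(\<Sum>t<T. ?y t v * (b - ?d t v)) \<le> T * (\<eta> / 2 * (real b + degree E v)\<^sup>2)" for v
  proof -
    have "2 * \<eta> * (\<Sum>t<T. ?y t v * (b - ?d t v)) \<le> 2 * \<eta> * (T * (\<eta> / 2 * (real b + degree E v)\<^sup>2))"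
      using regret[where T'=T and v=v] by (simp add: power2_eq_square algebra_simps)
        (smt (verit) zero_le_square)
    then show ?thesis using \<eta> by simp
  qed
  then have "(\<Sum>v\<in>V. \<Sum>t<T. ?y t v * (b - ?d t v)) \<le> (\<Sum>v\<in>V. T * (\<eta> / 2 * (real b + degree E v)\<^sup>2))"
    by (rule sum_mono)
  then have total: "(\<Sum>t<T. \<Sum>v\<in>V. ?y t v * (b - ?d t v)) \<le> T * (\<eta> / 2 * ?G)"
    by (subst sum.swap) (simp add: sum_distrib_left)
  have "T * ?M = (\<Sum>t<T. ?M)" by simp
  also have "\<dots> \<le> (\<Sum>t<T. (\<Sum>e\<in>E. w e * demand b \<eta> E w t e) + (\<Sum>v\<in>V. ?y t v * (b - ?d t v)))"
    by (rule sum_mono[OF step])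
  also have "\<dots> \<le> (\<Sum>t<T. \<Sum>e\<in>E. w e * demand b \<eta> E w t e) + T * (\<eta> / 2 * ?G)"
    using total by (simp add: sum.distrib)
  also have "(\<Sum>t<T. \<Sum>e\<in>E. w e * demand b \<eta> E w t e) = T * (\<Sum>e\<in>E. w e * mean_demand b \<eta> T E w e)"
    using T by (subst sum.swap) (simp add: mean_demand_def sum_distrib_left sum_divide_distrib)
  finally have "T * ?M \<le> T * ((\<Sum>e\<in>E. w e * mean_demand b \<eta> T E w e) + \<eta> / 2 * ?G)"
    by (simp add: algebra_simps)
  then show ?thesis using T by simp
qed

text \<open>
  Shrink the value of each edge by the relative excess of its two endpoints.
\<close>

lemma repair_nearly_feasible:
  fixes w x :: "'a set \<Rightarrow> real" and \<delta> :: "'a \<Rightarrow> real"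
  assumes V: "finite V" and E: "\<And>e. e \<in> E \<Longrightarrow> e \<subseteq> V" and b: "b \<ge> 1"
    and w: "\<And>e. e \<in> E \<Longrightarrow> 0 \<le> w e \<and> w e \<le> B" and B: "B \<ge> 0"
    and x: "\<And>e. e \<in> E \<Longrightarrow> 0 \<le> x e \<and> x e \<le> 1"
    and load: "\<And>v. (\<Sum>e\<in>{e\<in>E. v \<in> e}. x e) \<le> b + \<delta> v" and \<delta>: "\<And>v. \<delta> v \<ge> 0"
  shows "\<exists>x'. fractional_b_matching b E x' \<and>
           (\<Sum>e\<in>E. w e * x e) \<le> (\<Sum>e\<in>E. w e * x' e) + B * (\<Sum>v\<in>V. \<delta> v)"
proof -
  have finE: "finite E" by (rule finite_subset[of _ "Pow V"]) (use V E in auto)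
  \<comment> \<open>The factor 1 - r v scales the load b + \<delta> v down to b.\<close>
  define r where "r = (\<lambda>v. \<delta> v / (b + \<delta> v))"
  have r01: "0 \<le> r v" "r v \<le> 1" for v using \<delta>[of v] b by (auto simp: r_def divide_le_eq_1)
  define x' where "x' = (\<lambda>e. x e * max 0 (1 - (\<Sum>v\<in>e. r v)))"
  have r_mem: "r v \<le> (\<Sum>u\<in>e. r u)" if "e \<in> E" "v \<in> e" for e v
    using that finite_subset[OF E[OF that(1)] V] by (intro member_le_sum r01) auto
  have "fractional_b_matching b E x'" unfolding fractional_b_matching_def
  proof (intro conjI ballI allI)
    fix e assume e: "e \<in> E"
    have "max 0 (1 - (\<Sum>v\<in>e. r v)) \<le> 1" using sum_nonneg[of e r] r01 by auto
    then have "x' e \<le> 1 * 1" unfolding x'_def using x[OF e] by (intro mult_mono) auto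
    then show "x' e \<le> 1" by simp
    show "0 \<le> x' e" using x[OF e] by (simp add: x'_def)
  next
    fix v
    have "(\<Sum>e\<in>{e\<in>E. v \<in> e}. x' e) \<le> (\<Sum>e\<in>{e\<in>E. v \<in> e}. x e * (1 - r v))"
    proof (intro sum_mono)
      fix e assume "e \<in> {e\<in>E. v \<in> e}"
      then show "x' e \<le> x e * (1 - r v)"
        unfolding x'_def using r_mem[of e v] r01[of v] x[of e] by (intro mult_left_mono) auto
    qed
    also have "\<dots> = (\<Sum>e\<in>{e\<in>E. v \<in> e}. x e) * (1 - r v)" by (simp add: sum_distrib_right)
    also have "\<dots> \<le> (b + \<delta> v) * (1 - r v)" using load r01 by (intro mult_right_mono) auto
    also have "\<dots> = b" using \<delta>[of v] b by (simp add: r_def field_simps)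
    finally show "(\<Sum>e\<in>{e\<in>E. v \<in> e}. x' e) \<le> b" .
  qed
  moreover have "(\<Sum>e\<in>E. w e * x e) - (\<Sum>e\<in>E. w e * x' e) \<le> B * (\<Sum>v\<in>V. \<delta> v)"
  proof -
    have "(\<Sum>e\<in>E. w e * x e) - (\<Sum>e\<in>E. w e * x' e) \<le> (\<Sum>e\<in>E. B * (\<Sum>v\<in>e. r v * x e))"
      unfolding sum_subtractf[symmetric]
    proof (intro sum_mono)
      fix e assume e: "e \<in> E"
      have "w e * x e - w e * x' e = w e * (x e * (1 - max 0 (1 - (\<Sum>v\<in>e. r v))))"
        by (simp add: x'_def algebra_simps)
      also have "\<dots> \<le> B * (x e * (\<Sum>v\<in>e. r v))"
      proof (intro mult_mono mult_nonneg_nonneg)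
        show "0 \<le> 1 - max 0 (1 - (\<Sum>v\<in>e. r v))" using sum_nonneg[of e r] r01 by auto
      qed (use w[OF e] x[OF e] B r01 in \<open>auto intro: sum_nonneg\<close>)
      finally show "w e * x e - w e * x' e \<le> B * (\<Sum>v\<in>e. r v * x e)"
        by (simp add: sum_distrib_left mult_ac)
    qed
    also have "\<dots> = B * (\<Sum>v\<in>V. \<Sum>e\<in>{e\<in>E. v \<in> e}. r v * x e)"
      using sum_incidence[of V E "\<lambda>v e. r v * x e"] V finE E by (simp add: sum_distrib_left[symmetric])
    also have "\<dots> \<le> B * (\<Sum>v\<in>V. \<delta> v)"
    proof (intro mult_left_mono sum_mono B)
      fix v
      have "(\<Sum>e\<in>{e\<in>E. v \<in> e}. r v * x e) \<le> r v * (b + \<delta> v)"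
        unfolding sum_distrib_left[symmetric] using load r01 by (intro mult_left_mono)
      also have "\<dots> = \<delta> v" using \<delta>[of v] b by (simp add: r_def)
      finally show "(\<Sum>e\<in>{e\<in>E. v \<in> e}. r v * x e) \<le> \<delta> v" .
    qed
    finally show ?thesis .
  qed
  ultimately show ?thesis by (intro exI[of _ x']) auto
qed

text \<open>
  Truncated at b B, the value which a feasible solution cannot exceed at a vertex, so that the functional is bounded
  uniformly over all graphs; the truncation changes it by at most B times the violation.
\<close>

definition local_value :: "nat \<Rightarrow> real \<Rightarrow> real \<Rightarrow> nat \<Rightarrow> 'a set set \<Rightarrow> ('a set \<Rightarrow> real) \<Rightarrow> 'a \<Rightarrow> real" where
  "local_value b B \<eta> T E w v = min (b * B) (\<Sum>e\<in>{e\<in>E. v \<in> e}. w e * mean_demand b \<eta> T E w e)"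

lemma local_value_bounds:
  assumes "\<And>e. e \<in> E \<Longrightarrow> 0 \<le> w e" "B \<ge> 0"
  shows "0 \<le> local_value b B \<eta> T E w v" "local_value b B \<eta> T E w v \<le> b * B"
  using assms by (auto simp: local_value_def intro!: sum_nonneg mult_nonneg_nonneg mean_demand_01)

text \<open>
  The optimum is the sum of a local functional over the vertices, up to errors that are small
  compared with the number of vertices: the first one when \<open>\<eta> T\<close> is large, the second when
  \<open>\<eta>\<close> is small, the third when L is large and there are few short cycles.  The
  factor 1/2 compensates that each edge is counted at both endpoints.
\<close>

theorem max_weight_b_matching_local_approximation:
  fixes w :: "'a set \<Rightarrow> real"
  assumes V: "finite V" and E: "\<And>e. e \<in> E \<Longrightarrow> e \<subseteq> V \<and> card e = 2"
    and w: "\<And>e. e \<in> E \<Longrightarrow> 0 \<le> w e \<and> w e \<le> B" and B: "B \<ge> 0" and b: "b \<ge> 1"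
    and \<eta>: "\<eta> > 0" and T: "T > 0" and L: "L > 0"
  shows "\<bar>max_weight_b_matching b E w - (\<Sum>v\<in>V. local_value b B \<eta> T E w v) / 2\<bar> \<le>
     B * (\<Sum>v\<in>V. violation B \<eta> T E v) + \<eta> / 2 * (\<Sum>v\<in>V. (real b + degree E v)\<^sup>2) +
     B * (card {A\<in>cycle_sets E. card A < L} + card V / L)"
proof -
  let ?M = "max_weight_b_matching b E w"
  let ?x = "mean_demand b \<eta> T E w"
  let ?Q = "(\<Sum>v\<in>V. local_value b B \<eta> T E w v) / 2"
  let ?D = "\<Sum>v\<in>V. violation B \<eta> T E v"
  let ?G = "\<eta> / 2 * (\<Sum>v\<in>V. (real b + degree E v)\<^sup>2)"
  let ?Z = "B * (card {A\<in>cycle_sets E. card A < L} + card V / L)"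
  have finE: "finite E" by (rule finite_subset[of _ "Pow V"]) (use V E in auto)
  have EV: "e \<subseteq> V" and E2: "card e = 2" if "e \<in> E" for e using E that by auto
  have \<delta>: "violation B \<eta> T E v \<ge> 0" for v using B \<eta> by (simp add: violation_def)
  have load: "(\<Sum>e\<in>{e\<in>E. v \<in> e}. ?x e) \<le> b + violation B \<eta> T E v" for v
    by (rule mean_demand_nearly_feasible) (use E2 w B \<eta> T in auto)
  have upper: "?M \<le> (\<Sum>e\<in>E. w e * ?x e) + ?G"
    by (rule max_weight_b_matching_le_mean_demand[OF V EV \<eta> T])
  have "\<exists>x'. fractional_b_matching b E x' \<and> (\<Sum>e\<in>E. w e * ?x e) \<le> (\<Sum>e\<in>E. w e * x' e) + B * ?D"
    by (rule repair_nearly_feasible[OF V EV b w B _ load \<delta>]) (simp_all add: mean_demand_01)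
  then obtain x' where x': "fractional_b_matching b E x'" "(\<Sum>e\<in>E. w e * ?x e) \<le> (\<Sum>e\<in>E. w e * x' e) + B * ?D"
    by auto
  have lower: "(\<Sum>e\<in>E. w e * ?x e) \<le> ?M + ?Z + B * ?D"
    using b_matching_rounding[of V E w B b x' L] V E w B x' L by fastforce
  have twice: "(\<Sum>v\<in>V. \<Sum>e\<in>{e\<in>E. v \<in> e}. w e * ?x e) = 2 * (\<Sum>e\<in>E. w e * ?x e)"
  proof -
    have "(\<Sum>v\<in>V. \<Sum>e\<in>{e\<in>E. v \<in> e}. w e * ?x e) = (\<Sum>e\<in>E. \<Sum>v\<in>e. w e * ?x e)"
      by (rule sum_incidence) (use V finE EV in auto)
    also have "\<dots> = (\<Sum>e\<in>E. 2 * (w e * ?x e))" using E2 by (intro sum.cong) auto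
    finally show ?thesis by (simp add: sum_distrib_left)
  qed
  have "(\<Sum>v\<in>V. local_value b B \<eta> T E w v) \<le> (\<Sum>v\<in>V. \<Sum>e\<in>{e\<in>E. v \<in> e}. w e * ?x e)"
    by (intro sum_mono) (auto simp: local_value_def)
  then have Q1: "?Q \<le> (\<Sum>e\<in>E. w e * ?x e)" using twice by simp
  have "(\<Sum>v\<in>V. \<Sum>e\<in>{e\<in>E. v \<in> e}. w e * ?x e) \<le> (\<Sum>v\<in>V. local_value b B \<eta> T E w v + B * violation B \<eta> T E v)"
  proof (intro sum_mono)
    fix v
    have "(\<Sum>e\<in>{e\<in>E. v \<in> e}. w e * ?x e) \<le> (\<Sum>e\<in>{e\<in>E. v \<in> e}. B * ?x e)"
      using w by (intro sum_mono mult_right_mono mean_demand_01) auto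
    also have "\<dots> \<le> B * (b + violation B \<eta> T E v)"
      unfolding sum_distrib_left[symmetric] using load B by (intro mult_left_mono)
    finally have 1: "(\<Sum>e\<in>{e\<in>E. v \<in> e}. w e * ?x e) \<le> b * B + B * violation B \<eta> T E v"
      by (simp add: algebra_simps)
    have "0 \<le> B * violation B \<eta> T E v" using B \<delta> by simp
    with 1 show "(\<Sum>e\<in>{e\<in>E. v \<in> e}. w e * ?x e) \<le> local_value b B \<eta> T E w v + B * violation B \<eta> T E v"
      by (simp add: local_value_def)
  qed
  then have Q2: "2 * (\<Sum>e\<in>E. w e * ?x e) \<le> 2 * ?Q + B * ?D"
    unfolding twice sum.distrib sum_distrib_left[symmetric] by simp
  have "0 \<le> B * ?D" using B \<delta> by (intro mult_nonneg_nonneg sum_nonneg) auto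
  moreover have "0 \<le> ?G" using \<eta> by (intro mult_nonneg_nonneg sum_nonneg) auto
  moreover have "0 \<le> ?Z" using B by simp
  ultimately show ?thesis using upper lower Q1 Q2 by linarith
qed

section \<open>Averages over uniformly random subsets\<close>

definition subset_mean :: "'a set \<Rightarrow> nat \<Rightarrow> ('a set \<Rightarrow> real) \<Rightarrow> real" where
  "subset_mean A m f = (\<Sum>X | X \<subseteq> A \<and> card X = m. f X) / real (card A choose m)"

lemma finite_subsets_of_card: "finite A \<Longrightarrow> finite {X. X \<subseteq> A \<and> card X = m}"
  by (rule finite_subset[of _ "Pow A"]) auto

lemma subset_mean_mono:
  assumes "\<And>X. X \<subseteq> A \<Longrightarrow> card X = m \<Longrightarrow> f X \<le> g X"
  shows "subset_mean A m f \<le> subset_mean A m g"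
  unfolding subset_mean_def by (intro divide_right_mono sum_mono) (use assms in auto)

lemma subset_mean_cong:
  assumes "\<And>X. X \<subseteq> A \<Longrightarrow> card X = m \<Longrightarrow> f X = g X"
  shows "subset_mean A m f = subset_mean A m g"
  unfolding subset_mean_def by (intro arg_cong2[where f="(/)"] sum.cong) (use assms in auto)

lemma subset_mean_add: "subset_mean A m (\<lambda>X. f X + g X) = subset_mean A m f + subset_mean A m g"
  by (simp add: subset_mean_def sum.distrib add_divide_distrib)

lemma subset_mean_diff: "subset_mean A m (\<lambda>X. f X - g X) = subset_mean A m f - subset_mean A m g"
  by (simp add: subset_mean_def sum_subtractf diff_divide_distrib)

lemma subset_mean_cmult: "subset_mean A m (\<lambda>X. a * f X) = a * subset_mean A m f"
  by (simp add: subset_mean_def sum_distrib_left)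

lemma subset_mean_sum: "subset_mean A m (\<lambda>X. \<Sum>i\<in>I. f i X) = (\<Sum>i\<in>I. subset_mean A m (f i))"
  unfolding subset_mean_def sum_divide_distrib[symmetric] by (subst sum.swap) simp

lemma subset_mean_const:
  assumes "finite A" "m \<le> card A"
  shows "subset_mean A m (\<lambda>_. a) = a"
  using assms by (simp add: subset_mean_def n_subsets)

lemma subset_mean_abs: "\<bar>subset_mean A m f\<bar> \<le> subset_mean A m (\<lambda>X. \<bar>f X\<bar>)"
  unfolding subset_mean_def by (simp add: divide_right_mono sum_abs)

lemma card_subsets_with_trace:
  assumes A: "finite A" "R \<subseteq> A" and \<tau>: "\<tau> \<subseteq> R" "card \<tau> \<le> m"
  shows "card {X. (X \<subseteq> A \<and> card X = m) \<and> X \<inter> R = \<tau>} = (card A - card R) choose (m - card \<tau>)"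
proof -
  have fin: "finite \<tau>" "finite R" using A \<tau> by (auto intro: finite_subset)
  have fX: "finite X" if "X \<subseteq> A" for X using that A finite_subset by auto
  have "{X. (X \<subseteq> A \<and> card X = m) \<and> X \<inter> R = \<tau>} = (\<union>) \<tau> ` {Y. Y \<subseteq> A - R \<and> card Y = m - card \<tau>}"
  proof (intro set_eqI iffI)
    fix X assume "X \<in> {X. (X \<subseteq> A \<and> card X = m) \<and> X \<inter> R = \<tau>}"
    then have X: "X \<subseteq> A" "card X = m" "X \<inter> R = \<tau>" by auto
    then have "X = \<tau> \<union> (X - R)" by auto
    moreover have "card (X - R) = m - card \<tau>"
      using X fX[OF X(1)] by (metis card_Diff_subset_Int finite_Int)
    ultimately show "X \<in> (\<union>) \<tau> ` {Y. Y \<subseteq> A - R \<and> card Y = m - card \<tau>}" using X by blast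
  next
    fix X assume "X \<in> (\<union>) \<tau> ` {Y. Y \<subseteq> A - R \<and> card Y = m - card \<tau>}"
    then obtain Y where Y: "Y \<subseteq> A - R" "card Y = m - card \<tau>" "X = \<tau> \<union> Y" by auto
    have "card X = card \<tau> + card Y"
      unfolding Y(3) using Y(1) \<tau> fin by (intro card_Un_disjoint) (auto intro: fX finite_subset)
    then show "X \<in> {X. (X \<subseteq> A \<and> card X = m) \<and> X \<inter> R = \<tau>}" using Y \<tau> A by auto
  qed
  moreover have "inj_on ((\<union>) \<tau>) {Y. Y \<subseteq> A - R \<and> card Y = m - card \<tau>}"
    using \<tau> by (intro inj_onI) blast
  ultimately have "card {X. (X \<subseteq> A \<and> card X = m) \<and> X \<inter> R = \<tau>} = card {Y. Y \<subseteq> A - R \<and> card Y = m - card \<tau>}"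
    by (simp add: card_image)
  also have "\<dots> = card (A - R) choose (m - card \<tau>)" using A by (intro n_subsets) auto
  also have "card (A - R) = card A - card R" using A fin by (simp add: card_Diff_subset)
  finally show ?thesis .
qed

lemma subset_mean_indicator:
  assumes "finite A"
  shows "subset_mean A m (\<lambda>X. of_bool (P X)) = card {X. (X \<subseteq> A \<and> card X = m) \<and> P X} / real (card A choose m)"
proof -
  have "(\<Sum>X | X \<subseteq> A \<and> card X = m. of_bool (P X) :: real) = (\<Sum>X | (X \<subseteq> A \<and> card X = m) \<and> P X. 1)"
    by (rule sum.mono_neutral_cong_right) (use finite_subsets_of_card[OF assms] in auto)
  then show ?thesis by (simp add: subset_mean_def)
qed

lemma subset_mean_trace:
  assumes "finite A" "R \<subseteq> A" "\<tau> \<subseteq> R" "card \<tau> \<le> m"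
  shows "subset_mean A m (\<lambda>X. of_bool (X \<inter> R = \<tau>)) =
           real ((card A - card R) choose (m - card \<tau>)) / real (card A choose m)"
  using card_subsets_with_trace[OF assms] by (simp add: subset_mean_indicator[OF assms(1)])

text \<open>
  Each of the j factors (m - i) / (N - i) of the quotient is at most m / N.
\<close>

lemma binomial_diff_diff_le:
  assumes "j \<le> m" "m \<le> N"
  shows "real ((N - j) choose (m - j)) \<le> (real m / N) ^ j * real (N choose m)"
  using assms(1)
proof (induction j)
  case (Suc j)
  define N' m' where "N' = N - Suc j" and "m' = m - Suc j"
  have eq: "N - j = Suc N'" "m - j = Suc m'" using Suc.prems assms by (auto simp: N'_def m'_def)
  have "Suc m' * (Suc N' choose Suc m') = Suc N' * (N' choose m')"
    by (metis Suc_times_binomial_eq mult.commute)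
  then have "real (Suc m') * real (Suc N' choose Suc m') = real (Suc N') * real (N' choose m')"
    by (metis of_nat_mult)
  then have "real (N' choose m') = real (Suc m') / real (Suc N') * real (Suc N' choose Suc m')"
    by (simp add: field_simps)
  also have "\<dots> \<le> real m / N * ((real m / N) ^ j * real (N choose m))"
  proof (intro mult_mono)
    have "real (Suc m') * N \<le> m * real (Suc N')"
    proof -
      have *: "real (Suc m') = real m - j" "real (Suc N') = real N - j"
        using Suc.prems assms by (auto simp: N'_def m'_def)
      have "real j * m \<le> real j * N" using assms by (intro mult_left_mono) auto
      then show ?thesis unfolding * by (simp add: algebra_simps)
    qed
    then show "real (Suc m') / real (Suc N') \<le> real m / N"
      using Suc.prems assms by (simp add: field_simps)
    show "real (Suc N' choose Suc m') \<le> (real m / N) ^ j * real (N choose m)"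
      using Suc.IH Suc.prems eq by simp
  qed auto
  finally show ?case by (simp add: N'_def m'_def)
qed simp

text \<open>
  Like independent sampling with density m / card A: fixed elements are never positively correlated.
\<close>

lemma subset_mean_superset_le:
  assumes A: "finite A" "m \<le> card A" and \<tau>: "\<tau> \<subseteq> A"
  shows "subset_mean A m (\<lambda>X. of_bool (\<tau> \<subseteq> X)) \<le> (real m / card A) ^ card \<tau>"
proof (cases "card \<tau> \<le> m")
  case True
  have "subset_mean A m (\<lambda>X. of_bool (\<tau> \<subseteq> X)) = subset_mean A m (\<lambda>X. of_bool (X \<inter> \<tau> = \<tau>))"
    by (simp add: Int_absorb1 inf.absorb_iff2)
  also have "\<dots> = real ((card A - card \<tau>) choose (m - card \<tau>)) / real (card A choose m)"
    by (rule subset_mean_trace) (use A \<tau> True in auto)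
  also have "\<dots> \<le> (real m / card A) ^ card \<tau>"
    using binomial_diff_diff_le[OF True A(2)] A(2) by (simp add: divide_le_eq)
  finally show ?thesis .
next
  case False
  have "\<not> \<tau> \<subseteq> X" if "X \<subseteq> A" "card X = m" for X
    using False that card_mono[OF finite_subset[OF that(1) A(1)], of \<tau>] by auto
  then have "subset_mean A m (\<lambda>X. of_bool (\<tau> \<subseteq> X)) = subset_mean A m (\<lambda>X. 0)"
    by (intro subset_mean_cong) simp
  also have "\<dots> = 0" by (simp add: subset_mean_def)
  finally show ?thesis by simp
qed

text \<open>
  First-moment bound for counting small subgraphs.
\<close>

lemma subset_mean_count_le:
  assumes A: "finite A" "m \<le> card A" and I: "finite I"
    and \<tau>: "\<And>i. i \<in> I \<Longrightarrow> \<tau> i \<subseteq> A \<and> card (\<tau> i) = j"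
  shows "subset_mean A m (\<lambda>X. real (card {i\<in>I. \<tau> i \<subseteq> X})) \<le> card I * (real m / card A) ^ j"
proof -
  have "subset_mean A m (\<lambda>X. real (card {i\<in>I. \<tau> i \<subseteq> X})) = subset_mean A m (\<lambda>X. \<Sum>i\<in>I. of_bool (\<tau> i \<subseteq> X))"
    using I by (intro subset_mean_cong) (simp add: of_bool_def sum.If_cases Int_def conj_commute)
  also have "\<dots> = (\<Sum>i\<in>I. subset_mean A m (\<lambda>X. of_bool (\<tau> i \<subseteq> X)))" by (rule subset_mean_sum)
  also have "\<dots> \<le> (\<Sum>i\<in>I. (real m / card A) ^ j)"
    using subset_mean_superset_le[OF A] \<tau> by (intro sum_mono) metis
  finally show ?thesis by simp
qed

section \<open>Small subgraphs of sparse random graphs\<close>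

text \<open>
  The regime of n vertices and about c n edges, with the side conditions that make the edge density at
  most 4 c / n.
\<close>

definition sparse :: "nat \<Rightarrow> nat \<Rightarrow> real \<Rightarrow> bool" where
  "sparse n m c \<longleftrightarrow> n \<ge> 2 \<and> m \<le> n choose 2 \<and> real m \<le> c * n"

lemma sparse_density:
  assumes "sparse n m c"
  shows "real m / card (all_edges n) \<le> 4 * c / n"
proof -
  have n: "real n \<ge> 2" and m: "real m \<le> c * n" using assms by (auto simp: sparse_def)
  have N: "real (n choose 2) = n * (real n - 1) / 2"
    using n by (simp add: choose_two real_of_nat_div of_nat_diff)
  have "real n * (real n - 1) / 2 \<ge> real n * real n / 4" using n by (simp add: field_simps)
  moreover have "real n * real n / 4 > 0" using n by simp
  ultimately have "real m / real (n choose 2) \<le> c * n / (real n * real n / 4)"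
    unfolding N using m of_nat_0_le_iff[of m, where 'a=real] by - (rule frac_le; linarith)
  also have "\<dots> = 4 * c / n" using n by (simp add: field_simps)
  finally show ?thesis by (simp add: card_all_edges)
qed

text \<open>
  If a type of subgraph with j edges has O(n to the j) possible positions, then the mean number of its
  occurrences is bounded.
\<close>

lemma sparse_count_le:
  assumes s: "sparse n m c" and I: "finite I" "card I \<le> K * real n ^ j"
    and \<tau>: "\<And>i. i \<in> I \<Longrightarrow> \<tau> i \<subseteq> all_edges n \<and> card (\<tau> i) = j" and K: "K \<ge> 0"
  shows "subset_mean (all_edges n) m (\<lambda>E. real (card {i\<in>I. \<tau> i \<subseteq> E})) \<le> K * (4 * c) ^ j"
proof -
  have n: "real n > 0" using s by (simp add: sparse_def)
  have "subset_mean (all_edges n) m (\<lambda>E. real (card {i\<in>I. \<tau> i \<subseteq> E})) \<le>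
          card I * (real m / card (all_edges n)) ^ j"
    by (rule subset_mean_count_le) (use s I \<tau> in \<open>auto simp: sparse_def card_all_edges\<close>)
  also have "\<dots> \<le> (K * real n ^ j) * (4 * c / n) ^ j"
    using I sparse_density[OF s] K by (intro mult_mono power_mono) auto
  also have "\<dots> = K * (4 * c) ^ j" using n by (simp add: power_divide)
  finally show ?thesis .
qed

text \<open>
  A two-regular set of k edges spans exactly k vertices, so there are at most (n choose k) times a constant
  of them among all potential edges.
\<close>

lemma mean_short_cycle_sets_le:
  assumes s: "sparse n m c"
  shows "subset_mean (all_edges n) m (\<lambda>E. real (card {A\<in>cycle_sets E. card A < L})) \<le>
           (\<Sum>k<L. 2 ^ 2 ^ k * (4 * c) ^ k)"
proof -
  let ?I = "\<lambda>k. {A \<in> cycle_sets (all_edges n). card A = k}"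
  have fin: "finite (?I k)" for k using finite_cycle_sets[of "all_edges n"] by simp
  have split: "real (card {A\<in>cycle_sets E. card A < L}) = (\<Sum>k<L. real (card {A\<in>?I k. A \<subseteq> E}))"
    if "E \<subseteq> all_edges n" for E
  proof -
    have "{A\<in>cycle_sets E. card A < L} = (\<Union>k<L. {A\<in>?I k. A \<subseteq> E})"
      using that unfolding cycle_sets_def by blast
    also have "card \<dots> = (\<Sum>k<L. card {A\<in>?I k. A \<subseteq> E})"
      by (rule card_UN_disjoint) (use finite_cycle_sets[of "all_edges n"] in auto)
    finally show ?thesis by simp
  qed
  have "card (?I k) \<le> 2 ^ 2 ^ k * real n ^ k" for k
  proof -
    have "?I k \<subseteq> (\<Union>S\<in>{S. S \<subseteq> {1..n} \<and> card S = k}. Pow (Pow S))"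
    proof
      fix A assume A: "A \<in> ?I k"
      then have sub: "A \<subseteq> all_edges n" by (auto simp: cycle_sets_def)
      have "card (\<Union>A) = card A"
        by (rule card_two_regular)
           (use A finite_subset[OF sub] in \<open>auto simp: cycle_sets_def all_edges_def\<close>)
      then have "\<Union>A \<subseteq> {1..n}" "card (\<Union>A) = k" using A sub by (auto simp: all_edges_def)
      then show "A \<in> (\<Union>S\<in>{S. S \<subseteq> {1..n} \<and> card S = k}. Pow (Pow S))" by blast
    qed
    then have "card (?I k) \<le> card (\<Union>S\<in>{S. S \<subseteq> {1..n} \<and> card S = k}. Pow (Pow S))"
      by (rule card_mono[rotated])
         (auto intro!: finite_UN_I finite_subsets_of_card intro: finite_subset)
    also have "\<dots> \<le> (\<Sum>S\<in>{S. S \<subseteq> {1..n} \<and> card S = k}. card (Pow (Pow S)))"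
      by (rule card_UN_le) (auto intro: finite_subsets_of_card)
    also have "\<dots> = (\<Sum>S\<in>{S. S \<subseteq> {1..n} \<and> card S = k}. 2 ^ 2 ^ k)"
      by (intro sum.cong) (auto simp: card_Pow finite_subset[of _ "{1..n}"])
    also have "\<dots> = (n choose k) * 2 ^ 2 ^ k" by (simp add: n_subsets)
    also have "\<dots> \<le> n ^ k * 2 ^ 2 ^ k"
      by (cases "k \<le> n") (auto simp: binomial_le_pow binomial_eq_0)
    finally have "real (card (?I k)) \<le> real (n ^ k * 2 ^ 2 ^ k)" by (subst of_nat_le_iff)
    then show ?thesis by (simp add: mult.commute)
  qed
  then have each: "subset_mean (all_edges n) m (\<lambda>E. real (card {A\<in>?I k. A \<subseteq> E})) \<le> 2 ^ 2 ^ k * (4 * c) ^ k" for k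
    by (intro sparse_count_le[OF s fin]) (auto simp: cycle_sets_def)
  have "subset_mean (all_edges n) m (\<lambda>E. real (card {A\<in>cycle_sets E. card A < L})) =
        subset_mean (all_edges n) m (\<lambda>E. \<Sum>k<L. real (card {A\<in>?I k. A \<subseteq> E}))"
    by (intro subset_mean_cong split)
  then show ?thesis using each by (simp add: subset_mean_sum sum_mono)
qed

lemma degree_eq_card_neighbours:
  assumes E: "E \<subseteq> all_edges n"
  shows "degree E v = card {a\<in>{1..n} - {v}. {{v, a}} \<subseteq> E}"
proof -
  have "bij_betw (\<lambda>a. {v, a}) {a\<in>{1..n} - {v}. {{v, a}} \<subseteq> E} {e\<in>E. v \<in> e}"
  proof (rule bij_betw_imageI)
    show "inj_on (\<lambda>a. {v, a}) {a\<in>{1..n} - {v}. {{v, a}} \<subseteq> E}"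
      by (auto simp: inj_on_def doubleton_eq_iff)
    show "(\<lambda>a. {v, a}) ` {a\<in>{1..n} - {v}. {{v, a}} \<subseteq> E} = {e\<in>E. v \<in> e}"
    proof (intro equalityI subsetI)
      fix e assume e: "e \<in> {e\<in>E. v \<in> e}"
      then have "card e = 2" "e \<subseteq> {1..n}" using E by (auto simp: all_edges_def)
      then obtain a where "e = {v, a}" "a \<noteq> v" using e by (auto simp: card_2_iff)
      then show "e \<in> (\<lambda>a. {v, a}) ` {a\<in>{1..n} - {v}. {{v, a}} \<subseteq> E}"
        using e \<open>e \<subseteq> {1..n}\<close> by auto
    qed auto
  qed
  then show ?thesis unfolding degree_def by (rule bij_betw_same_card[THEN sym])
qed

lemma mean_degree_le:
  assumes s: "sparse n m c" and v: "v \<in> {1..n}"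
  shows "subset_mean (all_edges n) m (\<lambda>E. real (degree E v)) \<le> 4 * c"
proof -
  have "subset_mean (all_edges n) m (\<lambda>E. real (degree E v)) =
        subset_mean (all_edges n) m (\<lambda>E. real (card {a\<in>{1..n} - {v}. {{v, a}} \<subseteq> E}))"
    by (intro subset_mean_cong) (simp add: degree_eq_card_neighbours)
  also have "\<dots> \<le> 1 * (4 * c) ^ 1"
    by (rule sparse_count_le[OF s]) (use v in \<open>auto simp: all_edges_def\<close>)
  finally show ?thesis by simp
qed

text \<open>
  The square of the degree is the degree plus the number of ordered pairs of distinct neighbours.
\<close>

lemma mean_degree_square_le:
  assumes s: "sparse n m c" and v: "v \<in> {1..n}"
  shows "subset_mean (all_edges n) m (\<lambda>E. (real (degree E v))\<^sup>2) \<le> 4 * c + (4 * c)\<^sup>2"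
proof -
  let ?I = "{(a, b) \<in> ({1..n} - {v}) \<times> ({1..n} - {v}). a \<noteq> b}"
  let ?\<tau> = "\<lambda>(a, b). {{v, a}, {v, b}}"
  have pairs: "(real (degree E v))\<^sup>2 = real (degree E v) + real (card {p\<in>?I. ?\<tau> p \<subseteq> E})"
    if E: "E \<subseteq> all_edges n" for E
  proof -
    let ?N = "{a\<in>{1..n} - {v}. {{v, a}} \<subseteq> E}"
    have "?N \<times> ?N = (\<lambda>a. (a, a)) ` ?N \<union> {p\<in>?I. ?\<tau> p \<subseteq> E}" by auto
    moreover have "card ((\<lambda>a. (a, a)) ` ?N \<union> {p\<in>?I. ?\<tau> p \<subseteq> E}) = card ((\<lambda>a. (a, a)) ` ?N) + card {p\<in>?I. ?\<tau> p \<subseteq> E}"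
    proof (rule card_Un_disjoint)
      show "finite {p\<in>?I. ?\<tau> p \<subseteq> E}"
        by (rule finite_subset[of _ "{1..n} \<times> {1..n}"]) auto
      show "(\<lambda>a. (a, a)) ` ?N \<inter> {p\<in>?I. ?\<tau> p \<subseteq> E} = {}"
        by (rule equals0I) (elim IntE imageE, simp)
    qed simp
    moreover have "card ((\<lambda>a. (a, a)) ` ?N) = card ?N" by (intro card_image) (auto simp: inj_on_def)
    ultimately have "card (?N \<times> ?N) = card ?N + card {p\<in>?I. ?\<tau> p \<subseteq> E}" by presburger
    then have "real (card ?N) * real (card ?N) = real (card ?N) + real (card {p\<in>?I. ?\<tau> p \<subseteq> E})"
      unfolding card_cartesian_product of_nat_mult[symmetric] of_nat_add[symmetric] by (rule arg_cong)
    then show ?thesis by (simp add: degree_eq_card_neighbours[OF E] power2_eq_square)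
  qed
  have "card ?I \<le> card ({1..n} \<times> {1..n})" by (intro card_mono) auto
  then have "card ?I \<le> n ^ 2" by (simp add: power2_eq_square)
  then have "real (card ?I) \<le> real (n ^ 2)" by (rule of_nat_mono)
  then have cI: "real (card ?I) \<le> 1 * real n ^ 2" by simp
  have "subset_mean (all_edges n) m (\<lambda>E. real (card {p\<in>?I. ?\<tau> p \<subseteq> E})) \<le> 1 * (4 * c) ^ 2"
  proof (rule sparse_count_le[OF s _ cI])
    show "finite ?I" by (rule finite_subset[of _ "{1..n} \<times> {1..n}"]) auto
    fix p assume p: "p \<in> ?I"
    then show "?\<tau> p \<subseteq> all_edges n \<and> card (?\<tau> p) = 2"
      using v by (auto simp: all_edges_def card_2_iff doubleton_eq_iff)
  qed simp
  moreover have "subset_mean (all_edges n) m (\<lambda>E. (real (degree E v))\<^sup>2) =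
     subset_mean (all_edges n) m (\<lambda>E. real (degree E v)) + subset_mean (all_edges n) m (\<lambda>E. real (card {p\<in>?I. ?\<tau> p \<subseteq> E}))"
    unfolding subset_mean_add[symmetric] by (intro subset_mean_cong pairs)
  ultimately show ?thesis using mean_degree_le[OF s v] by simp
qed

section \<open>Neighbourhoods have bounded mean size\<close>

fun reach :: "'a set set \<Rightarrow> 'a \<Rightarrow> nat \<Rightarrow> 'a set" where
  "reach E v 0 = {v}"
| "reach E v (Suc t) = reach E v t \<union> \<Union>{e\<in>E. e \<inter> reach E v t \<noteq> {}}"

primrec path_edges :: "'a \<Rightarrow> 'a list \<Rightarrow> 'a set set" where
  "path_edges v [] = {}"
| "path_edges v (u # us) = insert {v, u} (path_edges u us)"

lemma path_edges_snoc: "path_edges v (us @ [u]) = insert {last (v # us), u} (path_edges v us)"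
  by (induction us arbitrary: v) auto

lemma path_edges_subset_set: "e \<in> path_edges v us \<Longrightarrow> e \<subseteq> set (v # us)"
  by (induction us arbitrary: v) fastforce+

lemma card_path_edges: "distinct (v # us) \<Longrightarrow> card (path_edges v us) = length us \<and> finite (path_edges v us)"
proof (induction us arbitrary: v)
  case (Cons u us)
  then have "{v, u} \<notin> path_edges u us" using path_edges_subset_set[of "{v, u}" u us] by auto
  then show ?case using Cons by auto
qed simp

lemma path_edges_in_all_edges:
  "distinct (v # us) \<Longrightarrow> set (v # us) \<subseteq> {1..n} \<Longrightarrow> path_edges v us \<subseteq> all_edges n"
  by (induction us arbitrary: v) (auto simp: all_edges_def)

lemma reach_mono: "s \<le> t \<Longrightarrow> reach E v s \<subseteq> reach E v t"
  by (rule lift_Suc_mono_le[of "reach E v"]) auto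

lemma reach_self: "v \<in> reach E v t"
  using reach_mono[of 0 t E v] by auto

lemma reach_subset:
  assumes "v \<in> V" "\<And>e. e \<in> E \<Longrightarrow> e \<subseteq> V"
  shows "reach E v t \<subseteq> V"
  using assms by (induction t) auto

text \<open>
  Follow the layers: a vertex of a new layer has a neighbour in the previous layers, whose path it extends
  without repeating a vertex.
\<close>

lemma reach_path:
  assumes "\<And>e. e \<in> E \<Longrightarrow> card e = 2" "u \<in> reach E v t"
  shows "\<exists>us. length us \<le> t \<and> distinct (v # us) \<and> set (v # us) \<subseteq> reach E v t \<and>
           last (v # us) = u \<and> path_edges v us \<subseteq> E"
  using assms(2)
proof (induction t arbitrary: u)
  case 0
  then show ?case by (intro exI[of _ "[]"]) auto
next
  case (Suc t)
  show ?case
  proof (cases "u \<in> reach E v t")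
    case True
    then obtain us where "length us \<le> t" "distinct (v # us)" "set (v # us) \<subseteq> reach E v t"
       "last (v # us) = u" "path_edges v us \<subseteq> E" using Suc.IH by blast
    then show ?thesis by (intro exI[of _ us]) auto
  next
    case False
    then obtain e s where e: "e \<in> E" "s \<in> e" "s \<in> reach E v t" "u \<in> e" using Suc.prems by auto
    have "s \<noteq> u" using e False by auto
    then have es: "e = {s, u}" using assms(1)[OF e(1)] e by (auto simp: card_2_iff)
    obtain us where us: "length us \<le> t" "distinct (v # us)" "set (v # us) \<subseteq> reach E v t"
       "last (v # us) = s" "path_edges v us \<subseteq> E" using Suc.IH[OF e(3)] by blast
    have "path_edges v (us @ [u]) \<subseteq> E"
      using us es e unfolding path_edges_snoc by auto
    moreover have "distinct (v # us @ [u])" using us False by auto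
    moreover have "set (v # us @ [u]) \<subseteq> reach E v (Suc t)" using us Suc.prems by auto
    ultimately show ?thesis using us by (intro exI[of _ "us @ [u]"]) auto
  qed
qed

text \<open>
  Every reached vertex ends a self-avoiding path of length at most t, and there are at most n to the j
  positions for such a path with j edges.
\<close>

lemma mean_card_reach_le:
  assumes s: "sparse n m c" and v: "v \<in> {1..n}"
  shows "subset_mean (all_edges n) m (\<lambda>E. real (card (reach E v t))) \<le> (\<Sum>j\<le>t. (4 * c) ^ j)"
proof -
  let ?I = "\<lambda>j. {us. (set us \<subseteq> {1..n} \<and> length us = j) \<and> distinct (v # us)}"
  have finI: "finite (?I j)" for j
    by (rule finite_subset[OF _ finite_lists_length_eq[of "{1..n}" j]]) auto
  have "card (?I j) \<le> card {us. set us \<subseteq> {1..n} \<and> length us = j}" for j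
    by (intro card_mono finite_lists_length_eq) auto
  then have cI: "card (?I j) \<le> n ^ j" for j by (simp add: card_lists_length_eq)
  have cI': "real (card (?I j)) \<le> 1 * real n ^ j" for j
    using of_nat_mono[OF cI[of j], where 'a=real] by simp
  have each: "subset_mean (all_edges n) m (\<lambda>E. real (card {us\<in>?I j. path_edges v us \<subseteq> E})) \<le> 1 * (4 * c) ^ j" for j
  proof (rule sparse_count_le[OF s finI cI'])
    fix us assume "us \<in> ?I j"
    then show "path_edges v us \<subseteq> all_edges n \<and> card (path_edges v us) = j"
      using card_path_edges[of v us] path_edges_in_all_edges[of v us n] v by auto
  qed simp
  have bound: "real (card (reach E v t)) \<le> (\<Sum>j\<le>t. real (card {us\<in>?I j. path_edges v us \<subseteq> E}))"
    if E: "E \<subseteq> all_edges n" for E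
  proof -
    have finI': "finite {us\<in>?I j. path_edges v us \<subseteq> E}" for j
      by (rule finite_subset[OF _ finI[of j]]) auto
    have E2: "\<And>e. e \<in> E \<Longrightarrow> card e = 2" "\<And>e. e \<in> E \<Longrightarrow> e \<subseteq> {1..n}"
      using E by (auto simp: all_edges_def)
    have "reach E v t \<subseteq> (\<Union>j\<le>t. (\<lambda>us. last (v # us)) ` {us\<in>?I j. path_edges v us \<subseteq> E})"
    proof
      fix u assume "u \<in> reach E v t"
      then obtain us where us: "length us \<le> t" "distinct (v # us)" "set (v # us) \<subseteq> reach E v t"
        "last (v # us) = u" "path_edges v us \<subseteq> E" using reach_path[OF E2(1)] by blast
      have "set us \<subseteq> {1..n}" using us(3) reach_subset[of v "{1..n}" E t] v E2(2) by auto
      then have "us \<in> {us\<in>?I (length us). path_edges v us \<subseteq> E}" using us by auto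
      then show "u \<in> (\<Union>j\<le>t. (\<lambda>us. last (v # us)) ` {us\<in>?I j. path_edges v us \<subseteq> E})"
        using us(1,4) by blast
    qed
    then have "card (reach E v t) \<le> card (\<Union>j\<le>t. (\<lambda>us. last (v # us)) ` {us\<in>?I j. path_edges v us \<subseteq> E})"
      by (rule card_mono[rotated]) (intro finite_UN_I finite_imageI finI' finite_atMost)
    also have "\<dots> \<le> (\<Sum>j\<le>t. card ((\<lambda>us. last (v # us)) ` {us\<in>?I j. path_edges v us \<subseteq> E}))"
      by (rule card_UN_le) simp
    also have "\<dots> \<le> (\<Sum>j\<le>t. card {us\<in>?I j. path_edges v us \<subseteq> E})"
      by (intro sum_mono card_image_le finI')
    finally have "real (card (reach E v t)) \<le> real (\<Sum>j\<le>t. card {us\<in>?I j. path_edges v us \<subseteq> E})"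
      by (rule of_nat_mono)
    then show ?thesis by simp
  qed
  have "subset_mean (all_edges n) m (\<lambda>E. real (card (reach E v t))) \<le>
     subset_mean (all_edges n) m (\<lambda>E. \<Sum>j\<le>t. real (card {us\<in>?I j. path_edges v us \<subseteq> E}))"
    by (intro subset_mean_mono bound)
  also have "\<dots> \<le> (\<Sum>j\<le>t. (4 * c) ^ j)"
    unfolding subset_mean_sum using each by (intro sum_mono) simp
  finally show ?thesis .
qed

section \<open>Locality and relabelling\<close>

text \<open>
  All edges that meet the vertices within distance t, including those that leave this set.  Knowing these
  edges means knowing both the presence and the absence of edges at the vertices within distance t, which makes the
  event that the ball equals a given set depend on a fixed set of potential edges only.
\<close>

definition ball_edges :: "'a set set \<Rightarrow> 'a \<Rightarrow> nat \<Rightarrow> 'a set set" where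
  "ball_edges E v t = {e\<in>E. e \<inter> reach E v t \<noteq> {}}"

lemma reach_agree:
  assumes agree: "\<And>e. e \<inter> reach E v t \<noteq> {} \<Longrightarrow> e \<in> E' \<longleftrightarrow> e \<in> E" and "s \<le> Suc t"
  shows "reach E' v s = reach E v s"
  using assms(2)
proof (induction s)
  case (Suc s)
  then have IH: "reach E' v s = reach E v s" by simp
  have "{e\<in>E'. e \<inter> reach E v s \<noteq> {}} = {e\<in>E. e \<inter> reach E v s \<noteq> {}}"
    using agree reach_mono[of s t E v] Suc.prems by blast
  then show ?case using IH by simp
qed simp

lemma reach_ball_edges:
  assumes "s \<le> Suc t"
  shows "reach (ball_edges E v t) v s = reach E v s"
  by (rule reach_agree[OF _ assms]) (auto simp: ball_edges_def)

lemma ball_edges_idem: "ball_edges (ball_edges E v t) v t = ball_edges E v t"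
  using reach_ball_edges[of t t E v] by (auto simp: ball_edges_def)

text \<open>
  The region explored is determined by the outcome: it can be computed from \<open>\<tau>\<close> in place of E.  This
  reduces the probability of a given ball to counting edge sets with a prescribed trace.
\<close>

lemma ball_edges_eq_iff:
  assumes \<tau>: "ball_edges \<tau> v t = \<tau>"
  shows "ball_edges E v t = \<tau> \<longleftrightarrow> {e\<in>E. e \<inter> reach \<tau> v t \<noteq> {}} = \<tau>"
proof
  assume "ball_edges E v t = \<tau>"
  then show "{e\<in>E. e \<inter> reach \<tau> v t \<noteq> {}} = \<tau>"
    using reach_ball_edges[of t t E v] by (auto simp: ball_edges_def)
next
  assume *: "{e\<in>E. e \<inter> reach \<tau> v t \<noteq> {}} = \<tau>"
  then have "reach E v t = reach \<tau> v t"
    by (intro reach_agree[where t=t]) auto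
  then show "ball_edges E v t = \<tau>" using * by (simp add: ball_edges_def)
qed

lemma edges_in_ball_reach:
  assumes "ball_edges \<tau> v t = \<tau>" "e \<in> \<tau>"
  shows "e \<subseteq> reach \<tau> v (Suc t)"
proof -
  have "e \<inter> reach \<tau> v t \<noteq> {}" using assms by (auto simp: ball_edges_def)
  then show ?thesis using assms(2) by auto
qed

lemma reach_neighbour:
  assumes "e \<in> E" "v \<in> e" "u \<in> e"
  shows "reach E u t \<subseteq> reach E v (Suc t)"
proof (induction t)
  case 0
  then show ?case using assms by auto
next
  case (Suc t)
  have "f \<inter> reach E v (Suc t) \<noteq> {}" if "f \<inter> reach E u t \<noteq> {}" for f using that Suc by blast
  then have "{f\<in>E. f \<inter> reach E u t \<noteq> {}} \<subseteq> {f\<in>E. f \<inter> reach E v (Suc t) \<noteq> {}}" by blast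
  then have "\<Union>{f\<in>E. f \<inter> reach E u t \<noteq> {}} \<subseteq> \<Union>{f\<in>E. f \<inter> reach E v (Suc t) \<noteq> {}}" by (rule Union_mono)
  then show ?case using Suc unfolding reach.simps(2)[of E u] reach.simps(2)[of E v "Suc t"] by blast
qed

lemma price_local:
  assumes "\<And>e. e \<inter> reach E v t \<noteq> {} \<Longrightarrow> e \<in> E' \<longleftrightarrow> e \<in> E"
    and "\<And>e. e \<in> E \<Longrightarrow> e \<inter> reach E v t \<noteq> {} \<Longrightarrow> w' e = w e"
  shows "price b \<eta> E' w' t v = price b \<eta> E w t v"
  using assms
proof (induction t arbitrary: v)
  case (Suc t)
  have self: "v \<in> reach E v s" for s by (rule reach_self)
  have IH: "price b \<eta> E' w' t u = price b \<eta> E w t u" if sub: "reach E u t \<subseteq> reach E v (Suc t)" for u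
  proof (rule Suc.IH)
    fix e assume "e \<inter> reach E u t \<noteq> {}"
    then have e: "e \<inter> reach E v (Suc t) \<noteq> {}" using sub by blast
    show "e \<in> E' \<longleftrightarrow> e \<in> E" by (rule Suc.prems(1)[OF e])
    show "w' e = w e" if "e \<in> E" by (rule Suc.prems(2)[OF that e])
  qed
  have IHv: "price b \<eta> E' w' t v = price b \<eta> E w t v"
    by (rule IH) (rule reach_mono, simp)
  have edges: "{e\<in>E'. v \<in> e} = {e\<in>E. v \<in> e}"
    using Suc.prems(1) self[of "Suc t"] by blast
  have "price b \<eta> E' w' t u = price b \<eta> E w t u" if "e \<in> E" "v \<in> e" "u \<in> e" for e u
    by (rule IH) (rule reach_neighbour[OF that])
  moreover have "w' e = w e" if "e \<in> E" "v \<in> e" for e using Suc.prems(2)[OF that(1)] that self[of "Suc t"] by blast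
  ultimately show ?case unfolding price.simps(2) edges IHv
    by (intro arg_cong2[where f=max] arg_cong2[where f="(-)"] arg_cong2[where f="(*)"] sum.cong refl) auto
qed simp

lemma mean_demand_local:
  assumes agree: "\<And>e. e \<inter> reach E v T \<noteq> {} \<Longrightarrow> e \<in> E' \<longleftrightarrow> e \<in> E"
    and w: "\<And>e. e \<in> E \<Longrightarrow> e \<inter> reach E v T \<noteq> {} \<Longrightarrow> w' e = w e"
    and e: "e \<in> E" "v \<in> e"
  shows "mean_demand b \<eta> T E' w' e = mean_demand b \<eta> T E w e"
proof -
  have we: "w' e = w e" using w[OF e(1)] e(2) reach_self[of v E T] by blast
  have "demand b \<eta> E' w' t e = demand b \<eta> E w t e" if "t < T" for t
  proof -
    have sub: "reach E u t \<subseteq> reach E v T" if "u \<in> e" for u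
      by (rule order_trans[OF reach_neighbour[OF e that] reach_mono]) (use \<open>t < T\<close> in simp)
    have "price b \<eta> E' w' t u = price b \<eta> E w t u" if "u \<in> e" for u
      by (rule price_local) (use agree w sub[OF that] in blast)+
    then show ?thesis unfolding demand_def we by (simp cong: sum.cong)
  qed
  then show ?thesis unfolding mean_demand_def by simp
qed

text \<open>
  With T steps of descent, information from outside the ball has no time to reach the root.
\<close>

lemma local_value_ball:
  assumes "\<And>e. e \<in> ball_edges E v T \<Longrightarrow> w' e = w e"
  shows "local_value b B \<eta> T (ball_edges E v T) w' v = local_value b B \<eta> T E w v"
proof -
  have w: "w' e = w e" if "e \<in> E" "e \<inter> reach E v T \<noteq> {}" for e
    using assms that by (auto simp: ball_edges_def)
  have touching: "e \<inter> reach E v T \<noteq> {}" if "v \<in> e" for e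
    using that reach_self[of v E T] by blast
  have edges: "{e\<in>ball_edges E v T. v \<in> e} = {e\<in>E. v \<in> e}"
    using touching by (auto simp: ball_edges_def)
  have "mean_demand b \<eta> T (ball_edges E v T) w' e = mean_demand b \<eta> T E w e" if "e \<in> E" "v \<in> e" for e
    by (rule mean_demand_local[OF _ w that]) (auto simp: ball_edges_def)
  then show ?thesis unfolding local_value_def edges 
    by (intro arg_cong2[where f=min] refl sum.cong) (use w touching in auto)
qed

lemma relabel_incident_edges:
  assumes "inj_on \<pi> S" "v \<in> S" "\<tau> \<subseteq> Pow S"
  shows "{e\<in>(`) \<pi> ` \<tau>. \<pi> v \<in> e} = (`) \<pi> ` {e\<in>\<tau>. v \<in> e}"
proof -
  have "\<pi> v \<in> \<pi> ` e \<longleftrightarrow> v \<in> e" if "e \<in> \<tau>" for e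
    by (rule inj_on_image_mem_iff[OF assms(1,2)]) (use assms(3) that in auto)
  then show ?thesis by blast
qed

lemma inj_on_image_sets:
  assumes "inj_on \<pi> S" "\<tau> \<subseteq> Pow S"
  shows "inj_on ((`) \<pi>) \<tau>"
  using inj_on_image_Pow[OF assms(1)] assms(2) by (rule inj_on_subset)

lemma price_relabel:
  assumes \<pi>: "inj_on \<pi> S" and \<tau>: "\<tau> \<subseteq> Pow S" and "v \<in> S"
  shows "price b \<eta> ((`) \<pi> ` \<tau>) w t (\<pi> v) = price b \<eta> \<tau> (\<lambda>e. w (\<pi> ` e)) t v"
  using assms(3)
proof (induction t arbitrary: v)
  case (Suc t)
  let ?p = "price b \<eta> ((`) \<pi> ` \<tau>) w t" and ?p' = "price b \<eta> \<tau> (\<lambda>e. w (\<pi> ` e)) t"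
  have inj: "inj_on ((`) \<pi>) {e\<in>\<tau>. v \<in> e}" by (rule inj_on_image_sets[OF \<pi>]) (use \<tau> in auto)
  have "(\<Sum>u\<in>\<pi> ` e. ?p u) = (\<Sum>u\<in>e. ?p' u)" if "e \<in> \<tau>" for e
  proof -
    have eS: "e \<subseteq> S" using that \<tau> by auto
    have "(\<Sum>u\<in>\<pi> ` e. ?p u) = (\<Sum>u\<in>e. ?p (\<pi> u))"
      using inj_on_subset[OF \<pi> eS] by (simp add: sum.reindex)
    then show ?thesis using eS Suc.IH by (auto intro!: sum.cong)
  qed
  then have "(\<Sum>e\<in>{e\<in>(`) \<pi> ` \<tau>. \<pi> v \<in> e}. of_bool (w e > (\<Sum>u\<in>e. ?p u))) =
        (\<Sum>e\<in>{e\<in>\<tau>. v \<in> e}. of_bool (w (\<pi> ` e) > (\<Sum>u\<in>e. ?p' u)) :: real)"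
    unfolding relabel_incident_edges[OF \<pi> Suc.prems \<tau>] sum.reindex[OF inj]
    by (intro sum.cong) auto
  then show ?case using Suc.IH[OF Suc.prems] by (simp add: price.simps(2))
qed simp

lemma local_value_relabel:
  assumes \<pi>: "inj_on \<pi> S" and \<tau>: "\<tau> \<subseteq> Pow S" and v: "v \<in> S"
  shows "local_value b B \<eta> T ((`) \<pi> ` \<tau>) w (\<pi> v) = local_value b B \<eta> T \<tau> (\<lambda>e. w (\<pi> ` e)) v"
proof -
  have inj: "inj_on ((`) \<pi>) {e\<in>\<tau>. v \<in> e}" by (rule inj_on_image_sets[OF \<pi>]) (use \<tau> in auto)
  have "mean_demand b \<eta> T ((`) \<pi> ` \<tau>) w (\<pi> ` e) = mean_demand b \<eta> T \<tau> (\<lambda>e. w (\<pi> ` e)) e" if "e \<in> \<tau>" for e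
  proof -
    have eS: "e \<subseteq> S" using that \<tau> by auto
    have "demand b \<eta> ((`) \<pi> ` \<tau>) w t (\<pi> ` e) = demand b \<eta> \<tau> (\<lambda>e. w (\<pi> ` e)) t e" for t
    proof -
      have "(\<Sum>u\<in>\<pi> ` e. price b \<eta> ((`) \<pi> ` \<tau>) w t u) = (\<Sum>u\<in>e. price b \<eta> ((`) \<pi> ` \<tau>) w t (\<pi> u))"
        using inj_on_subset[OF \<pi> eS] by (simp add: sum.reindex)
      also have "\<dots> = (\<Sum>u\<in>e. price b \<eta> \<tau> (\<lambda>e. w (\<pi> ` e)) t u)"
        by (intro sum.cong refl price_relabel[OF \<pi> \<tau>]) (use eS in auto)
      finally show ?thesis by (simp add: demand_def)
    qed
    then show ?thesis by (simp add: mean_demand_def)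
  qed
  then show ?thesis
    unfolding local_value_def relabel_incident_edges[OF \<pi> v \<tau>] sum.reindex[OF inj]
    by (intro arg_cong2[where f=min] refl sum.cong) auto
qed

lemma reach_relabel:
  assumes \<pi>: "inj_on \<pi> S" and \<tau>: "\<tau> \<subseteq> Pow S" and v: "v \<in> S"
  shows "reach ((`) \<pi> ` \<tau>) (\<pi> v) t = \<pi> ` reach \<tau> v t"
proof (induction t)
  case (Suc t)
  have R: "reach \<tau> v t \<subseteq> S" by (rule reach_subset) (use v \<tau> in auto)
  have "\<pi> ` e \<inter> \<pi> ` reach \<tau> v t \<noteq> {} \<longleftrightarrow> e \<inter> reach \<tau> v t \<noteq> {}" if "e \<in> \<tau>" for e
  proof -
    have "e \<subseteq> S" using that \<tau> by auto
    then show ?thesis using inj_on_image_Int[OF \<pi> _ R, of e] by (metis image_is_empty)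
  qed
  then have "{e\<in>(`) \<pi> ` \<tau>. e \<inter> \<pi> ` reach \<tau> v t \<noteq> {}} = (`) \<pi> ` {e\<in>\<tau>. e \<inter> reach \<tau> v t \<noteq> {}}"
    by (simp only: Compr_image_eq cong: conj_cong)
  then show ?case unfolding reach.simps Suc by (simp add: image_Un image_Union)
qed simp

lemma ball_edges_relabel:
  assumes \<pi>: "inj_on \<pi> S" and \<tau>: "\<tau> \<subseteq> Pow S" and v: "v \<in> S"
  shows "ball_edges ((`) \<pi> ` \<tau>) (\<pi> v) t = (`) \<pi> ` ball_edges \<tau> v t"
proof -
  have R: "reach \<tau> v t \<subseteq> S" by (rule reach_subset) (use v \<tau> in auto)
  have "\<pi> ` e \<inter> \<pi> ` reach \<tau> v t \<noteq> {} \<longleftrightarrow> e \<inter> reach \<tau> v t \<noteq> {}" if "e \<in> \<tau>" for e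
  proof -
    have "e \<subseteq> S" using that \<tau> by auto
    then show ?thesis using inj_on_image_Int[OF \<pi> _ R, of e] by (metis image_is_empty)
  qed
  then have "{e\<in>(`) \<pi> ` \<tau>. e \<inter> \<pi> ` reach \<tau> v t \<noteq> {}} = (`) \<pi> ` {e\<in>\<tau>. e \<inter> reach \<tau> v t \<noteq> {}}"
    by (simp only: Compr_image_eq cong: conj_cong)
  then show ?thesis unfolding ball_edges_def reach_relabel[OF assms] .
qed

text \<open>
  Each vertex of a new layer comes with its own edge to the previous layers.
\<close>

lemma card_reach_le_edges:
  assumes E: "finite E" "\<And>e. e \<in> E \<Longrightarrow> card e = 2"
  shows "finite (reach E v t) \<and> card (reach E v t) \<le> Suc (card {e\<in>E. e \<subseteq> reach E v t})"
proof (induction t)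
  case (Suc t)
  let ?R = "reach E v t" and ?R' = "reach E v (Suc t)"
  have "finite e" if "e \<in> E" for e using E(2)[OF that] by (simp add: card_ge_0_finite)
  then have finR': "finite ?R'" unfolding reach.simps using Suc E(1) by (intro finite_UnI finite_Union) simp_all
  have RR': "?R \<subseteq> ?R'" by (rule reach_mono) simp
  have "\<exists>e. e \<in> E \<and> u \<in> e \<and> e \<inter> ?R \<noteq> {}" if "u \<in> ?R' - ?R" for u using that by auto
  then obtain f where f: "\<And>u. u \<in> ?R' - ?R \<Longrightarrow> f u \<in> E \<and> u \<in> f u \<and> f u \<inter> ?R \<noteq> {}" by metis
  have inj: "inj_on f (?R' - ?R)"
  proof (rule inj_onI)
    fix u u' assume u: "u \<in> ?R' - ?R" "u' \<in> ?R' - ?R" "f u = f u'"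
    obtain s where s: "s \<in> f u" "s \<in> ?R" using f[OF u(1)] by auto
    have "card (f u) = 2" using f[OF u(1)] E by auto
    moreover have "{u, u', s} \<subseteq> f u" using f u s by auto
    ultimately have "card {u, u', s} \<le> 2" using card_mono[of "f u" "{u, u', s}"] by (simp add: card_ge_0_finite)
    then show "u = u'" using u s by (auto simp: card_insert_if split: if_splits)
  qed
  have "card ?R' = card ?R + card (?R' - ?R)"
    using card_Diff_subset[OF _ RR'] card_mono[OF finR' RR'] Suc.IH by simp
  also have "card (?R' - ?R) = card (f ` (?R' - ?R))" using inj by (simp add: card_image)
  also have "card ?R + \<dots> \<le> Suc (card {e\<in>E. e \<subseteq> ?R}) + card (f ` (?R' - ?R))" using Suc by simp
  also have "\<dots> = Suc (card ({e\<in>E. e \<subseteq> ?R} \<union> f ` (?R' - ?R)))"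
  proof -
    have "\<not> f u \<subseteq> ?R" if "u \<in> ?R' - ?R" for u using f[OF that] that by blast
    then have "{e\<in>E. e \<subseteq> ?R} \<inter> f ` (?R' - ?R) = {}" by (auto simp del: reach.simps)
    then show ?thesis using E finR' by (simp add: card_Un_disjoint)
  qed
  also have "\<dots> \<le> Suc (card {e\<in>E. e \<subseteq> ?R'})"
  proof -
    have "f u \<in> {e\<in>E. e \<subseteq> ?R'}" if "u \<in> ?R' - ?R" for u using f[OF that] by auto
    then have "f ` (?R' - ?R) \<subseteq> {e\<in>E. e \<subseteq> ?R'}" by (rule image_subsetI)
    moreover have "{e\<in>E. e \<subseteq> ?R} \<subseteq> {e\<in>E. e \<subseteq> ?R'}" using RR' by (auto simp del: reach.simps)
    ultimately have "{e\<in>E. e \<subseteq> ?R} \<union> f ` (?R' - ?R) \<subseteq> {e\<in>E. e \<subseteq> ?R'}" by (rule Un_least[rotated])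
    then show ?thesis using E by (simp add: card_mono)
  qed
  finally show ?case using finR' by simp
qed simp

section \<open>Rooted balls on a given vertex set\<close>

text \<open>
  The possible outcomes (root, ball) of an exploration that reaches exactly the vertices in S.
\<close>

definition rooted_balls :: "nat \<Rightarrow> 'a set \<Rightarrow> ('a \<times> 'a set set) set" where
  "rooted_balls t S = {(v, \<tau>). v \<in> S \<and> \<tau> \<subseteq> {e. e \<subseteq> S \<and> card e = 2} \<and>
     ball_edges \<tau> v t = \<tau> \<and> reach \<tau> v (Suc t) = S}"

lemma finite_rooted_balls: "finite S \<Longrightarrow> finite (rooted_balls t S)"
  by (rule finite_subset[of _ "S \<times> Pow (Pow S)"]) (auto simp: rooted_balls_def)

text \<open>
  A ball is connected.  Its probability decays with the number of its edges, and this is what makes the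
  expected number of balls of a given shape at most of order n.
\<close>

lemma rooted_balls_card:
  assumes "(v, \<tau>) \<in> rooted_balls t S" "finite S"
  shows "card S \<le> Suc (card \<tau>)"
proof -
  have \<tau>: "\<tau> \<subseteq> Pow S" "\<And>e. e \<in> \<tau> \<Longrightarrow> card e = 2" "reach \<tau> v (Suc t) = S"
    using assms(1) by (auto simp: rooted_balls_def)
  have fin: "finite \<tau>" by (rule finite_subset[OF \<tau>(1)]) (use assms(2) in simp)
  have "card S \<le> Suc (card {e\<in>\<tau>. e \<subseteq> S})"
    using card_reach_le_edges[OF fin \<tau>(2), of v "Suc t"] \<tau>(3) by simp
  also have "{e\<in>\<tau>. e \<subseteq> S} = \<tau>" using \<tau>(1) by auto
  finally show ?thesis .
qed

lemma rooted_balls_relabel_mem: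
  assumes "inj_on \<pi> S" "(v, \<tau>) \<in> rooted_balls t S"
  shows "(\<pi> v, (`) \<pi> ` \<tau>) \<in> rooted_balls t (\<pi> ` S)"
proof -
  have \<tau>: "v \<in> S" "\<tau> \<subseteq> Pow S" "\<And>e. e \<in> \<tau> \<Longrightarrow> card e = 2" "ball_edges \<tau> v t = \<tau>" "reach \<tau> v (Suc t) = S"
    using assms(2) by (auto simp: rooted_balls_def)
  have "card (\<pi> ` e) = 2" if "e \<in> \<tau>" for e
  proof -
    have "inj_on \<pi> e" using assms(1) \<tau>(2) that by (auto intro: inj_on_subset)
    then show ?thesis using \<tau>(3)[OF that] by (simp add: card_image)
  qed
  then show ?thesis
    using \<tau> ball_edges_relabel[OF assms(1) \<tau>(2,1), of t] reach_relabel[OF assms(1) \<tau>(2,1), of "Suc t"]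
    unfolding rooted_balls_def by (auto simp del: reach.simps)
qed

lemma sum_rooted_balls_relabel:
  fixes g :: "'b \<times> 'b set set \<Rightarrow> real"
  assumes \<pi>: "inj_on \<pi> S"
  shows "(\<Sum>p\<in>rooted_balls t (\<pi> ` S). g p) = (\<Sum>(v, \<tau>)\<in>rooted_balls t S. g (\<pi> v, (`) \<pi> ` \<tau>))"
proof -
  let ?\<sigma> = "inv_into S \<pi>"
  have undo: "?\<sigma> (\<pi> v) = v" if "v \<in> S" for v using \<pi> that by (rule inv_into_f_f)
  have redo: "\<pi> (?\<sigma> v) = v" if "v \<in> \<pi> ` S" for v using that by (rule f_inv_into_f)
  have undo': "(`) ?\<sigma> ` (`) \<pi> ` \<tau> = \<tau>" if "\<tau> \<subseteq> Pow S" for \<tau>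
  proof -
    have "(`) ?\<sigma> ` (`) \<pi> ` \<tau> = (\<lambda>e. ?\<sigma> ` \<pi> ` e) ` \<tau>" by (rule image_image)
    also have "\<dots> = (\<lambda>e. e) ` \<tau>"
      by (rule image_cong[OF refl], rule inv_into_image_cancel[OF \<pi>]) (use that in blast)
    finally show ?thesis by simp
  qed
  have redo': "(`) \<pi> ` (`) ?\<sigma> ` \<tau> = \<tau>" if "\<tau> \<subseteq> Pow (\<pi> ` S)" for \<tau>
  proof -
    have "(`) \<pi> ` (`) ?\<sigma> ` \<tau> = (\<lambda>e. \<pi> ` ?\<sigma> ` e) ` \<tau>" by (rule image_image)
    also have "\<dots> = (\<lambda>e. e) ` \<tau>"
      by (rule image_cong[OF refl], rule image_inv_into_cancel[OF refl]) (use that in blast)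
    finally show ?thesis by simp
  qed
  have \<sigma>: "inj_on ?\<sigma> (\<pi> ` S)" by (rule inj_on_inv_into) simp
  have \<sigma>S: "?\<sigma> ` \<pi> ` S = S" by (rule inv_into_image_cancel[OF \<pi>]) simp
  have sub: "\<tau> \<subseteq> Pow S" "v \<in> S" if "(v, \<tau>) \<in> rooted_balls t S" for v \<tau> and S :: "'c set"
    using that by (auto simp: rooted_balls_def)
  show ?thesis
  proof (rule sum.reindex_bij_witness[where i="\<lambda>(v, \<tau>). (\<pi> v, (`) \<pi> ` \<tau>)" and j="\<lambda>(v, \<tau>). (?\<sigma> v, (`) ?\<sigma> ` \<tau>)"])
    fix p assume p: "p \<in> rooted_balls t (\<pi> ` S)"
    obtain v \<tau> where vt: "p = (v, \<tau>)" by (cases p)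
    show "(case case p of (v, \<tau>) \<Rightarrow> (?\<sigma> v, (`) ?\<sigma> ` \<tau>) of (v, \<tau>) \<Rightarrow> (\<pi> v, (`) \<pi> ` \<tau>)) = p"
      unfolding vt using redo'[OF sub(1)] redo[OF sub(2)] p[unfolded vt] by simp
    show "(case p of (v, \<tau>) \<Rightarrow> (?\<sigma> v, (`) ?\<sigma> ` \<tau>)) \<in> rooted_balls t S"
      using rooted_balls_relabel_mem[OF \<sigma>] p unfolding vt \<sigma>S by simp
    show "(case case p of (v, \<tau>) \<Rightarrow> (?\<sigma> v, (`) ?\<sigma> ` \<tau>) of (v, \<tau>) \<Rightarrow> g (\<pi> v, (`) \<pi> ` \<tau>)) = g p"
      unfolding vt using redo'[OF sub(1)] redo[OF sub(2)] p[unfolded vt] by simp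
  next
    fix p assume p: "p \<in> rooted_balls t S"
    obtain v \<tau> where vt: "p = (v, \<tau>)" by (cases p)
    show "(case case p of (v, \<tau>) \<Rightarrow> (\<pi> v, (`) \<pi> ` \<tau>) of (v, \<tau>) \<Rightarrow> (?\<sigma> v, (`) ?\<sigma> ` \<tau>)) = p"
      unfolding vt using undo'[OF sub(1)] undo[OF sub(2)] p[unfolded vt] by simp
    show "(case p of (v, \<tau>) \<Rightarrow> (\<pi> v, (`) \<pi> ` \<tau>)) \<in> rooted_balls t (\<pi> ` S)"
      using rooted_balls_relabel_mem[OF \<pi>] p unfolding vt by simp
  qed
qed

section \<open>Limits of binomial quotients\<close>

lemma choose_Suc_real:
  assumes "k \<le> n"
  shows "real (Suc k) * real (n choose Suc k) = (real n - k) * real (n choose k)"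
  using binomial_absorption[of k n] binomial_absorb_comp[of n k] assms
  by (metis of_nat_diff of_nat_mult)

lemma binomial_over_power_convergent: "convergent (\<lambda>n. real (n choose k) / real n ^ k)"
proof (induction k)
  case 0
  then show ?case by (simp add: convergent_const)
next
  case (Suc k)
  have "(\<lambda>n. (real n - k) / real n / (k + 1)) \<longlonglongrightarrow> 1 / (k + 1)"
    by (intro tendsto_divide tendsto_const) (real_asymp, simp)
  then have "convergent (\<lambda>n. (real n - k) / real n / (k + 1))" by (auto simp: convergent_def)
  with Suc.IH have "convergent (\<lambda>n. real (n choose k) / real n ^ k * ((real n - k) / real n / (k + 1)))"
    by (rule convergent_mult)
  moreover have "real (n choose Suc k) / real n ^ Suc k = real (n choose k) / real n ^ k * ((real n - k) / real n / (k + 1))"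
    if "n \<ge> k" for n
  proof -
    have "real (Suc k) * real (n choose Suc k) = (real n - k) * real (n choose k)"
      by (rule choose_Suc_real[OF that])
    then have "real (n choose Suc k) = (real n - k) * real (n choose k) / (k + 1)"
      by (simp add: field_simps)
    then show ?thesis by (simp add: mult_ac)
  qed
  ultimately show ?case
    by (subst convergent_cong[where g="\<lambda>n. real (n choose k) / real n ^ k * ((real n - k) / real n / (k + 1))"])
       (auto intro: eventually_sequentiallyI)
qed

text \<open>
  Each factor (N' - l) / (N - l) of the quotient is at most N' / N.
\<close>

lemma binomial_shrink_upper:
  assumes "N' \<le> N" "m \<le> N'"
  shows "real (N' choose m) \<le> (real N' / N) ^ m * real (N choose m)"
  using assms(2)
proof (induction m)
  case (Suc m)
  have "real (Suc m) * real (N' choose Suc m) = (real N' - m) * real (N' choose m)"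
    by (rule choose_Suc_real) (use Suc.prems in auto)
  also have "\<dots> \<le> (real N' / N * (real N - m)) * ((real N' / N) ^ m * real (N choose m))"
  proof (intro mult_mono)
    have "real N' * m \<le> N * real m" using assms(1) by (intro mult_right_mono) auto
    then show "real N' - m \<le> real N' / N * (real N - m)"
      using Suc.prems assms(1) by (simp add: field_simps)
  qed (use Suc assms in auto)
  also have "\<dots> = (real N' / N) ^ Suc m * ((real N - m) * real (N choose m))" by simp
  also have "(real N - m) * real (N choose m) = real (Suc m) * real (N choose Suc m)"
    by (rule choose_Suc_real[symmetric]) (use Suc.prems assms in auto)
  finally have "real (Suc m) * real (N' choose Suc m) \<le> real (Suc m) * ((real N' / N) ^ Suc m * real (N choose Suc m))"
    by (simp only: mult.left_commute)
  then show ?case by (simp only: mult_le_cancel_left_pos of_nat_0_less_iff zero_less_Suc)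
qed simp

text \<open>
  Each factor (N' - l) / (N - l) of the quotient is at least (N' - x) / (N - x), since l is at most x.
\<close>

lemma binomial_shrink_lower:
  assumes "N' \<le> N" "real m \<le> x" "x < real N'"
  shows "((real N' - x) / (real N - x)) ^ m * real (N choose m) \<le> real (N' choose m)"
  using assms(2)
proof (induction m)
  case (Suc m)
  let ?r = "(real N' - x) / (real N - x)"
  have mN: "m \<le> N'" "m \<le> N" using Suc.prems assms by auto
  have "real (Suc m) * (?r ^ Suc m * real (N choose Suc m)) = ?r ^ Suc m * (real (Suc m) * real (N choose Suc m))"
    by simp
  also have "\<dots> = (?r * (real N - m)) * (?r ^ m * real (N choose m))"
    unfolding choose_Suc_real[OF mN(2)] by simp
  also have "\<dots> \<le> (real N' - m) * real (N' choose m)"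
  proof (intro mult_mono)
    have "0 \<le> (x - m) * (real N - N')" using Suc.prems assms by (intro mult_nonneg_nonneg) auto
    then show "?r * (real N - m) \<le> real N' - m"
      using assms by (simp add: field_simps)
  qed (use Suc assms mN in auto)
  also have "\<dots> = real (Suc m) * real (N' choose Suc m)"
    by (rule choose_Suc_real[OF mN(1), symmetric])
  finally show ?case by (simp only: mult_le_cancel_left_pos of_nat_0_less_iff zero_less_Suc)
qed simp

lemma choose_two_real: "real (n choose 2) = real n * (real n - 1) / 2"
  by (cases n) (simp_all add: choose_two real_of_nat_div algebra_simps)

text \<open>
  The quotient is the probability that none of the m edges meets a given set of i vertices.  It is squeezed
  between powers with base 1 - 2 i / n + o(1 / n) and exponent close to c n.
\<close>

lemma isolation_probability_limit:
  fixes c :: real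
  assumes c: "c > 0"
  shows "(\<lambda>n. real (((n - i) choose 2) choose nat \<lfloor>c * n\<rfloor>) / real ((n choose 2) choose nat \<lfloor>c * n\<rfloor>))
           \<longlonglongrightarrow> exp (- 2 * c * i)"
proof (rule tendsto_sandwich)
  let ?m = "\<lambda>n. nat \<lfloor>c * real n\<rfloor>"
  let ?P = "\<lambda>n::nat. real n * (real n - 1) / 2"
  let ?P' = "\<lambda>n::nat. (real n - i) * (real n - i - 1) / 2"
  let ?u = "\<lambda>n::nat. (?P' n / ?P n) powr (c * n - 1)"
  let ?l = "\<lambda>n::nat. ((?P' n - c * n) / (?P n - c * n)) powr (c * n)"
  have ev: "\<forall>\<^sub>F n::nat in sequentially. c * n < ?P' n \<and> c * n > 1 \<and> ?P' n \<le> ?P n \<and> i + 1 < real n"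
  proof (intro eventually_conj)
    show "\<forall>\<^sub>F n::nat in sequentially. c * n < ?P' n" using c by real_asymp
    show "\<forall>\<^sub>F n::nat in sequentially. c * n > 1" using c by real_asymp
    show "\<forall>\<^sub>F n::nat in sequentially. i + 1 < real n" by real_asymp
    then show "\<forall>\<^sub>F n::nat in sequentially. ?P' n \<le> ?P n"
    proof eventually_elim
      case (elim n)
      then have "(real n - i) * (real n - i - 1) \<le> real n * (real n - 1)" by (intro mult_mono) auto
      then show ?case by simp
    qed
  qed
  have real': "real ((n - i) choose 2) = ?P' n" if "i + 1 < real n" for n
    using that by (simp add: choose_two_real of_nat_diff)
  show "?l \<longlonglongrightarrow> exp (- 2 * c * i)" using c by (real_asymp, simp add: field_simps)
  show "?u \<longlonglongrightarrow> exp (- 2 * c * i)" by (real_asymp, simp add: field_simps)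
  show "\<forall>\<^sub>F n in sequentially. real (((n - i) choose 2) choose ?m n) / real ((n choose 2) choose ?m n) \<le> ?u n"
    using ev
  proof eventually_elim
    case (elim n)
    have m: "real (?m n) \<le> c * n" "c * n - 1 \<le> real (?m n)" using elim by linarith+
    have N: "real ((n - i) choose 2) \<le> real (n choose 2)" "real (?m n) \<le> real ((n - i) choose 2)"
      unfolding real'[OF conjunct2[OF conjunct2[OF conjunct2[OF elim]]]] choose_two_real[of n]
      using elim m by linarith+
    have "0 < ?P' n" using elim by linarith
    then have pos: "0 < ?P' n / ?P n" "?P' n / ?P n \<le> 1" using elim by auto
    have "real (((n - i) choose 2) choose ?m n) \<le> (?P' n / ?P n) ^ ?m n * real ((n choose 2) choose ?m n)"
      using binomial_shrink_upper[of "(n - i) choose 2" "n choose 2" "?m n"] N real'[of n] elim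
      by (simp add: choose_two_real)
    moreover have "((n choose 2) choose ?m n) > 0" using N by auto
    ultimately have "real (((n - i) choose 2) choose ?m n) / real ((n choose 2) choose ?m n) \<le> (?P' n / ?P n) ^ ?m n"
      by (simp add: divide_le_eq)
    also have "\<dots> = (?P' n / ?P n) powr (real (?m n))" by (rule powr_realpow[OF pos(1), symmetric])
    also have "\<dots> \<le> ?u n" by (rule powr_mono') (use pos m in auto)
    finally show ?case .
  qed
  show "\<forall>\<^sub>F n in sequentially. ?l n \<le> real (((n - i) choose 2) choose ?m n) / real ((n choose 2) choose ?m n)"
    using ev
  proof eventually_elim
    case (elim n)
    let ?q = "(?P' n - c * n) / (?P n - c * n)"
    have m: "real (?m n) \<le> c * n" using elim by linarith
    have N: "real ((n - i) choose 2) \<le> real (n choose 2)" "real (?m n) \<le> real ((n - i) choose 2)"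
      unfolding real'[OF conjunct2[OF conjunct2[OF conjunct2[OF elim]]]] choose_two_real[of n]
      using elim m by linarith+
    have "0 < ?P' n - c * n" "?P' n - c * n \<le> ?P n - c * n" using elim by linarith+
    then have pos: "0 < ?q" "?q \<le> 1" by (simp_all only: divide_pos_pos divide_le_eq_1 order.strict_trans2) simp_all
    have "?l n \<le> ?q powr (real (?m n))" by (rule powr_mono') (use pos m in auto)
    also have "\<dots> = ?q ^ ?m n" by (rule powr_realpow[OF pos(1)])
    finally have "?l n \<le> ?q ^ ?m n" .
    moreover have "?q ^ ?m n * real ((n choose 2) choose ?m n) \<le> real (((n - i) choose 2) choose ?m n)"
      using binomial_shrink_lower[of "(n - i) choose 2" "n choose 2" "?m n" "c * n"] N m real'[of n] elim
      by (simp add: choose_two_real)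
    moreover have "((n choose 2) choose ?m n) > 0" using N by auto
    ultimately show ?case by (simp add: le_divide_eq) (smt (verit) mult_right_mono of_nat_0_le_iff)
  qed
qed

text \<open>
  Lowering the number of chosen edges by one multiplies the binomial coefficient by approximately 2 c / n.
\<close>

lemma edge_probability_limit:
  fixes c :: real
  assumes c: "c > 0"
  shows "(\<lambda>n. real n ^ j * real (((n - i) choose 2) choose (nat \<lfloor>c * n\<rfloor> - j)) / real (((n - i) choose 2) choose nat \<lfloor>c * n\<rfloor>))
           \<longlonglongrightarrow> (2 * c) ^ j"
proof (induction j)
  case 0
  let ?m = "\<lambda>n. nat \<lfloor>c * real n\<rfloor>"
  have "\<forall>\<^sub>F n::nat in sequentially. c * n < (real n - i) * (real n - i - 1) / 2 \<and> i < real n"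
    using c by (intro eventually_conj; real_asymp)
  then have "\<forall>\<^sub>F n in sequentially. real n ^ 0 * real (((n - i) choose 2) choose (?m n - 0)) / real (((n - i) choose 2) choose ?m n) = 1"
  proof eventually_elim
    case (elim n)
    then have "real (?m n) \<le> real ((n - i) choose 2)" using c by (simp add: choose_two_real of_nat_diff) linarith
    then show ?case by auto
  qed
  then show ?case by (simp add: tendsto_eventually)
next
  case (Suc j)
  let ?m = "\<lambda>n. nat \<lfloor>c * real n\<rfloor>"
  let ?N = "\<lambda>n. (n - i) choose 2"
  let ?q = "\<lambda>n. real n * ((real (?m n) - j) / (real (?N n) - real (?m n) + j + 1))"
  have "?q \<longlonglongrightarrow> 2 * c"
  proof (rule tendsto_sandwich)
    let ?P' = "\<lambda>n::nat. (real n - i) * (real n - i - 1) / 2"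
    let ?l = "\<lambda>n::nat. real n * ((c * n - 1 - j) / (?P' n - (c * n - 1) + j + 1))"
    let ?u = "\<lambda>n::nat. real n * ((c * n - j) / (?P' n - c * n + j + 1))"
    have ev: "\<forall>\<^sub>F n::nat in sequentially. c * n < ?P' n \<and> j + 2 < c * n \<and> i < real n"
      using c by (intro eventually_conj; real_asymp)
    show "?l \<longlonglongrightarrow> 2 * c" using c by real_asymp
    show "?u \<longlonglongrightarrow> 2 * c" using c by real_asymp
    show "\<forall>\<^sub>F n in sequentially. ?l n \<le> ?q n"
      using ev
    proof eventually_elim
      case (elim n)
      have m: "real (?m n) \<le> c * n" "c * n - 1 \<le> real (?m n)" using elim by linarith+
      have N: "real (?N n) = ?P' n" using elim by (simp add: choose_two_real of_nat_diff)
      show ?case unfolding N by (intro mult_left_mono frac_le) (use m elim in linarith)+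
    qed
    show "\<forall>\<^sub>F n in sequentially. ?q n \<le> ?u n"
      using ev
    proof eventually_elim
      case (elim n)
      have m: "real (?m n) \<le> c * n" "c * n - 1 \<le> real (?m n)" using elim by linarith+
      have N: "real (?N n) = ?P' n" using elim by (simp add: choose_two_real of_nat_diff)
      show ?case unfolding N by (intro mult_left_mono frac_le) (use m elim in linarith)+
    qed
  qed
  from tendsto_mult[OF this Suc.IH]
  have lim: "(\<lambda>n. ?q n * (real n ^ j * real (?N n choose (?m n - j)) / real (?N n choose ?m n))) \<longlonglongrightarrow> (2 * c) ^ Suc j"
    by simp
  have ev: "\<forall>\<^sub>F n::nat in sequentially. c * n < (real n - i) * (real n - i - 1) / 2 \<and> j + 2 < c * n \<and> i < real n"
    using c by (intro eventually_conj; real_asymp)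
  show ?case
  proof (rule Lim_transform_eventually[OF lim])
    show "\<forall>\<^sub>F n in sequentially. ?q n * (real n ^ j * real (?N n choose (?m n - j)) / real (?N n choose ?m n)) =
       real n ^ Suc j * real (?N n choose (?m n - Suc j)) / real (?N n choose ?m n)"
      using ev
    proof eventually_elim
      case (elim n)
      have m: "real (?m n) \<le> c * n" "c * n - 1 \<le> real (?m n)" using elim by linarith+
      have N: "real (?N n) = (real n - i) * (real n - i - 1) / 2" using elim by (simp add: choose_two_real of_nat_diff)
      define k where "k = ?m n - Suc j"
      have "j + 1 < real (?m n)" using m elim by linarith
      then have k: "?m n - j = Suc k" "real (?m n) = real k + j + 1" by (auto simp: k_def)
      have "real (?m n) \<le> real (?N n)" using elim m N by linarith
      then have kN: "k \<le> ?N n" "real k + j + 1 \<le> real (?N n)" using k by auto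
      have "real (Suc k) * real (?N n choose Suc k) = (real (?N n) - k) * real (?N n choose k)"
        by (rule choose_Suc_real[OF kN(1)])
      then have eq: "real (?N n choose k) = (real k + 1) / (real (?N n) - k) * real (?N n choose Suc k)"
        using kN by (simp add: field_simps)
      have "?q n = real n * ((real k + 1) / (real (?N n) - k))" by (simp add: k)
      then show ?case unfolding k_def[symmetric] k(1) eq by simp
    qed
  qed
qed

text \<open>
  The expected number, divided by n, of balls with k vertices, j edges and i vertices in the interior, for
  one fixed shape.  There are about n to the k positions, each with probability of order n to the -j, and
  k - 1 is at most j.  For trees, k - 1 = j, the limit is positive, for other shapes it is zero.
\<close>

lemma neighbourhood_count_convergent:
  fixes c :: real
  assumes c: "c > 0" and k: "k \<le> Suc j"
  shows "convergent (\<lambda>n. real (n choose k) / n *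
           (real (((n - i) choose 2) choose (nat \<lfloor>c * n\<rfloor> - j)) / real ((n choose 2) choose nat \<lfloor>c * n\<rfloor>)))"
proof -
  let ?m = "\<lambda>n. nat \<lfloor>c * real n\<rfloor>"
  let ?N = "\<lambda>n. (n - i) choose 2"
  let ?X = "\<lambda>n. real (n choose k) / real n ^ k"
  let ?W = "\<lambda>n::nat. inverse (real n) ^ (Suc j - k)"
  let ?Y = "\<lambda>n. real n ^ j * real (?N n choose (?m n - j)) / real (?N n choose ?m n)"
  let ?Z = "\<lambda>n. real (?N n choose ?m n) / real ((n choose 2) choose ?m n)"
  have "convergent ?W"
    using tendsto_power[OF lim_inverse_n[where 'a=real]] by (auto simp: convergent_def)
  moreover have "convergent ?Y" using edge_probability_limit[OF c] by (auto simp: convergent_def)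
  moreover have "convergent ?Z" using isolation_probability_limit[OF c] by (auto simp: convergent_def)
  ultimately have conv: "convergent (\<lambda>n. ?X n * ?W n * (?Y n * ?Z n))"
    using binomial_over_power_convergent by (intro convergent_mult)
  have "\<forall>\<^sub>F n::nat in sequentially. c * n < (real n - i) * (real n - i - 1) / 2 \<and> i < real n"
    using c by (intro eventually_conj; real_asymp)
  then have "\<forall>\<^sub>F n in sequentially. ?X n * ?W n * (?Y n * ?Z n) = real (n choose k) / n *
           (real (?N n choose (?m n - j)) / real ((n choose 2) choose ?m n))"
  proof eventually_elim
    case (elim n)
    then have "real (?m n) \<le> real (?N n)" using c by (simp add: choose_two_real of_nat_diff) linarith
    then have nz: "real (?N n choose ?m n) \<noteq> 0" by auto
    have n: "real n \<noteq> 0" using elim by auto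
    have "real n ^ Suc j = real n ^ k * real n ^ (Suc j - k)" using k by (metis le_add_diff_inverse power_add)
    then have "?X n * ?W n * real n ^ j = real (n choose k) / n"
      using n by (simp add: field_simps)
    moreover have "?X n * ?W n * (?Y n * ?Z n) =
      ?X n * ?W n * real n ^ j * (real (?N n choose (?m n - j)) / real ((n choose 2) choose ?m n))"
      using nz by simp
    ultimately show ?case by simp
  qed
  then show ?thesis using conv by (subst convergent_cong[symmetric]) auto
qed

section \<open>Convergence of averages of local functionals\<close>

lemma eventually_sparse:
  fixes c :: real
  assumes "c > 0"
  shows "\<forall>\<^sub>F n in sequentially. sparse n (nat \<lfloor>c * real n\<rfloor>) c"
proof -
  have "\<forall>\<^sub>F n::nat in sequentially. c * n \<le> real n * (real n - 1) / 2 \<and> 2 \<le> n"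
    using assms by (intro eventually_conj; (real_asymp | rule eventually_ge_at_top))
  then show ?thesis
  proof eventually_elim
    case (elim n)
    have "0 \<le> c * n" using assms by simp
    then have m: "real (nat \<lfloor>c * real n\<rfloor>) \<le> c * n" by linarith
    moreover have "real (nat \<lfloor>c * real n\<rfloor>) \<le> real (n choose 2)"
      unfolding choose_two_real using m elim by linarith
    ultimately show ?case using elim by (simp add: sparse_def)
  qed
qed

text \<open>
  Once the ball is prescribed, the remaining m - card \<open>\<tau>\<close> edges avoid the explored vertices.
\<close>

lemma mean_ball_edges_eq:
  assumes v: "v \<in> {1..n}" and \<tau>: "\<tau> \<subseteq> all_edges n" "ball_edges \<tau> v T = \<tau>" "card \<tau> \<le> m"
  shows "subset_mean (all_edges n) m (\<lambda>E. of_bool (ball_edges E v T = \<tau>)) =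
    real (((n - card (reach \<tau> v T)) choose 2) choose (m - card \<tau>)) / real ((n choose 2) choose m)"
proof -
  define U where "U = reach \<tau> v T"
  define R where "R = {e\<in>all_edges n. e \<inter> U \<noteq> {}}"
  have U: "U \<subseteq> {1..n}" unfolding U_def by (rule reach_subset) (use v \<tau> in \<open>auto simp: all_edges_def\<close>)
  have \<tau>R: "\<tau> \<subseteq> R"
  proof
    fix e assume e: "e \<in> \<tau>"
    then have "e \<in> ball_edges \<tau> v T" using \<tau> by simp
    then show "e \<in> R" using \<tau>(1) e by (auto simp: R_def U_def ball_edges_def)
  qed
  have R: "R \<subseteq> all_edges n" by (auto simp: R_def)
  have "subset_mean (all_edges n) m (\<lambda>E. of_bool (ball_edges E v T = \<tau>)) =
        subset_mean (all_edges n) m (\<lambda>E. of_bool (E \<inter> R = \<tau>))"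
  proof (rule subset_mean_cong)
    fix E assume "E \<subseteq> all_edges n"
    then have "E \<inter> R = {e\<in>E. e \<inter> reach \<tau> v T \<noteq> {}}" by (auto simp: R_def U_def)
    then show "of_bool (ball_edges E v T = \<tau>) = (of_bool (E \<inter> R = \<tau>) :: real)"
      using ball_edges_eq_iff[OF \<tau>(2), of E] by simp
  qed
  also have "\<dots> = real ((card (all_edges n) - card R) choose (m - card \<tau>)) / real (card (all_edges n) choose m)"
    by (rule subset_mean_trace) (use R \<tau>R \<tau> in auto)
  also have "card (all_edges n) - card R = card (all_edges n - R)"
    using R by (simp add: card_Diff_subset finite_subset)
  also have "all_edges n - R = {e. e \<subseteq> {1..n} - U \<and> card e = 2}" by (auto simp: all_edges_def R_def)
  also have "card \<dots> = (n - card U) choose 2"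
    using U by (simp add: n_subsets card_Diff_subset finite_subset)
  finally show ?thesis by (simp add: card_all_edges U_def)
qed

text \<open>
  For a given graph, each root contributes exactly one pair to the right-hand side: the vertex set reached
  and the ball.
\<close>

lemma sum_over_small_balls:
  fixes F :: "nat set set \<Rightarrow> nat \<Rightarrow> real"
  assumes E: "E \<subseteq> all_edges n"
  shows "(\<Sum>v\<in>{1..n}. of_bool (card (reach E v (Suc T)) \<le> K) * F (ball_edges E v T) v) =
    (\<Sum>S | S \<subseteq> {1..n} \<and> card S \<le> K. \<Sum>(v, \<tau>)\<in>rooted_balls T S. of_bool (ball_edges E v T = \<tau>) * F \<tau> v)"
proof -
  let ?SS = "{S. S \<subseteq> {1..n} \<and> card S \<le> K}"
  let ?h = "\<lambda>(v, \<tau>). of_bool (ball_edges E v T = \<tau>) * F \<tau> v"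
  let ?V = "{v\<in>{1..n}. card (reach E v (Suc T)) \<le> K}"
  let ?b = "\<lambda>v. (v, ball_edges E v T)"
  have finSS: "finite ?SS" by (rule finite_subset[of _ "Pow {1..n}"]) auto
  have finS: "finite S" if "S \<in> ?SS" for S using that finite_subset[of S "{1..n}"] by auto
  have "(\<Sum>S\<in>?SS. \<Sum>p\<in>rooted_balls T S. ?h p) = (\<Sum>p\<in>(\<Union>S\<in>?SS. rooted_balls T S). ?h p)"
    by (rule sum.UNION_disjoint[symmetric])
       (use finSS finite_rooted_balls[OF finS] in \<open>auto simp: rooted_balls_def\<close>)
  also have "\<dots> = (\<Sum>p\<in>?b ` ?V. ?h p)"
  proof (rule sum.mono_neutral_right)
    show "finite (\<Union>S\<in>?SS. rooted_balls T S)"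
      by (intro finite_UN_I finSS finite_rooted_balls finS)
    show "?b ` ?V \<subseteq> (\<Union>S\<in>?SS. rooted_balls T S)"
    proof
      fix p assume "p \<in> ?b ` ?V"
      then obtain v where v: "v \<in> {1..n}" "card (reach E v (Suc T)) \<le> K" "p = (v, ball_edges E v T)" by auto
      have sub: "reach E v (Suc T) \<subseteq> {1..n}"
        by (rule reach_subset) (use v E in \<open>auto simp: all_edges_def\<close>)
      have "e \<subseteq> reach E v (Suc T)" if "e \<in> ball_edges E v T" for e
        using edges_in_ball_reach[OF ball_edges_idem that] reach_ball_edges[of "Suc T" T E v] by simp
      then have "p \<in> rooted_balls T (reach E v (Suc T))"
        using v E ball_edges_idem[of E v T] reach_ball_edges[of "Suc T" T E v] reach_self[of v E "Suc T"]
        by (auto simp: rooted_balls_def all_edges_def ball_edges_def simp del: reach.simps)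
      then show "p \<in> (\<Union>S\<in>?SS. rooted_balls T S)" using sub v(2) by blast
    qed
    show "\<forall>p\<in>(\<Union>S\<in>?SS. rooted_balls T S) - ?b ` ?V. ?h p = 0"
    proof
      fix p assume p: "p \<in> (\<Union>S\<in>?SS. rooted_balls T S) - ?b ` ?V"
      obtain v \<tau> where vt: "p = (v, \<tau>)" by (cases p)
      have "ball_edges E v T \<noteq> \<tau>"
      proof
        assume *: "ball_edges E v T = \<tau>"
        then have "reach \<tau> v (Suc T) = reach E v (Suc T)" using reach_ball_edges[of "Suc T" T E v] by simp
        then have "v \<in> ?V" using p by (auto simp: vt rooted_balls_def simp del: reach.simps)
        then show False using p * by (auto simp: vt simp del: reach.simps)
      qed
      then show "?h p = 0" by (simp add: vt)
    qed
  qed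
  also have "\<dots> = (\<Sum>v\<in>?V. F (ball_edges E v T) v)"
    by (subst sum.reindex) (auto simp: inj_on_def)
  also have "\<dots> = (\<Sum>v\<in>{1..n}. of_bool (card (reach E v (Suc T)) \<le> K) * F (ball_edges E v T) v)"
    by (rule sum.mono_neutral_cong_left) (auto simp del: reach.simps)
  finally show ?thesis by simp
qed

definition relabel_invariant :: "('a set set \<Rightarrow> 'a \<Rightarrow> real) \<Rightarrow> bool" where
  "relabel_invariant F \<longleftrightarrow> (\<forall>\<pi> S \<tau> v. finite S \<longrightarrow> inj_on \<pi> S \<longrightarrow> \<tau> \<subseteq> Pow S \<longrightarrow> v \<in> S \<longrightarrow>
     F ((`) \<pi> ` \<tau>) (\<pi> v) = F \<tau> v)"

text \<open>
  By symmetry, the contribution of a vertex set depends only on its size, so {1..k} can represent all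
  k-subsets.  What remains is a finite sum whose range is independent of n.
\<close>

lemma mean_over_small_balls:
  fixes F :: "nat set set \<Rightarrow> nat \<Rightarrow> real"
  assumes F: "relabel_invariant F" and m: "2 ^ K \<le> m"
  shows "(\<Sum>v\<in>{1..n}. subset_mean (all_edges n) m
            (\<lambda>E. of_bool (card (reach E v (Suc T)) \<le> K) * F (ball_edges E v T) v)) =
    (\<Sum>k\<le>K. \<Sum>(v, \<tau>)\<in>rooted_balls T {1..k}.
       real (n choose k) * (real (((n - card (reach \<tau> v T)) choose 2) choose (m - card \<tau>)) / real ((n choose 2) choose m)) * F \<tau> v)"
proof -
  let ?SS = "{S. S \<subseteq> {1..n} \<and> card S \<le> K}"
  let ?q = "\<lambda>(v::nat, \<tau>). real (((n - card (reach \<tau> v T)) choose 2) choose (m - card \<tau>)) / real ((n choose 2) choose m)"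
  let ?G = "\<lambda>k. \<Sum>(v, \<tau>)\<in>rooted_balls T {1..k}. ?q (v, \<tau>) * F \<tau> v"
  have finSS: "finite ?SS" by (rule finite_subset[of _ "Pow {1..n}"]) auto
  have finS: "finite S" if "S \<in> ?SS" for S using that finite_subset[of S "{1..n}"] by auto
  have "(\<Sum>v\<in>{1..n}. subset_mean (all_edges n) m
            (\<lambda>E. of_bool (card (reach E v (Suc T)) \<le> K) * F (ball_edges E v T) v)) =
        subset_mean (all_edges n) m (\<lambda>E. \<Sum>S\<in>?SS. \<Sum>(v, \<tau>)\<in>rooted_balls T S. of_bool (ball_edges E v T = \<tau>) * F \<tau> v)"
    unfolding subset_mean_sum[symmetric] by (intro subset_mean_cong sum_over_small_balls)
  also have "\<dots> = (\<Sum>S\<in>?SS. \<Sum>p\<in>rooted_balls T S. F (snd p) (fst p) *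
      subset_mean (all_edges n) m (\<lambda>E. of_bool (ball_edges E (fst p) T = snd p)))"
    by (simp add: subset_mean_sum case_prod_beta subset_mean_cmult[symmetric] mult.commute)
  also have "\<dots> = (\<Sum>S\<in>?SS. \<Sum>p\<in>rooted_balls T S. ?q p * F (snd p) (fst p))"
  proof (intro sum.cong refl)
    fix S p assume S: "S \<in> ?SS" and p: "p \<in> rooted_balls T S"
    obtain v \<tau> where vt: "p = (v, \<tau>)" by (cases p)
    have \<tau>: "v \<in> S" "\<tau> \<subseteq> {e. e \<subseteq> S \<and> card e = 2}" "ball_edges \<tau> v T = \<tau>"
      using p by (auto simp: vt rooted_balls_def)
    have "card \<tau> \<le> card (Pow S)" using \<tau>(2) finS[OF S] by (intro card_mono) auto
    also have "\<dots> \<le> 2 ^ K" using S finS[OF S] by (simp add: card_Pow)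
    finally have "card \<tau> \<le> m" using m by simp
    then have "subset_mean (all_edges n) m (\<lambda>E. of_bool (ball_edges E v T = \<tau>)) = ?q (v, \<tau>)"
      unfolding prod.case by (intro mean_ball_edges_eq) (use \<tau> S in \<open>auto simp: all_edges_def\<close>)
    then show "F (snd p) (fst p) * subset_mean (all_edges n) m (\<lambda>E. of_bool (ball_edges E (fst p) T = snd p)) = ?q p * F (snd p) (fst p)"
      by (simp add: vt)
  qed
  also have "\<dots> = (\<Sum>S\<in>?SS. ?G (card S))"
  proof (rule sum.cong[OF refl])
    fix S assume S: "S \<in> ?SS"
    obtain \<pi> where "bij_betw \<pi> {1..card S} S"
      using ex_bij_betw_nat_finite_1[OF finS[OF S]] by auto
    then have \<pi>: "inj_on \<pi> {1..card S}" "\<pi> ` {1..card S} = S" by (auto simp: bij_betw_def)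
    have "(\<Sum>p\<in>rooted_balls T S. ?q p * F (snd p) (fst p)) =
       (\<Sum>(v, \<tau>)\<in>rooted_balls T {1..card S}. ?q (\<pi> v, (`) \<pi> ` \<tau>) * F ((`) \<pi> ` \<tau>) (\<pi> v))"
      using sum_rooted_balls_relabel[OF \<pi>(1), where t=T and g="\<lambda>p. ?q p * F (snd p) (fst p)"] unfolding \<pi>(2) by simp
    also have "\<dots> = ?G (card S)"
    proof (rule sum.cong[OF refl])
      fix p assume p': "p \<in> rooted_balls T {1..card S}"
      obtain v \<tau> where vt: "p = (v, \<tau>)" by (cases p)
      have p: "(v, \<tau>) \<in> rooted_balls T {1..card S}" using p' vt by simp
      have \<tau>: "v \<in> {1..card S}" "\<tau> \<subseteq> Pow {1..card S}" using p by (auto simp: rooted_balls_def)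
      have "reach \<tau> v T \<subseteq> {1..card S}" by (rule reach_subset) (use \<tau> in auto)
      then have "card (reach ((`) \<pi> ` \<tau>) (\<pi> v) T) = card (reach \<tau> v T)"
        unfolding reach_relabel[OF \<pi>(1) \<tau>(2,1)] by (intro card_image inj_on_subset[OF \<pi>(1)])
      moreover have "card ((`) \<pi> ` \<tau>) = card \<tau>"
        by (intro card_image inj_on_image_sets[OF \<pi>(1) \<tau>(2)])
      moreover have "F ((`) \<pi> ` \<tau>) (\<pi> v) = F \<tau> v"
        using F \<pi>(1) \<tau> unfolding relabel_invariant_def by (metis finite_atLeastAtMost)
      ultimately show "(case p of (v, \<tau>) \<Rightarrow> ?q (\<pi> v, (`) \<pi> ` \<tau>) * F ((`) \<pi> ` \<tau>) (\<pi> v)) =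
          (case p of (v, \<tau>) \<Rightarrow> ?q (v, \<tau>) * F \<tau> v)" unfolding vt by simp
    qed
    finally show "(\<Sum>p\<in>rooted_balls T S. ?q p * F (snd p) (fst p)) = ?G (card S)" .
  qed
  also have "\<dots> = (\<Sum>k\<le>K. \<Sum>S\<in>{S\<in>?SS. card S = k}. ?G (card S))"
    by (rule sum.group[symmetric]) (use finSS in auto)
  also have "\<dots> = (\<Sum>k\<le>K. real (n choose k) * ?G k)"
  proof (intro sum.cong refl)
    fix k assume "k \<in> {..K}"
    then have "{S\<in>?SS. card S = k} = {S. S \<subseteq> {1..n} \<and> card S = k}" by auto
    then have "card {S\<in>?SS. card S = k} = n choose k" using n_subsets[of "{1..n}" k] by simp
    then show "(\<Sum>S\<in>{S\<in>?SS. card S = k}. ?G (card S)) = real (n choose k) * ?G k" by simp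
  qed
  finally show ?thesis by (simp add: sum_distrib_left case_prod_beta mult.assoc)
qed

text \<open>
  Balls with more than K vertices are discarded; by Markov's inequality and the bound on the mean size of
  a neighbourhood this costs O(1 / K).
\<close>

lemma local_average_nearly_convergent:
  fixes F :: "nat set set \<Rightarrow> nat \<Rightarrow> real" and K :: nat
  assumes c: "c > 0" and F: "relabel_invariant F" and C: "\<And>\<tau> v. \<bar>F \<tau> v\<bar> \<le> C" and K: "K > 0"
  shows "\<exists>Y. convergent Y \<and> (\<forall>\<^sub>F n in sequentially.
     \<bar>(\<Sum>v\<in>{1..n}. subset_mean (all_edges n) (nat \<lfloor>c * real n\<rfloor>) (\<lambda>E. F (ball_edges E v T) v)) / n - Y n\<bar> \<le>
       C * (\<Sum>j\<le>Suc T. (4 * c) ^ j) / K)"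
proof -
  let ?m = "\<lambda>n::nat. nat \<lfloor>c * real n\<rfloor>"
  let ?mean = "\<lambda>n::nat. subset_mean (all_edges n) (?m n)"
  let ?A = "\<Sum>j\<le>Suc T. (4 * c) ^ j"
  let ?X = "\<lambda>n::nat. \<Sum>v\<in>{1..n}. ?mean n (\<lambda>E. F (ball_edges E v T) v)"
  let ?Z = "\<lambda>n::nat. \<Sum>v\<in>{1..n}. ?mean n (\<lambda>E. of_bool (card (reach E v (Suc T)) \<le> K) * F (ball_edges E v T) v)"
  let ?Y = "\<lambda>n::nat. \<Sum>k\<le>K. \<Sum>(v, \<tau>)\<in>rooted_balls T {1..k}.
       real (n choose k) / n * (real (((n - card (reach \<tau> v T)) choose 2) choose (?m n - card \<tau>)) / real ((n choose 2) choose ?m n)) * F \<tau> v"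
  have C0: "C \<ge> 0" using C[of "{}" 0] by simp
  have "convergent ?Y"
  proof (intro convergent_sum)
    fix k :: nat and p :: "nat \<times> nat set set" assume p: "p \<in> rooted_balls T {1..k}"
    obtain v \<tau> where vt: "p = (v, \<tau>)" by (cases p)
    have "k \<le> Suc (card \<tau>)" using rooted_balls_card[of v \<tau> T "{1..k}"] p vt by simp
    then show "convergent (\<lambda>n. case p of (v, \<tau>) \<Rightarrow> real (n choose k) / n * (real (((n - card (reach \<tau> v T)) choose 2) choose (?m n - card \<tau>)) / real ((n choose 2) choose ?m n)) * F \<tau> v)"
      unfolding vt prod.case by (intro convergent_mult convergent_const neighbourhood_count_convergent[OF c])
  qed
  moreover have "\<forall>\<^sub>F n in sequentially. \<bar>?X n / n - ?Y n\<bar> \<le> C * ?A / K"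
  proof -
    \<comment> \<open>A ball on at most K vertices has at most 2 to the K edges, which must not exceed the number of edges of the graph.\<close>
    have "\<forall>\<^sub>F n::nat in sequentially. 2 ^ K + 1 \<le> c * n" using c by real_asymp
    with eventually_sparse[OF c] show ?thesis
    proof eventually_elim
      case (elim n)
      have n: "real n > 0" using elim by (auto simp: sparse_def)
      have "2 ^ K \<le> real (?m n)" using elim by linarith
      then have m: "2 ^ K \<le> ?m n" by (metis of_nat_le_iff of_nat_numeral of_nat_power)
      have "?Z n / n = ?Y n"
        unfolding mean_over_small_balls[OF F m] by (simp add: sum_divide_distrib case_prod_beta mult_ac)
      moreover have "\<bar>?X n - ?Z n\<bar> \<le> n * (C * ?A / K)"
      proof -
        have "\<bar>?X n - ?Z n\<bar> \<le> (\<Sum>v\<in>{1..n}. \<bar>?mean n (\<lambda>E. F (ball_edges E v T) v) -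
             ?mean n (\<lambda>E. of_bool (card (reach E v (Suc T)) \<le> K) * F (ball_edges E v T) v)\<bar>)"
          unfolding sum_subtractf[symmetric] by (rule sum_abs)
        also have "\<dots> \<le> (\<Sum>v\<in>{1..n}. C * ?A / K)"
        proof (rule sum_mono)
          fix v assume v: "v \<in> {1..n}"
          have "\<bar>?mean n (\<lambda>E. F (ball_edges E v T) v) -
             ?mean n (\<lambda>E. of_bool (card (reach E v (Suc T)) \<le> K) * F (ball_edges E v T) v)\<bar> \<le>
             ?mean n (\<lambda>E. \<bar>F (ball_edges E v T) v - of_bool (card (reach E v (Suc T)) \<le> K) * F (ball_edges E v T) v\<bar>)"
            unfolding subset_mean_diff[symmetric] by (rule subset_mean_abs)
          also have "\<dots> \<le> ?mean n (\<lambda>E. C / K * real (card (reach E v (Suc T))))"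
          proof (rule subset_mean_mono)
            fix E
            show "\<bar>F (ball_edges E v T) v - of_bool (card (reach E v (Suc T)) \<le> K) * F (ball_edges E v T) v\<bar> \<le>
               C / K * real (card (reach E v (Suc T)))"
            proof (cases "card (reach E v (Suc T)) \<le> K")
              case False
              then have "C * K \<le> C * real (card (reach E v (Suc T)))" using C0 by (intro mult_left_mono) auto
              then have "C \<le> C / K * real (card (reach E v (Suc T)))" using K by (simp add: field_simps del: reach.simps)
              then show ?thesis using False C[of "ball_edges E v T" v] by (simp del: reach.simps)
            qed (use C0 in \<open>simp del: reach.simps\<close>)
          qed
          also have "\<dots> \<le> C / K * ?A"
            unfolding subset_mean_cmult using mean_card_reach_le[of n "?m n" c v "Suc T"] elim v C0
            by (intro mult_left_mono) auto
          finally show "\<bar>?mean n (\<lambda>E. F (ball_edges E v T) v) -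
             ?mean n (\<lambda>E. of_bool (card (reach E v (Suc T)) \<le> K) * F (ball_edges E v T) v)\<bar> \<le> C * ?A / K" by simp
        qed
        finally show ?thesis by simp
      qed
      then have "\<bar>?X n - ?Z n\<bar> / n \<le> C * ?A / K" using n by (simp add: field_simps)
      moreover have "\<bar>?X n / n - ?Z n / n\<bar> = \<bar>?X n - ?Z n\<bar> / n"
        using n by (simp add: diff_divide_distrib[symmetric])
      ultimately show ?case by simp
    qed
  qed
  ultimately show ?thesis by blast
qed

lemma convergent_if_nearly_convergent:
  fixes X :: "nat \<Rightarrow> real"
  assumes "\<And>\<epsilon>. \<epsilon> > 0 \<Longrightarrow> \<exists>Y. convergent Y \<and> (\<forall>\<^sub>F n in sequentially. \<bar>X n - Y n\<bar> \<le> \<epsilon>)"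
  shows "convergent X"
proof -
  have "Cauchy X"
  proof (rule metric_CauchyI)
    fix e :: real assume "e > 0"
    then obtain Y where Y: "convergent Y" "\<forall>\<^sub>F n in sequentially. \<bar>X n - Y n\<bar> \<le> e / 4"
      using assms[of "e / 4"] by auto
    obtain M1 where M1: "\<And>n. n \<ge> M1 \<Longrightarrow> \<bar>X n - Y n\<bar> \<le> e / 4"
      using Y(2) by (auto simp: eventually_sequentially)
    obtain M2 where M2: "\<And>m n. m \<ge> M2 \<Longrightarrow> n \<ge> M2 \<Longrightarrow> dist (Y m) (Y n) < e / 4"
      using metric_CauchyD[OF convergent_Cauchy[OF Y(1)], of "e / 4"] \<open>e > 0\<close> by auto
    have "dist (X m) (X n) < e" if "m \<ge> max M1 M2" "n \<ge> max M1 M2" for m n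
      using M1[of m] M1[of n] M2[of m n] that \<open>e > 0\<close> unfolding dist_real_def by (simp add: abs_if split: if_splits)
    then show "\<exists>M. \<forall>m\<ge>M. \<forall>n\<ge>M. dist (X m) (X n) < e" by blast
  qed
  then show ?thesis by (rule Cauchy_convergent)
qed

text \<open>
  This is a form of local weak convergence of the sparse random graph, proved without naming the limiting
  Poisson tree: every shape of ball has a limiting frequency, and no mass escapes to large balls.
\<close>

theorem local_average_convergent:
  fixes F :: "nat set set \<Rightarrow> nat \<Rightarrow> real"
  assumes c: "c > 0" and F: "relabel_invariant F" and C: "\<And>\<tau> v. \<bar>F \<tau> v\<bar> \<le> C"
  shows "convergent (\<lambda>n. (\<Sum>v\<in>{1..n}. subset_mean (all_edges n) (nat \<lfloor>c * real n\<rfloor>) (\<lambda>E. F (ball_edges E v T) v)) / n)"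
    (is "convergent ?X")
proof (rule convergent_if_nearly_convergent)
  fix \<epsilon> :: real assume \<epsilon>: "\<epsilon> > 0"
  let ?A = "\<Sum>j\<le>Suc T. (4 * c) ^ j"
  obtain K :: nat where K: "C * ?A / \<epsilon> < K" using reals_Archimedean2 by blast
  have "C * ?A \<ge> 0" using C[of "{}" 0] c by (intro mult_nonneg_nonneg sum_nonneg) auto
  then have "0 \<le> C * ?A / \<epsilon>" using \<epsilon> by simp
  with K have K0: "K > 0" by linarith
  have bound: "C * ?A / K \<le> \<epsilon>" using K K0 \<epsilon> by (simp add: field_simps)
  obtain Y where "convergent Y" "\<forall>\<^sub>F n in sequentially. \<bar>?X n - Y n\<bar> \<le> C * ?A / K"
    using local_average_nearly_convergent[OF c F C K0, of T] by blast
  then show "\<exists>Y. convergent Y \<and> (\<forall>\<^sub>F n in sequentially. \<bar>?X n - Y n\<bar> \<le> \<epsilon>)"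
    using bound by (intro exI[of _ Y] conjI) (auto elim!: eventually_mono)
qed

section \<open>Variance bounds\<close>

text \<open>
  Drawing the subset one element at a time: every (m + 1)-subset arises from m + 1 choices of its first
  element.
\<close>

lemma subset_mean_insert:
  assumes A: "finite A" "m < card A"
  shows "subset_mean A (Suc m) g = (\<Sum>e\<in>A. subset_mean (A - {e}) m (\<lambda>Y. g (insert e Y))) / card A"
proof -
  let ?S = "{X. X \<subseteq> A \<and> card X = Suc m}"
  let ?N = "real (card A)" and ?C = "real ((card A - 1) choose m)"
  have finX: "finite X" if "X \<subseteq> A" for X using that A(1) finite_subset by auto
  have reindex: "(\<Sum>Y | Y \<subseteq> A - {e} \<and> card Y = m. g (insert e Y)) = (\<Sum>X | X \<in> ?S \<and> e \<in> X. g X)"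
    if e: "e \<in> A" for e
  proof (rule sum.reindex_bij_witness[where j="insert e" and i="\<lambda>X. X - {e}"])
    fix Y assume "Y \<in> {Y. Y \<subseteq> A - {e} \<and> card Y = m}"
    then have Y: "Y \<subseteq> A - {e}" "card Y = m" "e \<notin> Y" by auto
    moreover have "finite Y" using Y by (intro finX) auto
    ultimately show "insert e Y \<in> {X. X \<in> ?S \<and> e \<in> X}" "insert e Y - {e} = Y" using e by auto
  next
    fix X assume "X \<in> {X. X \<in> ?S \<and> e \<in> X}"
    then show "X - {e} \<in> {Y. Y \<subseteq> A - {e} \<and> card Y = m}" "insert e (X - {e}) = X"
      using finX[of X] by auto
  qed auto
  have "(\<Sum>e\<in>A. \<Sum>Y | Y \<subseteq> A - {e} \<and> card Y = m. g (insert e Y)) = (\<Sum>e\<in>A. \<Sum>X | X \<in> ?S \<and> e \<in> X. g X)"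
    by (intro sum.cong refl reindex)
  also have "\<dots> = (\<Sum>X\<in>?S. \<Sum>e | e \<in> A \<and> e \<in> X. g X)"
    by (rule sum.swap_restrict[OF A(1) finite_subsets_of_card[OF A(1)]])
  also have "\<dots> = (\<Sum>X\<in>?S. real (Suc m) * g X)"
  proof (intro sum.cong refl)
    fix X assume X: "X \<in> ?S"
    then have "{e. e \<in> A \<and> e \<in> X} = X" by auto
    then show "(\<Sum>e | e \<in> A \<and> e \<in> X. g X) = real (Suc m) * g X" using X by simp
  qed
  finally have sums: "(\<Sum>e\<in>A. \<Sum>Y | Y \<subseteq> A - {e} \<and> card Y = m. g (insert e Y)) = real (Suc m) * (\<Sum>X\<in>?S. g X)"
    by (simp add: sum_distrib_left)
  have "(\<Sum>e\<in>A. subset_mean (A - {e}) m (\<lambda>Y. g (insert e Y))) =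
      (\<Sum>e\<in>A. (\<Sum>Y | Y \<subseteq> A - {e} \<and> card Y = m. g (insert e Y)) / ?C)"
    using A(1) by (intro sum.cong refl) (simp add: subset_mean_def)
  also have "\<dots> = real (Suc m) * (\<Sum>X\<in>?S. g X) / ?C"
    by (simp only: sum_divide_distrib[symmetric] sums)
  finally have R: "(\<Sum>e\<in>A. subset_mean (A - {e}) m (\<lambda>Y. g (insert e Y))) = real (Suc m) * (\<Sum>X\<in>?S. g X) / ?C" .
  have "real (Suc m) * real (card A choose Suc m) = ?N * ?C"
    using binomial_absorption[of m "card A"] by (metis of_nat_mult)
  then have "real (Suc m) * (\<Sum>X\<in>?S. g X) / ?C / ?N =
      real (Suc m) * (\<Sum>X\<in>?S. g X) / (real (Suc m) * real (card A choose Suc m))"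
    by (simp only: divide_divide_eq_left mult.commute)
  also have "\<dots> = subset_mean A (Suc m) g" unfolding subset_mean_def by (rule mult_divide_mult_cancel_left) simp
  finally show ?thesis unfolding R by simp
qed

lemma subset_mean_bias_variance:
  assumes "finite A" "m \<le> card A"
  shows "subset_mean A m (\<lambda>X. (f X - a)\<^sup>2) =
           subset_mean A m (\<lambda>X. (f X - subset_mean A m f)\<^sup>2) + (subset_mean A m f - a)\<^sup>2"
proof -
  define \<mu> where "\<mu> = subset_mean A m f"
  have "(\<lambda>X. (f X - a)\<^sup>2) = (\<lambda>X. (f X - \<mu>)\<^sup>2 + (2 * (\<mu> - a) * (f X - \<mu>) + (\<mu> - a)\<^sup>2))"
    by (auto simp: power2_eq_square algebra_simps)
  then have "subset_mean A m (\<lambda>X. (f X - a)\<^sup>2) = subset_mean A m (\<lambda>X. (f X - \<mu>)\<^sup>2) +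
      (2 * (\<mu> - a) * (subset_mean A m f - \<mu>) + (\<mu> - a)\<^sup>2)"
    by (simp only: subset_mean_add subset_mean_cmult subset_mean_diff subset_mean_const[OF assms])
  then show ?thesis by (simp add: \<mu>_def)
qed

text \<open>
  Efron--Stein for sampling without replacement.  Reveal one element e first.  Given e, the induction
  hypothesis applies to the rest.  The conditional means for two first elements differ by at most c, because exchanging
  the two elements maps the possible completions onto each other and changes the subset by at
  most one swap.
\<close>

lemma subset_mean_variance_le:
  assumes "finite A" "m \<le> card A"
    and "\<And>X Y. X \<subseteq> A \<Longrightarrow> Y \<subseteq> A \<Longrightarrow> card X = m \<Longrightarrow> card Y = m \<Longrightarrow> card (X - Y) \<le> 1 \<Longrightarrow> \<bar>f X - f Y\<bar> \<le> c"
  shows "subset_mean A m (\<lambda>X. (f X - subset_mean A m f)\<^sup>2) \<le> m * c\<^sup>2"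
  using assms
proof (induction m arbitrary: A f)
  case 0
  have "subset_mean A 0 (\<lambda>X. (f X - subset_mean A 0 f)\<^sup>2) = subset_mean A 0 (\<lambda>X. (f {} - f {})\<^sup>2)"
  proof (rule subset_mean_cong)
    fix X assume "X \<subseteq> A" "card X = 0"
    then have "X = {}" using 0(1) finite_subset by fastforce
    moreover have "subset_mean A 0 f = subset_mean A 0 (\<lambda>_. f {})"
      using 0(1) by (intro subset_mean_cong) (metis card_0_eq finite_subset)
    ultimately show "(f X - subset_mean A 0 f)\<^sup>2 = (f {} - f {})\<^sup>2"
      using 0 by (simp add: subset_mean_const)
  qed
  then show ?case by (simp add: subset_mean_def)
next
  case (Suc m)
  have m: "m < card A" using Suc.prems by simp
  let ?h = "\<lambda>e. subset_mean (A - {e}) m (\<lambda>Y. f (insert e Y))"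
  define \<mu> where "\<mu> = subset_mean A (Suc m) f"
  have finX: "finite X" if "X \<subseteq> A" for X using that Suc.prems(1) finite_subset by auto
  have Ae: "finite (A - {e})" "m \<le> card (A - {e})" if "e \<in> A" for e using Suc.prems that by auto
  have cA: "real (card A) > 0" using m by simp
  have inner: "subset_mean (A - {e}) m (\<lambda>Y. (f (insert e Y) - ?h e)\<^sup>2) \<le> m * c\<^sup>2" if e: "e \<in> A" for e
  proof (rule Suc.IH[OF Ae[OF e]])
    fix X Y assume *: "X \<subseteq> A - {e}" "Y \<subseteq> A - {e}" "card X = m" "card Y = m" "card (X - Y) \<le> 1"
    have "X \<subseteq> A" "Y \<subseteq> A" "e \<notin> X" "e \<notin> Y" using * by blast+
    then have "card (insert e X) = Suc m" "card (insert e Y) = Suc m"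
      using * finX[of X] finX[of Y] by simp_all
    moreover have "insert e X - insert e Y = X - Y" using * by auto
    ultimately show "\<bar>f (insert e X) - f (insert e Y)\<bar> \<le> c" using * e by (intro Suc.prems(3)) auto
  qed
  have swap: "\<bar>?h e - ?h e'\<bar> \<le> c" if e: "e \<in> A" "e' \<in> A" for e e'
  proof -
    \<comment> \<open>Exchange the roles of a and b: completions of a become completions of b.\<close>
    define \<phi> where "\<phi> = (\<lambda>a b (Y::'a set). if b \<in> Y then insert a (Y - {b}) else Y)"
    have \<phi>: "\<phi> a b Y \<subseteq> A - {b} \<and> card (\<phi> a b Y) = m \<and> \<phi> b a (\<phi> a b Y) = Y"
      if "Y \<subseteq> A - {a}" "card Y = m" "a \<in> A" "b \<in> A" for a b Y
    proof (cases "b \<in> Y")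
      case True
      then have "a \<noteq> b" using that by auto
      have "finite Y" using that by (intro finX) auto
      then have "Suc (card Y - Suc 0) = card Y" using True card_gt_0_iff[of Y] by auto
      then show ?thesis using that True \<open>a \<noteq> b\<close> \<open>finite Y\<close> by (auto simp: \<phi>_def card_insert_if)
    qed (use that in \<open>auto simp: \<phi>_def\<close>)
    have "(\<Sum>Y | Y \<subseteq> A - {e'} \<and> card Y = m. f (insert e' Y)) =
          (\<Sum>Y | Y \<subseteq> A - {e} \<and> card Y = m. f (insert e' (\<phi> e e' Y)))"
      by (rule sum.reindex_bij_witness[where j="\<phi> e' e" and i="\<phi> e e'"]) (use \<phi> e in auto)
    moreover have "card (A - {e}) = card (A - {e'})" using e Suc.prems(1) by simp
    ultimately have "?h e' = subset_mean (A - {e}) m (\<lambda>Y. f (insert e' (\<phi> e e' Y)))"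
      by (simp add: subset_mean_def)
    then have "\<bar>?h e - ?h e'\<bar> \<le> subset_mean (A - {e}) m (\<lambda>Y. \<bar>f (insert e Y) - f (insert e' (\<phi> e e' Y))\<bar>)"
      by (simp only: subset_mean_diff[symmetric] subset_mean_abs)
    also have "\<dots> \<le> subset_mean (A - {e}) m (\<lambda>_. c)"
    proof (rule subset_mean_mono)
      fix Y assume Y: "Y \<subseteq> A - {e}" "card Y = m"
      have fin: "finite Y" using Y by (intro finX) auto
      have "e \<notin> Y" using Y by auto
      have Y': "\<phi> e e' Y \<subseteq> A - {e'}" "card (\<phi> e e' Y) = m" using \<phi>[OF Y e] by auto
      have fin': "finite (\<phi> e e' Y)" using Y' by (intro finX) auto
      have "e' \<notin> \<phi> e e' Y" using Y'(1) by auto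
      have "insert e Y - insert e' (\<phi> e e' Y) \<subseteq> {e}" by (auto simp: \<phi>_def)
      then have "card (insert e Y - insert e' (\<phi> e e' Y)) \<le> 1"
        using card_mono[of "{e}"] by fastforce
      then show "\<bar>f (insert e Y) - f (insert e' (\<phi> e e' Y))\<bar> \<le> c"
        using Y Y' e fin fin' \<open>e \<notin> Y\<close> \<open>e' \<notin> \<phi> e e' Y\<close> by (intro Suc.prems(3)) auto
    qed
    also have "\<dots> = c" by (rule subset_mean_const[OF Ae[OF e(1)]])
    finally show ?thesis .
  qed
  have \<mu>: "\<mu> = (\<Sum>e\<in>A. ?h e) / card A" unfolding \<mu>_def by (rule subset_mean_insert[OF Suc.prems(1) m])
  have h\<mu>: "(?h e - \<mu>)\<^sup>2 \<le> c\<^sup>2" if e: "e \<in> A" for e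
  proof -
    have "\<bar>card A * (?h e - \<mu>)\<bar> = \<bar>\<Sum>e'\<in>A. ?h e - ?h e'\<bar>"
      using cA by (simp add: \<mu> sum_subtractf right_diff_distrib)
    also have "\<dots> \<le> (\<Sum>e'\<in>A. c)" using swap[OF e] by (intro sum_abs[THEN order_trans] sum_mono)
    finally have "\<bar>?h e - \<mu>\<bar> \<le> c" using cA by (simp add: abs_mult)
    then show ?thesis using swap[OF e e] by (simp add: abs_le_square_iff[symmetric])
  qed
  have "subset_mean A (Suc m) (\<lambda>X. (f X - \<mu>)\<^sup>2) =
        (\<Sum>e\<in>A. subset_mean (A - {e}) m (\<lambda>Y. (f (insert e Y) - \<mu>)\<^sup>2)) / card A"
    by (rule subset_mean_insert[OF Suc.prems(1) m])
  also have "\<dots> \<le> (\<Sum>e\<in>A. m * c\<^sup>2 + c\<^sup>2) / card A"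
  proof (intro divide_right_mono sum_mono)
    fix e assume e: "e \<in> A"
    show "subset_mean (A - {e}) m (\<lambda>Y. (f (insert e Y) - \<mu>)\<^sup>2) \<le> m * c\<^sup>2 + c\<^sup>2"
      unfolding subset_mean_bias_variance[OF Ae[OF e], of "\<lambda>Y. f (insert e Y)" \<mu>]
      using inner[OF e] h\<mu>[OF e] by (rule add_mono)
  qed simp
  also have "\<dots> = real (Suc m) * c\<^sup>2" using cA by (simp add: field_simps)
  finally show ?case by (simp add: \<mu>_def)
qed

lemma (in prob_space) integrable_bounded:
  fixes f :: "'a \<Rightarrow> real"
  assumes "f \<in> borel_measurable M" "\<And>x. x \<in> space M \<Longrightarrow> \<bar>f x\<bar> \<le> C"
  shows "integrable M f"
  by (rule integrable_const_bound[where B=C]) (use assms in auto)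

text \<open>
  Also for functions that are not integrable, whose integral is 0 by convention.
\<close>

lemma (in prob_space) expectation_abs_le:
  fixes f :: "'a \<Rightarrow> real"
  assumes "\<And>x. x \<in> space M \<Longrightarrow> \<bar>f x\<bar> \<le> C"
  shows "\<bar>expectation f\<bar> \<le> C"
proof (cases "integrable M f")
  case True
  have "\<bar>expectation f\<bar> \<le> expectation (\<lambda>x. \<bar>f x\<bar>)" by (rule integral_abs_bound)
  also have "\<dots> \<le> expectation (\<lambda>_. C)"
    using True assms by (intro integral_mono integrable_abs) auto
  finally show ?thesis by (simp add: prob_space)
next
  case False
  obtain x where "x \<in> space M" using not_empty by auto
  then show ?thesis using False assms[of x] by (simp add: not_integrable_integral_eq)
qed

lemma (in prob_space) bias_variance:
  fixes f :: "'a \<Rightarrow> real"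
  assumes f: "f \<in> borel_measurable M" "\<And>x. x \<in> space M \<Longrightarrow> \<bar>f x\<bar> \<le> C"
  shows "expectation (\<lambda>x. (f x - a)\<^sup>2) = expectation (\<lambda>x. (f x - expectation f)\<^sup>2) + (expectation f - a)\<^sup>2"
proof -
  define \<mu> where "\<mu> = expectation f"
  note [measurable] = f(1)
  have int: "integrable M f" by (rule integrable_bounded[OF f])
  have "\<bar>(f x - \<mu>)\<^sup>2\<bar> \<le> (C + \<bar>\<mu>\<bar>)\<^sup>2" if "x \<in> space M" for x
    using f(2)[OF that] by (simp add: abs_le_square_iff[symmetric])
  then have int2: "integrable M (\<lambda>x. (f x - \<mu>)\<^sup>2)" by (intro integrable_bounded) auto
  have "expectation (\<lambda>x. (f x - a)\<^sup>2) = expectation (\<lambda>x. (f x - \<mu>)\<^sup>2 + (2 * (\<mu> - a) * (f x - \<mu>) + (\<mu> - a)\<^sup>2))"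
    by (intro Bochner_Integration.integral_cong refl) (simp add: power2_eq_square algebra_simps)
  also have "\<dots> = expectation (\<lambda>x. (f x - \<mu>)\<^sup>2) + (2 * (\<mu> - a) * (expectation f - \<mu>) + (\<mu> - a)\<^sup>2)"
    using int int2 by (simp add: prob_space)
  finally show ?thesis by (simp add: \<mu>_def)
qed

text \<open>
  Efron--Stein for independent coordinates: split off one coordinate, whose conditional variance is at most
  the square of its influence; averaging over it preserves the influences of the others.
\<close>

lemma product_variance_le:
  fixes f :: "('i \<Rightarrow> 'a) \<Rightarrow> real" and d :: "'i \<Rightarrow> real"
  assumes D: "prob_space D" and I: "finite I"
    and f: "f \<in> borel_measurable (\<Pi>\<^sub>M i\<in>I. D)" "\<And>w. w \<in> space (\<Pi>\<^sub>M i\<in>I. D) \<Longrightarrow> \<bar>f w\<bar> \<le> C"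
    and d: "\<And>w i z. w \<in> space (\<Pi>\<^sub>M i\<in>I. D) \<Longrightarrow> i \<in> I \<Longrightarrow> z \<in> space D \<Longrightarrow> \<bar>f (w(i := z)) - f w\<bar> \<le> d i"
  shows "(\<integral>w. (f w - (\<integral>w. f w \<partial>(\<Pi>\<^sub>M i\<in>I. D)))\<^sup>2 \<partial>(\<Pi>\<^sub>M i\<in>I. D)) \<le> (\<Sum>i\<in>I. (d i)\<^sup>2)"
  using I f d
proof (induction I arbitrary: f rule: finite_induct)
  case empty
  interpret P: prob_space "\<Pi>\<^sub>M i\<in>({}::'i set). D" by (intro prob_space_PiM D)
  let ?P = "\<Pi>\<^sub>M i\<in>({}::'i set). D"
  have const: "(\<integral>w. a \<partial>?P) = a" for a :: real
    by (subst lebesgue_integral_const, subst P.prob_space) simp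
  have "(\<integral>w. f w \<partial>?P) = (\<integral>w. f (\<lambda>_. undefined) \<partial>?P)"
    by (intro Bochner_Integration.integral_cong refl) (auto simp: space_PiM)
  then have mean: "(\<integral>w. f w \<partial>?P) = f (\<lambda>_. undefined)" by (simp only: const)
  have "(\<integral>w. (f w - (\<integral>w. f w \<partial>?P))\<^sup>2 \<partial>?P) = (\<integral>w. 0 \<partial>?P)"
    unfolding mean by (intro Bochner_Integration.integral_cong refl) (auto simp: space_PiM)
  then show ?case by simp
next
  case (insert i I)
  interpret D: prob_space D by (rule D)
  interpret PP: product_sigma_finite "\<lambda>_::'i. D" by standard
  let ?P = "\<Pi>\<^sub>M i\<in>I. D" and ?P' = "\<Pi>\<^sub>M j\<in>insert i I. D"
  interpret P: prob_space ?P by (intro prob_space_PiM D)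
  interpret P': prob_space ?P' by (intro prob_space_PiM D)
  note [measurable] = insert.prems(1)
  have upd: "x(i := y) \<in> space ?P'" if "x \<in> space ?P" "y \<in> space D" for x y
    using that by (auto simp: space_PiM PiE_def Pi_def extensional_def)
  have "(\<lambda>p. f ((\<lambda>(x, y). x(i := y)) p)) \<in> borel_measurable (?P \<Otimes>\<^sub>M D)"
    by (rule measurable_compose[OF measurable_add_dim insert.prems(1)])
  then have meas [measurable]: "(\<lambda>(x, y). f (x(i := y))) \<in> borel_measurable (?P \<Otimes>\<^sub>M D)"
    by (simp add: case_prod_beta')
  have [measurable]: "(\<lambda>y. f (x(i := y))) \<in> borel_measurable D" if "x \<in> space ?P" for x
    using measurable_compose[OF measurable_Pair1'[OF that] meas] by simp
  define g where "g = (\<lambda>x. \<integral>y. f (x(i := y)) \<partial>D)"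
  have g_meas [measurable]: "g \<in> borel_measurable ?P" unfolding g_def by measurable
  have fC: "\<bar>f (x(i := y))\<bar> \<le> C" if "x \<in> space ?P" "y \<in> space D" for x y
    using insert.prems(2) upd[OF that] by blast
  have intD: "integrable D (\<lambda>y. f (x(i := y)))" if "x \<in> space ?P" for x
    using that fC by (intro D.integrable_bounded[where C=C]) auto
  have gC: "\<bar>g x\<bar> \<le> C" if "x \<in> space ?P" for x
    unfolding g_def by (rule D.expectation_abs_le) (rule fC[OF that])
  have gd: "\<bar>g (x(j := z)) - g x\<bar> \<le> d j" if x: "x \<in> space ?P" "j \<in> I" "z \<in> space D" for x j z
  proof -
    have xz: "x(j := z) \<in> space ?P" using x by (auto simp: space_PiM PiE_def Pi_def extensional_def)
    have "g (x(j := z)) - g x = (\<integral>y. f (x(j := z, i := y)) - f (x(i := y)) \<partial>D)"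
      unfolding g_def using intD[OF xz] intD[OF x(1)] by simp
    also have "\<bar>\<dots>\<bar> \<le> d j"
    proof (rule D.expectation_abs_le)
      fix y assume y: "y \<in> space D"
      have "x(j := z, i := y) = (x(i := y))(j := z)" using insert.hyps x(2) by (auto simp: fun_upd_twist)
      then show "\<bar>f (x(j := z, i := y)) - f (x(i := y))\<bar> \<le> d j"
        using insert.prems(3)[OF upd[OF x(1) y] _ x(3), of j] x(2) by (simp only: insert_iff simp_thms)
    qed
    finally show ?thesis .
  qed
  have fg: "(\<integral>y. (f (x(i := y)) - g x)\<^sup>2 \<partial>D) \<le> (d i)\<^sup>2" if x: "x \<in> space ?P" for x
  proof -
    have "\<bar>f (x(i := y)) - g x\<bar> \<le> d i" if y: "y \<in> space D" for y
    proof -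
      have "f (x(i := y)) - g x = (\<integral>y'. f (x(i := y)) - f (x(i := y')) \<partial>D)"
        unfolding g_def using intD[OF x] by (simp add: D.prob_space)
      also have "\<bar>\<dots>\<bar> \<le> d i"
      proof (rule D.expectation_abs_le)
        fix y' assume y': "y' \<in> space D"
        show "\<bar>f (x(i := y)) - f (x(i := y'))\<bar> \<le> d i"
          using insert.prems(3)[OF upd[OF x y'] insertI1 y] unfolding fun_upd_upd .
      qed
      finally show ?thesis .
    qed
    then have "\<bar>(f (x(i := y)) - g x)\<^sup>2\<bar> \<le> (d i)\<^sup>2" if "y \<in> space D" for y
      using that by (simp add: abs_le_square_iff[symmetric]) (meson abs_ge_self order_trans)
    then show ?thesis
      using D.expectation_abs_le[of "\<lambda>y. (f (x(i := y)) - g x)\<^sup>2" "(d i)\<^sup>2"] by (auto dest: abs_le_D1)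
  qed
  define \<mu> where "\<mu> = (\<integral>w. f w \<partial>?P')"
  have intf: "integrable ?P' f" by (rule P'.integrable_bounded) (use insert.prems in auto)
  have \<mu>: "\<mu> = (\<integral>x. g x \<partial>?P)"
    unfolding \<mu>_def g_def by (rule PP.product_integral_insert[OF insert.hyps intf])
  have sq: "\<bar>(a - \<mu>)\<^sup>2\<bar> \<le> (C + \<bar>\<mu>\<bar>)\<^sup>2" if "\<bar>a\<bar> \<le> C" for a
    using that by (simp add: abs_le_square_iff[symmetric])
  have int2: "integrable ?P' (\<lambda>w. (f w - \<mu>)\<^sup>2)"
    by (rule P'.integrable_bounded[where C="(C + \<bar>\<mu>\<bar>)\<^sup>2"]) (use sq insert.prems in auto)
  have intg2: "integrable ?P (\<lambda>x. (g x - \<mu>)\<^sup>2)"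
    by (rule P.integrable_bounded[where C="(C + \<bar>\<mu>\<bar>)\<^sup>2"]) (use sq gC in auto)
  have "(\<integral>w. (f w - \<mu>)\<^sup>2 \<partial>?P') = (\<integral>x. (\<integral>y. (f (x(i := y)) - \<mu>)\<^sup>2 \<partial>D) \<partial>?P)"
    by (rule PP.product_integral_insert[OF insert.hyps int2])
  also have "\<dots> \<le> (\<integral>x. (d i)\<^sup>2 + (g x - \<mu>)\<^sup>2 \<partial>?P)"
  proof (rule integral_mono)
    have "(\<lambda>x. \<integral>y. (f (x(i := y)) - \<mu>)\<^sup>2 \<partial>D) \<in> borel_measurable ?P" by measurable
    then show "integrable ?P (\<lambda>x. \<integral>y. (f (x(i := y)) - \<mu>)\<^sup>2 \<partial>D)"
      by (rule P.integrable_bounded[where C="(C + \<bar>\<mu>\<bar>)\<^sup>2"]) (intro D.expectation_abs_le sq fC)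
    show "integrable ?P (\<lambda>x. (d i)\<^sup>2 + (g x - \<mu>)\<^sup>2)" using intg2 by simp
    fix x assume x: "x \<in> space ?P"
    have "(\<integral>y. (f (x(i := y)) - \<mu>)\<^sup>2 \<partial>D) = (\<integral>y. (f (x(i := y)) - g x)\<^sup>2 \<partial>D) + (g x - \<mu>)\<^sup>2"
      unfolding g_def by (rule D.bias_variance[where C=C]) (use x fC in auto)
    then show "(\<integral>y. (f (x(i := y)) - \<mu>)\<^sup>2 \<partial>D) \<le> (d i)\<^sup>2 + (g x - \<mu>)\<^sup>2" using fg[OF x] by simp
  qed
  also have "\<dots> = (d i)\<^sup>2 + (\<integral>x. (g x - \<mu>)\<^sup>2 \<partial>?P)" using intg2 by (simp add: P.prob_space)
  also have "(\<integral>x. (g x - \<mu>)\<^sup>2 \<partial>?P) \<le> (\<Sum>i\<in>I. (d i)\<^sup>2)"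
    unfolding \<mu> by (rule insert.IH[OF g_meas gC gd])
  finally show ?case using insert.hyps by (simp add: \<mu>_def)
qed

section \<open>Averaging over the weights\<close>

text \<open>
  Weights lie in [0, B] only almost surely.  Clipping them makes all bounds hold everywhere, and it changes
  nothing almost surely.
\<close>

definition clip :: "real \<Rightarrow> real \<Rightarrow> real" where
  "clip B x = max 0 (min B x)"

lemma clip_bounds: "B \<ge> 0 \<Longrightarrow> 0 \<le> clip B x \<and> clip B x \<le> B"
  by (auto simp: clip_def)

lemma clip_id: "x \<in> {0..B} \<Longrightarrow> clip B x = x"
  by (auto simp: clip_def)

lemma price_measurable:
  assumes "\<And>e. e \<in> E \<Longrightarrow> (\<lambda>x. w x e) \<in> borel_measurable M"
  shows "(\<lambda>x. price b \<eta> E (w x) t v) \<in> borel_measurable M"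
proof (induction t arbitrary: v)
  case (Suc t)
  note [measurable] = Suc
  have "(\<lambda>x. of_bool (w x e > (\<Sum>u\<in>e. price b \<eta> E (w x) t u)) :: real) \<in> borel_measurable M" if "e \<in> E" for e
  proof -
    note [measurable] = assms[OF that]
    show ?thesis unfolding of_bool_def by measurable
  qed
  then have "(\<lambda>x. \<Sum>e\<in>{e\<in>E. v \<in> e}. of_bool (w x e > (\<Sum>u\<in>e. price b \<eta> E (w x) t u)) :: real) \<in> borel_measurable M"
    by (intro borel_measurable_sum) auto
  then show ?case unfolding price.simps(2) by measurable
qed simp

lemma local_value_measurable:
  assumes w: "\<And>e. e \<in> E \<Longrightarrow> (\<lambda>x. w x e) \<in> borel_measurable M"
  shows "(\<lambda>x. local_value b B \<eta> T E (w x) v) \<in> borel_measurable M"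
proof -
  note price_measurable[OF w, measurable]
  have "(\<lambda>x. w x e * mean_demand b \<eta> T E (w x) e) \<in> borel_measurable M" if "e \<in> E" for e
  proof -
    note [measurable] = w[OF that]
    show ?thesis unfolding mean_demand_def demand_def of_bool_def by measurable
  qed
  then have "(\<lambda>x. \<Sum>e\<in>{e\<in>E. v \<in> e}. w x e * mean_demand b \<eta> T E (w x) e) \<in> borel_measurable M"
    by (intro borel_measurable_sum) auto
  then show ?thesis unfolding local_value_def by measurable
qed

lemma clipped_weight_measurable:
  assumes "real_distribution D" "e \<in> A"
  shows "(\<lambda>w. clip B (w e)) \<in> borel_measurable (\<Pi>\<^sub>M e\<in>A. D)"
proof -
  interpret real_distribution D by (rule assms)
  have [measurable]: "(\<lambda>w. w e) \<in> borel_measurable (\<Pi>\<^sub>M e\<in>A. D)"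
    using measurable_component_singleton[OF assms(2), of "\<lambda>_. D"] by (simp cong: measurable_cong_sets)
  show ?thesis unfolding clip_def by measurable
qed

text \<open>
  An injective selection of coordinates of an i.i.d. family is again i.i.d.; this covers both restriction to a
  smaller index set and relabelling.
\<close>

lemma integral_PiM_reindex:
  fixes g :: "('i \<Rightarrow> 'a) \<Rightarrow> real"
  assumes D: "prob_space D" and f: "inj_on f I" "f ` I \<subseteq> K" and g: "g \<in> borel_measurable (\<Pi>\<^sub>M i\<in>I. D)"
  shows "(\<integral>w. g (\<lambda>i\<in>I. w (f i)) \<partial>(\<Pi>\<^sub>M i\<in>K. D)) = (\<integral>w. g w \<partial>(\<Pi>\<^sub>M i\<in>I. D))"
proof -
  have "(\<lambda>w. \<lambda>i\<in>I. w (f i)) \<in> (\<Pi>\<^sub>M i\<in>K. D) \<rightarrow>\<^sub>M (\<Pi>\<^sub>M i\<in>I. D)"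
    by (intro measurable_restrict measurable_component_singleton) (use f in auto)
  then have "(\<integral>w. g (\<lambda>i\<in>I. w (f i)) \<partial>(\<Pi>\<^sub>M i\<in>K. D)) =
     (\<integral>w. g w \<partial>distr (\<Pi>\<^sub>M i\<in>K. D) (\<Pi>\<^sub>M i\<in>I. D) (\<lambda>w. \<lambda>i\<in>I. w (f i)))"
    by (rule integral_distr[symmetric, OF _ g])
  also have "distr (\<Pi>\<^sub>M i\<in>K. D) (\<Pi>\<^sub>M i\<in>I. D) (\<lambda>w. \<lambda>i\<in>I. w (f i)) = (\<Pi>\<^sub>M i\<in>I. D)"
    using distr_PiM_reindex[of K "\<lambda>_. D" f I] D f by auto
  finally show ?thesis .
qed

text \<open>
  Only the weights of the edges in \<open>\<tau>\<close> are integrated, which makes the functional meaningful without reference to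
  the number n of vertices.
\<close>

definition mean_local_value :: "real measure \<Rightarrow> nat \<Rightarrow> real \<Rightarrow> real \<Rightarrow> nat \<Rightarrow> 'a set set \<Rightarrow> 'a \<Rightarrow> real" where
  "mean_local_value D b B \<eta> T \<tau> v =
     (\<integral>w. local_value b B \<eta> T \<tau> (\<lambda>e. clip B (w e)) v \<partial>(\<Pi>\<^sub>M e\<in>\<tau>. D))"

lemma clipped_local_value_bounds:
  assumes "B \<ge> 0"
  shows "\<bar>local_value b B \<eta> T \<tau> (\<lambda>e. clip B (w e)) v\<bar> \<le> b * B"
  using local_value_bounds[of \<tau> "\<lambda>e. clip B (w e)" B b \<eta> T v] clip_bounds[OF assms] assms by auto

lemma mean_local_value_bound:
  assumes "prob_space D" "B \<ge> 0"
  shows "\<bar>mean_local_value D b B \<eta> T \<tau> v\<bar> \<le> b * B"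
proof -
  interpret prob_space "\<Pi>\<^sub>M e\<in>\<tau>. D" by (intro prob_space_PiM assms)
  show ?thesis unfolding mean_local_value_def
    by (intro expectation_abs_le clipped_local_value_bounds assms)
qed

lemma local_value_cong:
  assumes "\<And>e. e \<in> E \<Longrightarrow> w' e = w e"
  shows "local_value b B \<eta> T E w' v = local_value b B \<eta> T E w v"
proof -
  have "w' e = w e" if "e \<in> ball_edges E v T" for e using that assms by (auto simp: ball_edges_def)
  then have "local_value b B \<eta> T (ball_edges E v T) w' v = local_value b B \<eta> T E w v"
    by (rule local_value_ball)
  moreover have "local_value b B \<eta> T (ball_edges E v T) w' v = local_value b B \<eta> T E w' v"
    by (rule local_value_ball) simp
  ultimately show ?thesis by simp
qed

lemma integral_local_value_relabel:
  assumes D: "real_distribution D" and \<pi>: "inj_on \<pi> S" and \<tau>: "\<tau> \<subseteq> Pow S" and v: "v \<in> S"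
    and K: "(`) \<pi> ` \<tau> \<subseteq> K"
  shows "(\<integral>w. local_value b B \<eta> T ((`) \<pi> ` \<tau>) (\<lambda>e. clip B (w e)) (\<pi> v) \<partial>(\<Pi>\<^sub>M e\<in>K. D)) =
     mean_local_value D b B \<eta> T \<tau> v"
proof -
  let ?g = "\<lambda>w. local_value b B \<eta> T \<tau> (\<lambda>e. clip B (w e)) v"
  interpret real_distribution D by (rule D)
  have g: "?g \<in> borel_measurable (\<Pi>\<^sub>M e\<in>\<tau>. D)"
    by (intro local_value_measurable clipped_weight_measurable D)
  have "local_value b B \<eta> T ((`) \<pi> ` \<tau>) (\<lambda>e. clip B (w e)) (\<pi> v) = ?g (\<lambda>e\<in>\<tau>. w (\<pi> ` e))" for w
    unfolding local_value_relabel[OF \<pi> \<tau> v] by (rule local_value_cong) simp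
  then show ?thesis
    unfolding mean_local_value_def
    using integral_PiM_reindex[OF prob_space_axioms inj_on_image_sets[OF \<pi> \<tau>] K g] by simp
qed

lemma mean_local_value_relabel_invariant:
  assumes D: "real_distribution D"
  shows "relabel_invariant (mean_local_value D b B \<eta> T)"
  unfolding relabel_invariant_def
proof (intro allI impI)
  fix \<pi> :: "'a \<Rightarrow> 'a" and S \<tau> v
  assume *: "finite S" "inj_on \<pi> S" "\<tau> \<subseteq> Pow S" "v \<in> S"
  show "mean_local_value D b B \<eta> T ((`) \<pi> ` \<tau>) (\<pi> v) = mean_local_value D b B \<eta> T \<tau> v"
    using integral_local_value_relabel[OF D *(2-4) order_refl] by (simp add: mean_local_value_def)
qed

text \<open>
  Averaging over the weights keeps the functional local.
\<close>

lemma integral_local_value_ball: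
  assumes D: "real_distribution D" and E: "E \<subseteq> A"
  shows "(\<integral>w. local_value b B \<eta> T E (\<lambda>e. clip B (w e)) v \<partial>(\<Pi>\<^sub>M e\<in>A. D)) =
     mean_local_value D b B \<eta> T (ball_edges E v T) v"
proof -
  have "(\<integral>w. local_value b B \<eta> T E (\<lambda>e. clip B (w e)) v \<partial>(\<Pi>\<^sub>M e\<in>A. D)) =
        (\<integral>w. local_value b B \<eta> T ((`) id ` ball_edges E v T) (\<lambda>e. clip B (w e)) (id v) \<partial>(\<Pi>\<^sub>M e\<in>A. D))"
    by (simp add: local_value_ball)
  also have "\<dots> = mean_local_value D b B \<eta> T (ball_edges E v T) v"
    by (rule integral_local_value_relabel[OF D, where S=UNIV]) (use E in \<open>auto simp: ball_edges_def\<close>)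
  finally show ?thesis .
qed

abbreviation clipped_max :: "nat \<Rightarrow> real \<Rightarrow> 'a set set \<Rightarrow> ('a set \<Rightarrow> real) \<Rightarrow> real" where
  "clipped_max b B E w \<equiv> max_weight_b_matching b E (\<lambda>e. clip B (w e))"

text \<open>
  Restrict an optimal b-matching of E to the edges in E'.
\<close>

lemma max_weight_b_matching_edge_change:
  assumes fin: "finite E" "finite E'" and w: "\<And>e. e \<in> E \<Longrightarrow> w e \<le> B" and B: "B \<ge> 0"
  shows "max_weight_b_matching b E w \<le> max_weight_b_matching b E' w + B * card (E - E')"
proof -
  obtain F where F: "b_matching b E F" "max_weight_b_matching b E w = (\<Sum>e\<in>F. w e)"
    by (rule max_weight_b_matching_attained[OF fin(1)])
  have FE: "F \<subseteq> E" and finF: "finite F" using F(1) fin finite_subset by (auto simp: b_matching_def)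
  have "b_matching b E' (F \<inter> E')" unfolding b_matching_def
  proof (intro conjI allI)
    fix v
    have "card {e \<in> F \<inter> E'. v \<in> e} \<le> card {e \<in> F. v \<in> e}" using finF by (intro card_mono) auto
    also have "\<dots> \<le> b" using F(1) by (simp add: b_matching_def)
    finally show "card {e \<in> F \<inter> E'. v \<in> e} \<le> b" .
  qed simp
  then have "(\<Sum>e\<in>F \<inter> E'. w e) \<le> max_weight_b_matching b E' w"
    by (rule max_weight_b_matching_ge[OF fin(2)])
  moreover have "(\<Sum>e\<in>F. w e) = (\<Sum>e\<in>F \<inter> E'. w e) + (\<Sum>e\<in>F - E'. w e)"
    by (rule sum.Int_Diff[OF finF])
  moreover have "(\<Sum>e\<in>F - E'. w e) \<le> B * card (E - E')"
  proof -
    have "(\<Sum>e\<in>F - E'. w e) \<le> (\<Sum>e\<in>F - E'. B)" using w FE by (intro sum_mono) auto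
    also have "\<dots> = B * card (F - E')" by simp
    also have "\<dots> \<le> B * card (E - E')"
      using fin FE B by (intro mult_left_mono of_nat_mono card_mono) auto
    finally show ?thesis .
  qed
  ultimately show ?thesis using F(2) by linarith
qed

lemma max_weight_b_matching_weight_change:
  assumes fin: "finite E" and w: "\<And>e. e \<in> E \<Longrightarrow> w' e \<le> w e + d e" and d: "\<And>e. e \<in> E \<Longrightarrow> d e \<ge> 0"
  shows "max_weight_b_matching b E w' \<le> max_weight_b_matching b E w + (\<Sum>e\<in>E. d e)"
proof -
  obtain F where F: "b_matching b E F" "max_weight_b_matching b E w' = (\<Sum>e\<in>F. w' e)"
    by (rule max_weight_b_matching_attained[OF fin(1)])
  have FE: "F \<subseteq> E" using F(1) by (auto simp: b_matching_def)
  have "(\<Sum>e\<in>F. w' e) \<le> (\<Sum>e\<in>F. w e + d e)" using w FE by (intro sum_mono) auto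
  also have "\<dots> = (\<Sum>e\<in>F. w e) + (\<Sum>e\<in>F. d e)" by (rule sum.distrib)
  also have "(\<Sum>e\<in>F. d e) \<le> (\<Sum>e\<in>E. d e)" using fin FE d by (intro sum_mono2) auto
  also have "(\<Sum>e\<in>F. w e) \<le> max_weight_b_matching b E w" by (rule max_weight_b_matching_ge[OF fin F(1)])
  finally show ?thesis using F(2) by simp
qed

lemma max_weight_b_matching_cong:
  assumes "\<And>e. e \<in> E \<Longrightarrow> w' e = w e"
  shows "max_weight_b_matching b E w' = max_weight_b_matching b E w"
  unfolding max_weight_b_matching_def
  by (intro arg_cong[where f=Max] image_cong refl sum.cong) (use assms in \<open>auto simp: b_matching_def\<close>)

lemma clipped_max_bounds:
  assumes fin: "finite E" and B: "B \<ge> 0"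
  shows "0 \<le> clipped_max b B E w" "clipped_max b B E w \<le> B * card E"
proof -
  show "0 \<le> clipped_max b B E w"
    using max_weight_b_matching_ge[OF fin b_matching_empty, of "\<lambda>e. clip B (w e)"] by simp
  obtain F where F: "b_matching b E F" "clipped_max b B E w = (\<Sum>e\<in>F. clip B (w e))"
    by (rule max_weight_b_matching_attained[OF fin(1)])
  have FE: "F \<subseteq> E" using F(1) by (auto simp: b_matching_def)
  have "(\<Sum>e\<in>F. clip B (w e)) \<le> (\<Sum>e\<in>F. B)" using clip_bounds[OF B] by (intro sum_mono) auto
  also have "\<dots> = B * card F" by simp
  also have "\<dots> \<le> B * card E" using fin FE B by (intro mult_left_mono of_nat_mono card_mono) auto
  finally show "clipped_max b B E w \<le> B * card E" using F(2) by simp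
qed

lemma clipped_max_weight_change:
  assumes fin: "finite E" and B: "B \<ge> 0"
  shows "\<bar>clipped_max b B E (w(i := z)) - clipped_max b B E w\<bar> \<le> (if i \<in> E then B else 0)"
proof -
  let ?d = "\<lambda>e. if e = i then B else 0"
  have "(\<Sum>e\<in>E. ?d e) = (if i \<in> E then B else 0)" using fin by simp
  moreover have "clipped_max b B E (w(i := z)) \<le> clipped_max b B E w + (\<Sum>e\<in>E. ?d e)"
    by (rule max_weight_b_matching_weight_change[OF fin])
       (use clip_bounds[OF B] B in \<open>auto intro: order_trans simp: add_increasing\<close>)
  moreover have "clipped_max b B E w \<le> clipped_max b B E (w(i := z)) + (\<Sum>e\<in>E. ?d e)"
    by (rule max_weight_b_matching_weight_change[OF fin])
       (use clip_bounds[OF B] B in \<open>auto intro: order_trans simp: add_increasing\<close>)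
  ultimately show ?thesis by linarith
qed

lemma clipped_max_edge_swap:
  assumes fin: "finite X" "finite Y" and card: "card X = card Y" "card (X - Y) \<le> 1" and B: "B \<ge> 0"
  shows "\<bar>clipped_max b B X w - clipped_max b B Y w\<bar> \<le> B"
proof -
  have "card (Y - X) = card (X - Y)"
    using card_le_sym_Diff[of X Y] card_le_sym_Diff[of Y X] fin card(1) by simp
  then have "card (Y - X) \<le> 1" using card(2) by simp
  then have "B * card (Y - X) \<le> B" "B * card (X - Y) \<le> B"
    using B card(2) by (simp_all add: mult_left_le)
  moreover have "clipped_max b B X w \<le> clipped_max b B Y w + B * card (X - Y)"
    by (rule max_weight_b_matching_edge_change) (use fin B clip_bounds[OF B] in auto)
  moreover have "clipped_max b B Y w \<le> clipped_max b B X w + B * card (Y - X)"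
    by (rule max_weight_b_matching_edge_change) (use fin B clip_bounds[OF B] in auto)
  ultimately show ?thesis by linarith
qed

lemma clipped_max_measurable:
  assumes D: "real_distribution D" and E: "E \<subseteq> A" "finite E"
  shows "(\<lambda>w. clipped_max b B E w) \<in> borel_measurable (\<Pi>\<^sub>M e\<in>A. D)"
  unfolding max_weight_b_matching_def
  by (intro borel_measurable_Max finite_b_matchings E borel_measurable_sum clipped_weight_measurable D)
     (use E in \<open>auto simp: b_matching_def\<close>)

section \<open>Variance and local approximation of the mean\<close>

definition mean_max :: "real measure \<Rightarrow> nat \<Rightarrow> real \<Rightarrow> nat \<Rightarrow> nat set set \<Rightarrow> real" where
  "mean_max D b B n E = (\<integral>w. clipped_max b B E w \<partial>(\<Pi>\<^sub>M e\<in>all_edges n. D))"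

lemma clipped_max_bounded:
  assumes E: "E \<subseteq> all_edges n" and B: "B \<ge> 0"
  shows "\<bar>clipped_max b B E w\<bar> \<le> B * card (all_edges n)"
proof -
  have "finite E" by (rule finite_subset[OF E finite_all_edges])
  from clipped_max_bounds[OF this B, of b w] have "\<bar>clipped_max b B E w\<bar> \<le> B * card E" by simp
  also have "\<dots> \<le> B * card (all_edges n)" using E B by (intro mult_left_mono of_nat_mono card_mono) auto
  finally show ?thesis .
qed

text \<open>
  The variance splits into the mean conditional variance given the graph and the variance of the conditional
  mean.  In the former only the m weights of present edges have influence, each at most B; in the latter
  an edge swap has influence at most B.
\<close>

lemma clipped_max_variance_le:
  fixes b n m :: nat and B :: real
  assumes D: "real_distribution D" and s: "m \<le> card (all_edges n)" and B: "B \<ge> 0"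
  defines "\<mu> \<equiv> subset_mean (all_edges n) m (mean_max D b B n)"
  shows "subset_mean (all_edges n) m (\<lambda>E. \<integral>w. (clipped_max b B E w - \<mu>)\<^sup>2 \<partial>(\<Pi>\<^sub>M e\<in>all_edges n. D)) \<le> 2 * m * B\<^sup>2"
proof -
  let ?W = "\<Pi>\<^sub>M e\<in>all_edges n. D"
  interpret D: real_distribution D by (rule D)
  interpret W: prob_space ?W by (intro prob_space_PiM D.prob_space_axioms)
  have finE: "finite E" if "E \<subseteq> all_edges n" for E by (rule finite_subset[OF that finite_all_edges])
  have meas: "(\<lambda>w. clipped_max b B E w) \<in> borel_measurable ?W" if "E \<subseteq> all_edges n" for E
    by (rule clipped_max_measurable[OF D that finE[OF that]])
  have "subset_mean (all_edges n) m (\<lambda>E. \<integral>w. (clipped_max b B E w - \<mu>)\<^sup>2 \<partial>?W) \<le>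
        subset_mean (all_edges n) m (\<lambda>E. m * B\<^sup>2 + (mean_max D b B n E - \<mu>)\<^sup>2)"
  proof (rule subset_mean_mono)
    fix E assume E: "E \<subseteq> all_edges n" "card E = m"
    have "(\<integral>w. (clipped_max b B E w - mean_max D b B n E)\<^sup>2 \<partial>?W) \<le> (\<Sum>e\<in>all_edges n. (if e \<in> E then B else 0)\<^sup>2)"
      unfolding mean_max_def
      by (rule product_variance_le[OF D.prob_space_axioms finite_all_edges meas[OF E(1)]
             clipped_max_bounded[OF E(1) B] clipped_max_weight_change[OF finE[OF E(1)] B]])
    also have "\<dots> = (\<Sum>e\<in>E. B\<^sup>2)"
      by (rule sum.mono_neutral_cong_right) (use E in auto)
    finally have "(\<integral>w. (clipped_max b B E w - mean_max D b B n E)\<^sup>2 \<partial>?W) \<le> m * B\<^sup>2" using E(2) by simp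
    moreover have "(\<integral>w. (clipped_max b B E w - \<mu>)\<^sup>2 \<partial>?W) =
       (\<integral>w. (clipped_max b B E w - mean_max D b B n E)\<^sup>2 \<partial>?W) + (mean_max D b B n E - \<mu>)\<^sup>2"
      unfolding mean_max_def by (rule W.bias_variance[OF meas[OF E(1)] clipped_max_bounded[OF E(1) B]])
    ultimately show "(\<integral>w. (clipped_max b B E w - \<mu>)\<^sup>2 \<partial>?W) \<le> m * B\<^sup>2 + (mean_max D b B n E - \<mu>)\<^sup>2" by simp
  qed
  also have "\<dots> = m * B\<^sup>2 + subset_mean (all_edges n) m (\<lambda>E. (mean_max D b B n E - \<mu>)\<^sup>2)"
    by (simp add: subset_mean_add subset_mean_const s)
  also have "subset_mean (all_edges n) m (\<lambda>E. (mean_max D b B n E - \<mu>)\<^sup>2) \<le> m * B\<^sup>2"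
    unfolding \<mu>_def
  proof (rule subset_mean_variance_le[OF finite_all_edges s])
    fix X Y assume *: "X \<subseteq> all_edges n" "Y \<subseteq> all_edges n" "card X = m" "card Y = m" "card (X - Y) \<le> 1"
    have int: "integrable ?W (\<lambda>w. clipped_max b B E w)" if "E \<subseteq> all_edges n" for E
      by (rule W.integrable_bounded[OF meas[OF that] clipped_max_bounded[OF that B]])
    have "mean_max D b B n X - mean_max D b B n Y = (\<integral>w. clipped_max b B X w - clipped_max b B Y w \<partial>?W)"
      unfolding mean_max_def by (rule Bochner_Integration.integral_diff[symmetric, OF int[OF *(1)] int[OF *(2)]])
    also have "\<bar>\<dots>\<bar> \<le> B"
      by (rule W.expectation_abs_le) (intro clipped_max_edge_swap; use * finE B in auto)
    finally show "\<bar>mean_max D b B n X - mean_max D b B n Y\<bar> \<le> B" .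
  qed
  finally show ?thesis by simp
qed

text \<open>
  Expectation of the deterministic approximation, with the moment bounds for degrees and short cycles
  inserted.
\<close>

lemma mean_max_local_approximation:
  assumes D: "real_distribution D" and s: "sparse n m c" and B: "B \<ge> 0" and b: "b \<ge> 1"
    and \<eta>: "\<eta> > 0" and T: "T > 0" and L: "L > 0"
  shows "\<bar>subset_mean (all_edges n) m (mean_max D b B n) -
      (\<Sum>v\<in>{1..n}. subset_mean (all_edges n) m (\<lambda>E. mean_local_value D b B \<eta> T (ball_edges E v T) v)) / 2\<bar> \<le>
    n * (B * ((B + \<eta> * (4 * c)) / (\<eta> * T)) + \<eta> * ((real b)\<^sup>2 + 4 * c + (4 * c)\<^sup>2) + B / L) +
    B * (\<Sum>k<L. 2 ^ 2 ^ k * (4 * c) ^ k)"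
proof -
  let ?W = "\<Pi>\<^sub>M e\<in>all_edges n. D"
  let ?mean = "subset_mean (all_edges n) m"
  let ?F = "\<lambda>E v. mean_local_value D b B \<eta> T (ball_edges E v T) v"
  interpret D: real_distribution D by (rule D)
  interpret W: prob_space ?W by (intro prob_space_PiM D.prob_space_axioms)
  define err where "err = (\<lambda>E. B * (\<Sum>v\<in>{1..n}. violation B \<eta> T E v) + \<eta> / 2 * (\<Sum>v\<in>{1..n}. (real b + degree E v)\<^sup>2) +
     B * (card {A\<in>cycle_sets E. card A < L} + n / L))"
  have mN: "m \<le> card (all_edges n)" using s by (simp add: sparse_def card_all_edges)
  have pointwise: "\<bar>mean_max D b B n E - (\<Sum>v\<in>{1..n}. ?F E v) / 2\<bar> \<le> err E" if E: "E \<subseteq> all_edges n" for E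
  proof -
    have finE: "finite E" by (rule finite_subset[OF E finite_all_edges])
    let ?l = "\<lambda>w v. local_value b B \<eta> T E (\<lambda>e. clip B (w e)) v"
    have int1: "integrable ?W (\<lambda>w. clipped_max b B E w)"
      by (rule W.integrable_bounded[OF clipped_max_measurable[OF D E finE] clipped_max_bounded[OF E B]])
    have int2: "integrable ?W (\<lambda>w. ?l w v)" for v
      by (rule W.integrable_bounded[OF _ clipped_local_value_bounds[OF B]],
          intro local_value_measurable clipped_weight_measurable D) (use E in auto)
    have "mean_max D b B n E - (\<Sum>v\<in>{1..n}. ?F E v) / 2 =
       (\<integral>w. clipped_max b B E w - (\<Sum>v\<in>{1..n}. ?l w v) / 2 \<partial>?W)"
      using int1 int2 by (simp add: mean_max_def integral_local_value_ball[OF D E])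
    also have "\<bar>\<dots>\<bar> \<le> err E"
    proof (rule W.expectation_abs_le)
      fix w
      show "\<bar>clipped_max b B E w - (\<Sum>v\<in>{1..n}. ?l w v) / 2\<bar> \<le> err E"
        using max_weight_b_matching_local_approximation[of "{1..n}" E "\<lambda>e. clip B (w e)" B b \<eta> T L]
          E clip_bounds[OF B] B b \<eta> T L unfolding err_def by (auto simp: all_edges_def)
    qed
    finally show ?thesis .
  qed
  have "\<bar>?mean (mean_max D b B n) - (\<Sum>v\<in>{1..n}. ?mean (\<lambda>E. ?F E v)) / 2\<bar> =
        \<bar>?mean (\<lambda>E. mean_max D b B n E - (\<Sum>v\<in>{1..n}. ?F E v) / 2)\<bar>"
    using subset_mean_cmult[of "all_edges n" m "1/2" "\<lambda>E. \<Sum>v\<in>{1..n}. ?F E v"]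
    by (simp only: subset_mean_diff subset_mean_sum) (simp add: subset_mean_sum)
  also have "\<dots> \<le> ?mean (\<lambda>E. \<bar>mean_max D b B n E - (\<Sum>v\<in>{1..n}. ?F E v) / 2\<bar>)" by (rule subset_mean_abs)
  also have "\<dots> \<le> ?mean err" by (rule subset_mean_mono[OF pointwise])
  also have "?mean err = B * (\<Sum>v\<in>{1..n}. ?mean (\<lambda>E. violation B \<eta> T E v)) +
     \<eta> / 2 * (\<Sum>v\<in>{1..n}. ?mean (\<lambda>E. (real b + degree E v)\<^sup>2)) +
     B * (?mean (\<lambda>E. real (card {A\<in>cycle_sets E. card A < L})) + n / L)"
    unfolding err_def by (simp only: subset_mean_add subset_mean_cmult subset_mean_sum subset_mean_const[OF finite_all_edges mN])
  also have "\<dots> \<le> B * (\<Sum>v\<in>{1..n}. (B + \<eta> * (4 * c)) / (\<eta> * T)) +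
     \<eta> / 2 * (\<Sum>v\<in>{1..n}. 2 * ((real b)\<^sup>2 + 4 * c + (4 * c)\<^sup>2)) + B * ((\<Sum>k<L. 2 ^ 2 ^ k * (4 * c) ^ k) + n / L)"
  proof (intro add_mono mult_left_mono sum_mono B order_refl mean_short_cycle_sets_le[OF s])
    fix v assume v: "v \<in> {1..n}"
    have "(\<lambda>E. violation B \<eta> T E v) = (\<lambda>E. 1 / (\<eta> * T) * (B + \<eta> * real (degree E v)))"
      by (simp add: violation_def fun_eq_iff)
    then have "?mean (\<lambda>E. violation B \<eta> T E v) = 1 / (\<eta> * T) * (B + \<eta> * ?mean (\<lambda>E. real (degree E v)))"
      by (simp only: subset_mean_add subset_mean_cmult subset_mean_const[OF finite_all_edges mN])
    also have "\<dots> \<le> 1 / (\<eta> * T) * (B + \<eta> * (4 * c))"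
      using mean_degree_le[OF s v] \<eta> by (intro mult_left_mono add_left_mono) auto
    finally show "?mean (\<lambda>E. violation B \<eta> T E v) \<le> (B + \<eta> * (4 * c)) / (\<eta> * T)" by simp
    have "?mean (\<lambda>E. (real b + degree E v)\<^sup>2) \<le> ?mean (\<lambda>E. 2 * (real b)\<^sup>2 + 2 * (real (degree E v))\<^sup>2)"
    proof (rule subset_mean_mono)
      fix E
      show "(real b + degree E v)\<^sup>2 \<le> 2 * (real b)\<^sup>2 + 2 * (real (degree E v))\<^sup>2"
        using zero_le_power2[of "real b - degree E v"] by (simp add: power2_eq_square algebra_simps)
    qed
    also have "\<dots> = 2 * (real b)\<^sup>2 + 2 * ?mean (\<lambda>E. (real (degree E v))\<^sup>2)"
      by (simp only: subset_mean_add subset_mean_cmult subset_mean_const[OF finite_all_edges mN])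
    also have "\<dots> \<le> 2 * ((real b)\<^sup>2 + 4 * c + (4 * c)\<^sup>2)" using mean_degree_square_le[OF s v] by simp
    finally show "?mean (\<lambda>E. (real b + degree E v)\<^sup>2) \<le> 2 * ((real b)\<^sup>2 + 4 * c + (4 * c)\<^sup>2)" .
  qed (use \<eta> in simp)
  also have "\<dots> = n * (B * ((B + \<eta> * (4 * c)) / (\<eta> * T)) + \<eta> * ((real b)\<^sup>2 + 4 * c + (4 * c)\<^sup>2) + B / L) +
    B * (\<Sum>k<L. 2 ^ 2 ^ k * (4 * c) ^ k)"
    by (simp add: algebra_simps)
  finally show ?thesis .
qed

section \<open>Convergence in probability\<close>

text \<open>
  The mean per vertex is, up to every positive error, a convergent average of a local functional.
\<close>

theorem mean_max_convergent:
  assumes D: "real_distribution D" and c: "c > 0" and B: "B \<ge> 0" and b: "b \<ge> 1"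
  shows "convergent (\<lambda>n. subset_mean (all_edges n) (nat \<lfloor>c * real n\<rfloor>) (mean_max D b B n) / n)"
    (is "convergent (\<lambda>n. ?X n / n)")
proof (rule convergent_if_nearly_convergent)
  fix \<epsilon> :: real assume \<epsilon>: "\<epsilon> > 0"
  interpret D: real_distribution D by (rule D)
  let ?m = "\<lambda>n. nat \<lfloor>c * real n\<rfloor>"
  define G where "G = (real b)\<^sup>2 + 4 * c + (4 * c)\<^sup>2"
  have G: "G > 0" using c by (simp add: G_def add_nonneg_pos add_pos_nonneg)
  \<comment> \<open>The step size makes the regret term \<epsilon> / 4; then T and L are taken large enough for the other two terms.\<close>
  define \<eta> where "\<eta> = \<epsilon> / (4 * G)"
  have \<eta>: "\<eta> > 0" using \<epsilon> G by (simp add: \<eta>_def)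
  define R where "R = B * (B + \<eta> * (4 * c)) / \<eta>"
  have R: "R \<ge> 0" using B \<eta> c by (simp add: R_def)
  obtain T :: nat where T: "4 * R / \<epsilon> + 1 < T" using reals_Archimedean2 by blast
  obtain L :: nat where L: "4 * B / \<epsilon> + 1 < L" using reals_Archimedean2 by blast
  have pos: "real T > 0" "real L > 0" using T L R B \<epsilon> by (smt (verit) divide_nonneg_pos mult_nonneg_nonneg)+
  have e1: "B * ((B + \<eta> * (4 * c)) / (\<eta> * T)) \<le> \<epsilon> / 4"
  proof -
    have "B * ((B + \<eta> * (4 * c)) / (\<eta> * T)) = R / T" by (simp add: R_def)
    also have "\<dots> \<le> \<epsilon> / 4" using T pos \<epsilon> by (simp add: field_simps)
    finally show ?thesis .
  qed
  have e2: "\<eta> * G \<le> \<epsilon> / 4" using G by (simp add: \<eta>_def)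
  have e3: "B / L \<le> \<epsilon> / 4" using L pos \<epsilon> by (simp add: field_simps)
  define Z where "Z = B * (\<Sum>k<L. 2 ^ 2 ^ k * (4 * c) ^ k)"
  let ?F = "mean_local_value D b B \<eta> T :: nat set set \<Rightarrow> nat \<Rightarrow> real"
  let ?Q = "\<lambda>n. \<Sum>v\<in>{1..n}. subset_mean (all_edges n) (?m n) (\<lambda>E. ?F (ball_edges E v T) v)"
  have "convergent (\<lambda>n. ?Q n / n)"
    by (rule local_average_convergent[OF c mean_local_value_relabel_invariant[OF D]
          mean_local_value_bound[OF D.prob_space_axioms B]])
  then have "convergent (\<lambda>n. 1 / 2 * (?Q n / n))" by (intro convergent_mult convergent_const)
  then have "convergent (\<lambda>n. ?Q n / 2 / n)" by (simp add: field_simps)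
  moreover have "\<forall>\<^sub>F n in sequentially. \<bar>?X n / n - ?Q n / 2 / n\<bar> \<le> \<epsilon>"
  proof -
    have "\<forall>\<^sub>F n::nat in sequentially. 4 * Z / \<epsilon> < n" by real_asymp
    with eventually_sparse[OF c] show ?thesis
    proof eventually_elim
      case (elim n)
      have n: "real n > 0" using elim by (auto simp: sparse_def)
      have Zn: "Z \<le> n * (\<epsilon> / 4)" using elim \<epsilon> by (simp add: field_simps)
      have "\<bar>?X n - ?Q n / 2\<bar> \<le> n * (B * ((B + \<eta> * (4 * c)) / (\<eta> * T)) + \<eta> * G + B / L) + Z"
        unfolding G_def Z_def using elim(1) D B b \<eta> pos by (intro mean_max_local_approximation) auto
      also have "\<dots> \<le> n * (\<epsilon> / 4 + \<epsilon> / 4 + \<epsilon> / 4) + n * (\<epsilon> / 4)"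
        using e1 e2 e3 Zn by (intro add_mono mult_left_mono) auto
      also have "\<dots> = n * \<epsilon>" by simp
      finally have "\<bar>?X n - ?Q n / 2\<bar> / n \<le> \<epsilon>" using n by (simp add: field_simps)
      moreover have "\<bar>?X n / n - ?Q n / 2 / n\<bar> = \<bar>?X n - ?Q n / 2\<bar> / n"
        using n by (simp only: diff_divide_distrib[symmetric] abs_divide abs_of_pos)
      ultimately show ?case by simp
    qed
  qed
  ultimately show "\<exists>Y. convergent Y \<and> (\<forall>\<^sub>F n in sequentially. \<bar>?X n / n - Y n\<bar> \<le> \<epsilon>)" by blast
qed

lemma prob_space_random_graph:
  assumes "sparse n (nat \<lfloor>c * real n\<rfloor>) c"
  shows "prob_space (random_graph n c)"
  unfolding random_graph_def using assms
  by (intro prob_space_uniform_count_measure graphs_with_edges_nonempty) (auto simp: sparse_def)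

lemma prob_space_weighted_graph_sparse:
  assumes "prob_space D" "sparse n (nat \<lfloor>c * real n\<rfloor>) c"
  shows "prob_space (weighted_graph D n c)"
proof -
  interpret G: prob_space "random_graph n c" by (rule prob_space_random_graph[OF assms(2)])
  interpret W: prob_space "\<Pi>\<^sub>M e\<in>all_edges n. D" by (intro prob_space_PiM assms)
  interpret pair_prob_space "random_graph n c" "\<Pi>\<^sub>M e\<in>all_edges n. D" ..
  show ?thesis unfolding weighted_graph_def by (rule prob_space_axioms)
qed

lemma weighted_graph_integral:
  assumes D: "prob_space D" and s: "sparse n (nat \<lfloor>c * real n\<rfloor>) c"
    and h: "(\<lambda>(E, w). h E w) \<in> borel_measurable (weighted_graph D n c)"
    and C: "\<And>E w. E \<subseteq> all_edges n \<Longrightarrow> \<bar>h E w\<bar> \<le> C"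
  shows "(\<integral>(E, w). h E w \<partial>weighted_graph D n c) =
    subset_mean (all_edges n) (nat \<lfloor>c * real n\<rfloor>) (\<lambda>E. \<integral>w. h E w \<partial>(\<Pi>\<^sub>M e\<in>all_edges n. D))"
proof -
  let ?G = "random_graph n c" and ?W = "\<Pi>\<^sub>M e\<in>all_edges n. D" and ?m = "nat \<lfloor>c * real n\<rfloor>"
  interpret P: prob_space "weighted_graph D n c" by (rule prob_space_weighted_graph_sparse[OF D s])
  interpret W: prob_space ?W by (intro prob_space_PiM D)
  interpret G: prob_space ?G by (rule prob_space_random_graph[OF s])
  interpret pair_sigma_finite ?G ?W ..
  have int: "integrable (weighted_graph D n c) (\<lambda>(E, w). h E w)"
  proof (rule P.integrable_bounded[OF h, where C=C])
    fix x assume "x \<in> space (weighted_graph D n c)"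
    then have "fst x \<subseteq> all_edges n"
      by (auto simp: weighted_graph_def space_pair_measure random_graph_def space_uniform_count_measure graphs_with_edges_def)
    then show "\<bar>case x of (E, w) \<Rightarrow> h E w\<bar> \<le> C" using C by (simp add: case_prod_beta)
  qed
  then have "(\<integral>(E, w). h E w \<partial>weighted_graph D n c) = (\<integral>E. (\<integral>w. h E w \<partial>?W) \<partial>?G)"
    unfolding weighted_graph_def by (subst integral_fst'[symmetric]) simp_all
  also have "\<dots> = subset_mean (all_edges n) ?m (\<lambda>E. \<integral>w. h E w \<partial>?W)"
    unfolding random_graph_def integral_uniform_count_measure[OF finite_graphs_with_edges]
    by (simp add: subset_mean_def graphs_with_edges_def n_subsets)
  finally show ?thesis .
qed

lemma clipped_max_measurable_weighted_graph:
  assumes D: "real_distribution D"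
  shows "(\<lambda>(E, w). clipped_max b B E w) \<in> borel_measurable (weighted_graph D n c)"
proof -
  interpret D: real_distribution D by (rule D)
  let ?A = "graphs_with_edges n (nat \<lfloor>c * real n\<rfloor>)"
  have sets_A: "sets (random_graph n c) = sets (count_space ?A)"
    by (simp add: random_graph_def sets_uniform_count_measure)
  have "(\<lambda>w. clipped_max b B E w) \<in> borel_measurable (\<Pi>\<^sub>M e\<in>all_edges n. D)" if "E \<in> ?A" for E
  proof -
    have E: "E \<subseteq> all_edges n" using that by (auto simp: graphs_with_edges_def)
    show ?thesis by (rule clipped_max_measurable[OF D E finite_subset[OF E finite_all_edges]])
  qed
  then have "(\<lambda>(E, w). clipped_max b B E w)
      \<in> borel_measurable (count_space ?A \<Otimes>\<^sub>M (\<Pi>\<^sub>M e\<in>all_edges n. D))"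
    by (intro measurable_pair_measure_countable1) (auto simp: countable_finite)
  then show ?thesis
    unfolding weighted_graph_def
    using measurable_cong_sets[OF sets_pair_measure_cong[OF sets_A refl] refl] by blast
qed

text \<open>
  The variance is of order n, so deviations of order n have probability O(1 / n).
\<close>

lemma clipped_max_concentration:
  fixes b n :: nat and B c a :: real
  assumes D: "real_distribution D" and s: "sparse n (nat \<lfloor>c * real n\<rfloor>) c" and B: "B \<ge> 0"
    and a: "a > 0"
  defines "\<mu> \<equiv> subset_mean (all_edges n) (nat \<lfloor>c * real n\<rfloor>) (mean_max D b B n)"
  shows "measure (weighted_graph D n c) {x \<in> space (weighted_graph D n c).
      \<bar>(case x of (E, w) \<Rightarrow> clipped_max b B E w) - \<mu>\<bar> \<ge> a} \<le> 2 * (c * n) * B\<^sup>2 / a\<^sup>2"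
proof -
  let ?M = "weighted_graph D n c" and ?m = "nat \<lfloor>c * real n\<rfloor>"
  let ?f = "\<lambda>(E, w). clipped_max b B E w"
  interpret D: real_distribution D by (rule D)
  interpret P: prob_space ?M by (rule prob_space_weighted_graph_sparse[OF D.prob_space_axioms s])
  have mN: "?m \<le> card (all_edges n)" using s by (simp add: sparse_def card_all_edges)
  let ?C = "B * card (all_edges n)"
  have f [measurable]: "?f \<in> borel_measurable ?M" by (rule clipped_max_measurable_weighted_graph[OF D])
  have sq: "\<bar>(r - t)\<^sup>2\<bar> \<le> (?C + \<bar>t\<bar>)\<^sup>2" if "\<bar>r\<bar> \<le> ?C" for r t :: real
    using that by (simp add: abs_le_square_iff[symmetric])
  have mean: "P.expectation ?f = \<mu>"
    unfolding \<mu>_def mean_max_def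
    by (rule weighted_graph_integral[OF D.prob_space_axioms s f clipped_max_bounded[OF _ B]])
  have var: "P.expectation (\<lambda>x. (?f x - t)\<^sup>2) =
     subset_mean (all_edges n) ?m (\<lambda>E. \<integral>w. (clipped_max b B E w - t)\<^sup>2 \<partial>(\<Pi>\<^sub>M e\<in>all_edges n. D))" for t
  proof -
    have eq: "(\<lambda>x. (?f x - t)\<^sup>2) = (\<lambda>(E, w). (clipped_max b B E w - t)\<^sup>2)" by (auto simp: fun_eq_iff)
    have "(\<lambda>x. (?f x - t)\<^sup>2) \<in> borel_measurable ?M" by measurable
    then show ?thesis
      unfolding eq
      by (rule weighted_graph_integral[OF D.prob_space_axioms s _ sq[OF clipped_max_bounded[OF _ B]]])
  qed
  have var_le: "P.variance ?f \<le> 2 * (c * n) * B\<^sup>2"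
  proof -
    have "P.variance ?f \<le> 2 * ?m * B\<^sup>2"
      unfolding mean var unfolding \<mu>_def by (rule clipped_max_variance_le[OF D mN B])
    also have "\<dots> \<le> 2 * (c * n) * B\<^sup>2"
      using s by (intro mult_right_mono mult_left_mono) (auto simp: sparse_def)
    finally show ?thesis .
  qed
  have "integrable ?M (\<lambda>x. (?f x)\<^sup>2)"
  proof (rule P.integrable_bounded)
    fix x assume "x \<in> space ?M"
    then have "fst x \<subseteq> all_edges n"
      by (auto simp: weighted_graph_def space_pair_measure random_graph_def space_uniform_count_measure graphs_with_edges_def)
    then show "\<bar>(?f x)\<^sup>2\<bar> \<le> (?C + \<bar>0\<bar>)\<^sup>2"
      using sq[of "?f x" 0] clipped_max_bounded[OF _ B] by (simp add: case_prod_beta)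
  qed measurable
  from P.Chebyshev_inequality[OF f this a]
  have "P.prob {x \<in> space ?M. \<bar>?f x - \<mu>\<bar> \<ge> a} \<le> P.variance ?f / a\<^sup>2" unfolding mean .
  also have "\<dots> \<le> 2 * (c * n) * B\<^sup>2 / a\<^sup>2" using var_le by (rule divide_right_mono) simp
  finally show ?thesis .
qed

lemma AE_weights_in_range:
  assumes D: "real_distribution D" and AE: "AE x in D. x \<in> {0..B}" and s: "sparse n (nat \<lfloor>c * real n\<rfloor>) c"
  shows "AE x in weighted_graph D n c. \<forall>e\<in>all_edges n. snd x e \<in> {0..B}"
proof (rule AE_finite_allI[OF finite_all_edges])
  fix e assume e: "e \<in> all_edges n"
  interpret D: real_distribution D by (rule D)
  let ?G = "random_graph n c" and ?W = "\<Pi>\<^sub>M e\<in>all_edges n. D"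
  interpret W: prob_space ?W by (intro prob_space_PiM D.prob_space_axioms)
  interpret G: prob_space ?G by (rule prob_space_random_graph[OF s])
  interpret pair_sigma_finite ?G ?W ..
  have "AE w in ?W. w e \<in> {0..B}"
    by (rule AE_PiM_component[OF _ e]) (use AE D.prob_space_axioms in auto)
  moreover have [measurable]: "(\<lambda>x. snd x e) \<in> borel_measurable (?G \<Otimes>\<^sub>M ?W)"
  proof -
    have [measurable]: "(\<lambda>w. w e) \<in> borel_measurable ?W"
      using measurable_component_singleton[OF e, of "\<lambda>_. D"] by (simp cong: measurable_cong_sets)
    show ?thesis by measurable
  qed
  ultimately show "AE x in weighted_graph D n c. snd x e \<in> {0..B}"
    unfolding weighted_graph_def by (intro AE_pair_measure) simp_all
qed

theorem theorem3:
  fixes D :: "real measure" and B :: real and b :: nat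
  assumes "real_distribution D"
    and "AE x in D. x \<in> {0..B}"
    and "b \<ge> 1"
  shows "\<forall>c>0. \<exists>g::real. \<forall>\<epsilon>>0.
    (\<lambda>n. \<P>((E, w) in weighted_graph D n c.
        \<bar>max_weight_b_matching b E w / real n - g\<bar> > \<epsilon>)) \<longlonglongrightarrow> 0"
proof (intro allI impI)
  fix c :: real assume c: "c > 0"
  interpret D: real_distribution D by (rule assms(1))
  have B: "B \<ge> 0"
  proof (rule ccontr)
    assume "\<not> ?thesis"
    then have "AE x in D. False" using assms(2) by simp
    then show False by simp
  qed
  let ?m = "\<lambda>n. nat \<lfloor>c * real n\<rfloor>"
  let ?\<mu> = "\<lambda>n. subset_mean (all_edges n) (?m n) (mean_max D b B n)"
  obtain g where g: "(\<lambda>n. ?\<mu> n / n) \<longlonglongrightarrow> g"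
    using mean_max_convergent[OF assms(1) c B assms(3)] by (auto simp: convergent_def)
  show "\<exists>g::real. \<forall>\<epsilon>>0. (\<lambda>n. \<P>((E, w) in weighted_graph D n c.
        \<bar>max_weight_b_matching b E w / real n - g\<bar> > \<epsilon>)) \<longlonglongrightarrow> 0"
  proof (intro exI[of _ g] allI impI)
    fix \<epsilon> :: real assume \<epsilon>: "\<epsilon> > 0"
    let ?P = "\<lambda>n. \<P>((E, w) in weighted_graph D n c. \<bar>max_weight_b_matching b E w / real n - g\<bar> > \<epsilon>)"
    let ?C = "8 * c * B\<^sup>2 / \<epsilon>\<^sup>2"
    have "\<forall>\<^sub>F n in sequentially. dist (?\<mu> n / n) g < \<epsilon> / 2"
      using tendstoD[OF g, of "\<epsilon> / 2"] \<epsilon> by simp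
    with eventually_sparse[OF c] have "\<forall>\<^sub>F n in sequentially. ?P n \<le> ?C * inverse (real n)"
    proof eventually_elim
      case (elim n)
      let ?M = "weighted_graph D n c"
      let ?A = "{x \<in> space ?M. \<bar>(case x of (E, w) \<Rightarrow> clipped_max b B E w) - ?\<mu> n\<bar> \<ge> \<epsilon> * n / 2}"
      interpret M: prob_space ?M by (rule prob_space_weighted_graph_sparse[OF D.prob_space_axioms elim(1)])
      have n: "real n > 0" using elim by (auto simp: sparse_def)
      note clipped_max_measurable_weighted_graph[OF assms(1), measurable]
      \<comment> \<open>Almost surely clipping has no effect, and as the mean is within \<epsilon> / 2 of g, a deviation of more than \<epsilon> from g is one of more than \<epsilon> / 2 from the mean.\<close>
      have "?A \<in> sets ?M" by measurable
      moreover have "AE x in ?M. x \<in> {(E, w). (E, w) \<in> space ?M \<and> \<bar>max_weight_b_matching b E w / real n - g\<bar> > \<epsilon>} \<longrightarrow> x \<in> ?A"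
        using AE_weights_in_range[OF assms(1,2) elim(1)]
      proof eventually_elim
        case (elim x)
        show ?case
        proof
          assume x: "x \<in> {(E, w). (E, w) \<in> space ?M \<and> \<bar>max_weight_b_matching b E w / real n - g\<bar> > \<epsilon>}"
          obtain E w where Ew: "x = (E, w)" by (cases x)
          have "E \<subseteq> all_edges n"
            using x by (auto simp: Ew weighted_graph_def space_pair_measure random_graph_def
                space_uniform_count_measure graphs_with_edges_def)
          then have eq: "clipped_max b B E w = max_weight_b_matching b E w"
            using elim by (intro max_weight_b_matching_cong clip_id) (auto simp: Ew)
          have "\<bar>max_weight_b_matching b E w / n - ?\<mu> n / n\<bar> > \<epsilon> / 2"
          proof -
            have "\<epsilon> < \<bar>max_weight_b_matching b E w / n - g\<bar>" using x by (simp add: Ew)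
            moreover have "\<bar>?\<mu> n / n - g\<bar> < \<epsilon> / 2"
              using \<open>dist (?\<mu> n / n) g < \<epsilon> / 2\<close> by (simp only: dist_real_def)
            ultimately show ?thesis by linarith
          qed
          then have "\<bar>max_weight_b_matching b E w - ?\<mu> n\<bar> / n > \<epsilon> / 2"
            using n by (simp add: diff_divide_distrib[symmetric])
          then show "x \<in> ?A" using x n eq by (simp add: Ew field_simps)
        qed
      qed
      ultimately have "?P n \<le> M.prob ?A" by (intro M.finite_measure_mono_AE)
      also have "\<dots> \<le> 2 * (c * n) * B\<^sup>2 / (\<epsilon> * n / 2)\<^sup>2"
        by (rule clipped_max_concentration[OF assms(1) elim(1) B]) (use \<epsilon> n in simp)
      also have "\<dots> = ?C * inverse (real n)"
        using n \<epsilon> by (simp add: power2_eq_square field_simps)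
      finally show ?case .
    qed
    moreover have "(\<lambda>n. ?C * inverse (real n)) \<longlonglongrightarrow> 0"
      using tendsto_mult[OF tendsto_const lim_inverse_n[where 'a=real], of ?C] by simp
    moreover have "\<forall>\<^sub>F n in sequentially. 0 \<le> ?P n"
      by (intro always_eventually allI measure_nonneg)
    ultimately show "?P \<longlonglongrightarrow> 0"
      by - (rule tendsto_sandwich[OF _ _ tendsto_const])
  qed
qed



end
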